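(* Let $(B\subseteq A,\Omega^\bullet,\Omega^{(\bullet,\bullet)},\sigma)$ be a CQH-Hermitian space and let $\mathcal{F}$ be a covariant Hermitian module over $B$. Then for any $\omega\in\Omega^\bullet$, a bounded linear operator is given by $$L_\omega:\Omega^\bullet\otimes_B\mathcal{F}\to\Omega^\bullet\otimes_B\mathcal{F},\qquad \nu\otimes f\mapsto\omega\wedge\nu\otimes f.$$ Hence it admits an extension to a bounded linear operator on $L^2(\Omega^\bullet\otimes_B\mathcal{F})$.
   Context: All algebras are unital over $\mathbb{C}$. A differential calculus (dc) over an algebra $B$ is a differential graded algebra $(\Omega^\bullet=\bigoplus_{k\ge 0}\Omega^k,\mathrm{d})$ (product $\wedge$) with $\Omega^0=B$, generated as an algebra by the elements $a,\mathrm{d}b$, $a,b\in B$; it has total degree $m$ if $\Omega^m\ne 0$ and $\Omega^k=0$ for $k>m$. For $B$ a $*$-algebra, a $*$-dc is a dc such that $*$ extends to a conjugate-linear involution of $\Omega^\bullet$ with $\mathrm{d}(\omega^* )=(\mathrm{d}\omega)^*$ and $(\omega\wedge\nu)^*=(-1)^{kl}\nu^*\wedge\omega^*$ for $\omega\in\Omega^k$, $\nu\in\Omega^l$. A complex structure is a $\mathbb{Z}^2_{\ge0}$-algebra grading $\Omega^{(\bullet,\bullet)}$ with $\Omega^k=\bigoplus_{a+b=k}\Omega^{(a,b)}$, $(\Omega^{(a,b)})^*=\Omega^{(b,a)}$, such that $\mathrm{d}=\partial+\overline{\partial}$ with $\partial$ of degree $(1,0)$ and $\overline{\partial}$ of degree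 $(0,1)$. Hermitian structure $(\Omega^{(\bullet,\bullet)},\sigma)$ on a $*$-dc of total degree $2n$: a complex structure and a central real ($\sigma^*=\sigma$) form $\sigma\in\Omega^{(1,1)}$ such that, for $L_\sigma(\omega):=\sigma\wedge\omega$, the maps $L_\sigma^{n-k}:\Omega^k\to\Omega^{2n-k}$, $k=0,\dots,n-1$, are isomorphisms. Primitive forms: $P^k:=\{\alpha\in\Omega^k: L_\sigma^{n-k+1}(\alpha)=0\}$ for $k\le n$, $P^k:=0$ for $k>n$; one has $\Omega^k=\bigoplus_j L_\sigma^j(P^{k-2j})$. The Hodge map $\ast_\sigma$ is determined by $\ast_\sigma(L_\sigma^j(\alpha))=(-1)^{k(k+1)/2}\mathbf{i}^{a-b}\frac{j!}{(n-j-k)!}L_\sigma^{n-j-k}(\alpha)$ for $\alpha\in P^k\cap\Omega^{(a,b)}$, $a+b=k$. The metric is the sesquilinear form (conjugate-linear in the first variable) $g_\sigma:\Omega^\bullet\times\Omega^\bullet\to B$, $g_\sigma(\omega,\nu)=\ast_\sigma(\ast_\sigma(\omega^* )\wedge\nu)$ for $\omega,\nu$ of equal degree, zero for different degrees. $B_{>0}$ is the set of non-zero elements of the form $\sum_i b_i^*b_i$; the structure is positive definite if $g_\sigma(\omega,\omega)\in B_{>0}$ for all $\omega\neq0$. A CQGA is a cosemisimple Hopf $*$-algebra whose Haar functional $\mathbf{h}$ is a state. A quantum homogeneous $A$-space is a left coideal subalgebra $B\subseteq A$ with $A$ faithfully flat as right $B$-module and $B^+A=AB^+$, $B^+:=\ker(\varepsilon)\cap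 B$; put $\pi_B(A):=A/B^+A$. A CQGA-homogeneous space is a quantum homogeneous space $B\subseteq A$ with $A,\pi_B(A)$ CQGAs, $B$ a $*$-subalgebra, and $\pi_B:A\to\pi_B(A)$ a Hopf $*$-map. ${}^A_B\mathrm{mod}_0$ is the category of left relative Hopf modules (left $A$-comodules and left $B$-modules, compatibly) finitely generated over $B$, with right $B$-action $fb=f_{(-2)}bS(f_{(-1)})f_{(0)}$ (i.e. under $\mathcal{F}\cong A\,\square_{\pi_B}(\mathcal{F}/B^+\mathcal{F})$, $f\mapsto f_{(-1)}\otimes[f_{(0)}]$, right multiplication by $b$ on $A$). A CQH-Hermitian space is a quadruple $(B\subseteq A,\Omega^\bullet,\Omega^{(\bullet,\bullet)},\sigma)$ with $B\subseteq A$ a CQGA-homogeneous space, $\Omega^\bullet$ a left $A$-covariant $*$-dc over $B$ (an object of ${}^A_B\mathrm{mod}_0$, $\mathrm d$ a comodule map), and $(\Omega^{(\bullet,\bullet)},\sigma)$ a positive definite Hermitian structure which is covariant (the bigrading is one of objects of ${}^A_B\mathrm{mod}_0$, $\sigma$ is coinvariant) and $\int$-closed: for $\int:=\mathbf{h}\circ\ast_\sigma:\Omega^{2n}\to\mathbb{C}$ one has $\int\circ\,\mathrm{d}=0$ on $\Omega^{2n-1}$. Modules. For a $B$-bimodule $\mathcal{F}$, $\mathcal{F}^\vee$ is the bimodule of right $B$-module maps $\mathcal{F}\to B$ and $\overline{\mathcal{F}}$ the conjugate bimodule ($b\overline{f}=\overline{fb^*}$, $\overline{f}b=\overline{b^*f}$).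 A weak Hermitian module is a pair $(\mathcal{F},h_{\mathcal{F}})$ with $h_{\mathcal{F}}:\overline{\mathcal{F}}\to\mathcal{F}^\vee$ a bimodule isomorphism such that $h'_{\mathcal{F}}(f,k):=h_{\mathcal{F}}(\overline{f})(k)$ satisfies $h'_{\mathcal{F}}(f,k)=h'_{\mathcal{F}}(k,f)^*$ and $h'_{\mathcal{F}}(f,f)\in B_{>0}$ for $f\ne0$. It is an Hermitian module if $g_{\mathcal{F}}(\omega\otimes f,\nu\otimes k):=h'_{\mathcal{F}}(f,g_\sigma(\omega,\nu)k)$ makes $\Omega^\bullet\otimes_B\mathcal{F}$ a weak Hermitian module; covariant if $\mathcal{F}\in{}^A_B\mathrm{mod}_0$ and $h_{\mathcal{F}}$ is a morphism there. $L^2(\Omega^\bullet\otimes_B\mathcal{F})$ is the completion of $\Omega^\bullet\otimes_B\mathcal{F}$ for the inner product $\mathbf{h}\circ g_{\mathcal{F}}$, and bounded means bounded for its norm. *)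

theory Defs
  imports
    "HOL-Analysis.Elementary_Topology"
    "HOL-Library.Poly_Mapping"
    "HOL-Library.Function_Algebras"
    "HOL-Algebra.Group"
begin

section \<open>Complex vector spaces, algebras and Hilbert spaces\<close>

class scaleC =
  fixes scaleC :: "complex \<Rightarrow> 'a \<Rightarrow> 'a"  (infixr "*\<^sub>C" 75)

class complex_vector = ab_group_add + scaleC +
  assumes scaleC_add_right: "a *\<^sub>C (x + y) = a *\<^sub>C x + a *\<^sub>C y"
    and scaleC_add_left: "(a + b) *\<^sub>C x = a *\<^sub>C x + b *\<^sub>C x"
    and scaleC_scaleC: "a *\<^sub>C (b *\<^sub>C x) = (a * b) *\<^sub>C x"
    and scaleC_one: "1 *\<^sub>C x = x"

interpretation cvs: vector_space "scaleC :: complex \<Rightarrow> 'a \<Rightarrow> 'a::complex_vector"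
  by unfold_locales (simp_all add: scaleC_add_right scaleC_add_left scaleC_scaleC scaleC_one)

abbreviation csubspace :: "'a::complex_vector set \<Rightarrow> bool"
  where "csubspace \<equiv> module.subspace scaleC"

abbreviation cspan :: "'a::complex_vector set \<Rightarrow> 'a set"
  where "cspan \<equiv> module.span scaleC"

abbreviation clinear :: "('a::complex_vector \<Rightarrow> 'b::complex_vector) \<Rightarrow> bool"
  where "clinear \<equiv> Vector_Spaces.linear scaleC scaleC"

class complex_algebra_1 = complex_vector + ring_1 +
  assumes mult_scaleC_left: "(a *\<^sub>C x) * y = a *\<^sub>C (x * y)"
    and mult_scaleC_right: "x * (a *\<^sub>C y) = a *\<^sub>C (x * y)"

class complex_star_algebra = complex_algebra_1 +
  fixes star :: "'a \<Rightarrow> 'a"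
  assumes star_add: "star (x + y) = star x + star y"
    and star_scaleC: "star (a *\<^sub>C x) = cnj a *\<^sub>C star x"
    and star_mult: "star (x * y) = star y * star x"
    and star_star: "star (star x) = x"

text \<open>The inner product is conjugate-linear in the first variable.\<close>

class chilbert_space = complex_vector + banach +
  fixes cinner :: "'a \<Rightarrow> 'a \<Rightarrow> complex"
  assumes scaleR_eq_scaleC: "r *\<^sub>R x = complex_of_real r *\<^sub>C x"
    and cinner_add_right: "cinner x (y + z) = cinner x y + cinner x z"
    and cinner_scaleC_right: "cinner x (a *\<^sub>C y) = a * cinner x y"
    and cinner_commute: "cinner x y = cnj (cinner y x)"
    and norm_eq_sqrt_cinner: "norm x = sqrt (Re (cinner x x))"

definition bounded_clinear :: "('a::chilbert_space \<Rightarrow> 'b::chilbert_space) \<Rightarrow> bool"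
  where "bounded_clinear T \<longleftrightarrow> clinear T \<and> (\<exists>K. \<forall>x. norm (T x) \<le> K * norm x)"

instantiation complex :: complex_algebra_1
begin
definition scaleC_complex :: "complex \<Rightarrow> complex \<Rightarrow> complex"
  where "scaleC_complex a x = a * x"
instance by standard (simp_all add: scaleC_complex_def algebra_simps)
end

instantiation "fun" :: (type, complex_vector) complex_vector
begin
definition scaleC_fun :: "complex \<Rightarrow> ('a \<Rightarrow> 'b) \<Rightarrow> 'a \<Rightarrow> 'b"
  where "scaleC_fun a f = (\<lambda>x. a *\<^sub>C f x)"
instance
  by standard (simp_all add: scaleC_fun_def fun_eq_iff scaleC_add_right scaleC_add_left
      scaleC_scaleC scaleC_one)
end

instantiation poly_mapping :: (type, complex_vector) complex_vector
begin
lift_definition scaleC_poly_mapping :: "complex \<Rightarrow> ('a \<Rightarrow>\<^sub>0 'b) \<Rightarrow> 'a \<Rightarrow>\<^sub>0 'b"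
  is "\<lambda>a f x. a *\<^sub>C f x"
proof -
  fix a :: complex and f :: "'a \<Rightarrow> 'b"
  assume "finite {x. f x \<noteq> 0}"
  moreover have "{x. a *\<^sub>C f x \<noteq> 0} \<subseteq> {x. f x \<noteq> 0}" by auto
  ultimately show "finite {x. a *\<^sub>C f x \<noteq> 0}" by (rule rev_finite_subset)
qed
instance
  by standard (transfer; simp add: fun_eq_iff scaleC_add_right scaleC_add_left
      scaleC_scaleC scaleC_one)+
end


section \<open>Tensor products over the complex numbers\<close>

definition tensor_relations :: "('a::complex_vector \<times> 'b::complex_vector \<Rightarrow>\<^sub>0 complex) set"
  where "tensor_relations = cspan
    ({Poly_Mapping.single (v + v', w) 1 - Poly_Mapping.single (v, w) 1
        - Poly_Mapping.single (v', w) 1 | v v' w. True}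
   \<union> {Poly_Mapping.single (v, w + w') 1 - Poly_Mapping.single (v, w) 1
        - Poly_Mapping.single (v, w') 1 | v w w'. True}
   \<union> {Poly_Mapping.single (c *\<^sub>C v, w) 1 - Poly_Mapping.single (v, w) c | c v w. True}
   \<union> {Poly_Mapping.single (v, c *\<^sub>C w) 1 - Poly_Mapping.single (v, w) c | c v w. True})"

lemma subspace_tensor_relations: "csubspace tensor_relations"
  unfolding tensor_relations_def by (rule cvs.subspace_span)

lemma equivp_tensor_relations: "equivp (\<lambda>x y. x - y \<in> tensor_relations)"
proof (intro equivpI reflpI sympI transpI)
  fix x y z :: "'a \<times> 'b \<Rightarrow>\<^sub>0 complex"
  show "x - x \<in> tensor_relations"
    by (simp add: cvs.subspace_0[OF subspace_tensor_relations])
  show "y - x \<in> tensor_relations" if "x - y \<in> tensor_relations"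
    using cvs.subspace_neg[OF subspace_tensor_relations that] by simp
  show "x - z \<in> tensor_relations" if "x - y \<in> tensor_relations" "y - z \<in> tensor_relations"
    using cvs.subspace_add[OF subspace_tensor_relations that] by simp
qed

quotient_type (overloaded) ('a, 'b) tensor =
    "('a::complex_vector \<times> 'b::complex_vector) \<Rightarrow>\<^sub>0 complex"
  / "\<lambda>x y. x - y \<in> tensor_relations"
  by (rule equivp_tensor_relations)

instantiation tensor :: (complex_vector, complex_vector) complex_vector
begin
lift_definition zero_tensor :: "('a, 'b) tensor" is 0 .
lift_definition plus_tensor :: "('a, 'b) tensor \<Rightarrow> ('a, 'b) tensor \<Rightarrow> ('a, 'b) tensor" is plus
  subgoal premises p for x x' y y'
    using cvs.subspace_add[OF subspace_tensor_relations p] by (simp add: algebra_simps)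
  done
lift_definition uminus_tensor :: "('a, 'b) tensor \<Rightarrow> ('a, 'b) tensor" is uminus
  subgoal premises p for x x'
    using cvs.subspace_neg[OF subspace_tensor_relations p] by (simp add: algebra_simps)
  done
lift_definition minus_tensor :: "('a, 'b) tensor \<Rightarrow> ('a, 'b) tensor \<Rightarrow> ('a, 'b) tensor" is minus
  subgoal premises p for x x' y y'
    using cvs.subspace_diff[OF subspace_tensor_relations p] by (simp add: algebra_simps)
  done
lift_definition scaleC_tensor :: "complex \<Rightarrow> ('a, 'b) tensor \<Rightarrow> ('a, 'b) tensor" is scaleC
  subgoal premises p for c x x'
    using cvs.subspace_scale[OF subspace_tensor_relations p, of c]
    by (simp add: cvs.scale_right_diff_distrib)
  done
instance
  by standard (transfer;
      simp add: cvs.subspace_0[OF subspace_tensor_relations] algebra_simps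
        scaleC_add_right scaleC_add_left scaleC_scaleC scaleC_one)+
end

lift_definition tens :: "'a::complex_vector \<Rightarrow> 'b::complex_vector \<Rightarrow> ('a, 'b) tensor"
    (infixr "\<otimes>\<^sub>C" 72)
  is "\<lambda>v w. Poly_Mapping.single (v, w) 1" .

text \<open>
  \<open>tlift \<beta>\<close> is the additive map \<open>v \<otimes> w \<mapsto> \<beta> v w\<close>. It is computed on an arbitrary representing
  formal sum, hence meaningful when \<open>\<beta>\<close> is biadditive with \<open>\<beta> (c v) w = \<beta> v (c w)\<close>. Absorbing the
  coefficients into the first leg makes it cover both bilinear maps and maps that are
  conjugate-linear in both variables; see \<open>tlift_tens\<close>.
\<close>

definition tlift ::
    "('a::complex_vector \<Rightarrow> 'b::complex_vector \<Rightarrow> 'c::ab_group_add) \<Rightarrow> ('a, 'b) tensor \<Rightarrow> 'c"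
  where "tlift \<beta> t = (\<Sum>p\<in>Poly_Mapping.keys (rep_tensor t).
           \<beta> (Poly_Mapping.lookup (rep_tensor t) p *\<^sub>C fst p) (snd p))"

definition tmap :: "('a::complex_vector \<Rightarrow> 'c::complex_vector) \<Rightarrow>
    ('b::complex_vector \<Rightarrow> 'd::complex_vector) \<Rightarrow> ('a, 'b) tensor \<Rightarrow> ('c, 'd) tensor"
  where "tmap f g = tlift (\<lambda>v w. f v \<otimes>\<^sub>C g w)"

definition tassoc :: "(('a::complex_vector, 'b::complex_vector) tensor, 'c::complex_vector) tensor
    \<Rightarrow> ('a, ('b, 'c) tensor) tensor"
  where "tassoc = tlift (\<lambda>t w. tlift (\<lambda>u v. u \<otimes>\<^sub>C (v \<otimes>\<^sub>C w)) t)"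

definition tmult :: "('a::complex_algebra_1, 'b::complex_algebra_1) tensor \<Rightarrow>
    ('a, 'b) tensor \<Rightarrow> ('a, 'b) tensor"
  where "tmult s t = tlift (\<lambda>u v. tlift (\<lambda>u' v'. (u * u') \<otimes>\<^sub>C (v * v')) t) s"

text \<open>The image of \<open>V \<otimes> W\<close> in the tensor product of the ambient spaces.\<close>

definition tensor_subspace ::
    "'a::complex_vector set \<Rightarrow> 'b::complex_vector set \<Rightarrow> ('a, 'b) tensor set"
  where "tensor_subspace V W = cspan {v \<otimes>\<^sub>C w | v w. v \<in> V \<and> w \<in> W}"

definition balanced ::
    "('a::complex_vector \<Rightarrow> 'b::complex_vector \<Rightarrow> 'c::ab_group_add) \<Rightarrow> bool"
  where "balanced \<beta> \<longleftrightarrow>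
    (\<forall>v v' w. \<beta> (v + v') w = \<beta> v w + \<beta> v' w) \<and>
    (\<forall>v w w'. \<beta> v (w + w') = \<beta> v w + \<beta> v w') \<and>
    (\<forall>c v w. \<beta> (c *\<^sub>C v) w = \<beta> v (c *\<^sub>C w))"

context
  fixes \<beta> :: "'a::complex_vector \<Rightarrow> 'b::complex_vector \<Rightarrow> 'c::ab_group_add"
  assumes bal: "balanced \<beta>"
begin

private definition ev :: "('a \<times> 'b \<Rightarrow>\<^sub>0 complex) \<Rightarrow> 'c"
  where "ev x = (\<Sum>p\<in>Poly_Mapping.keys x. \<beta> (Poly_Mapping.lookup x p *\<^sub>C fst p) (snd p))"

private lemma b_add1: "\<beta> (v + v') w = \<beta> v w + \<beta> v' w" using bal by (simp add: balanced_def)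
private lemma b_add2: "\<beta> v (w + w') = \<beta> v w + \<beta> v w'" using bal by (simp add: balanced_def)
private lemma b_bal: "\<beta> (c *\<^sub>C v) w = \<beta> v (c *\<^sub>C w)" using bal by (simp add: balanced_def)
private lemma b_zero1: "\<beta> 0 w = 0" using b_add1[of 0 0 w] by simp

private lemma ev_superset:
  assumes "finite S" "Poly_Mapping.keys x \<subseteq> S"
  shows "ev x = (\<Sum>p\<in>S. \<beta> (Poly_Mapping.lookup x p *\<^sub>C fst p) (snd p))"
  unfolding ev_def using assms
  by (intro sum.mono_neutral_left) (auto simp: in_keys_iff b_zero1)

private lemma ev_add: "ev (x + y) = ev x + ev y"
proof -
  let ?S = "Poly_Mapping.keys x \<union> Poly_Mapping.keys y"
  have "Poly_Mapping.keys (x + y) \<subseteq> ?S" by (rule Poly_Mapping.keys_add)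
  then show ?thesis
    by (simp add: ev_superset[of ?S] lookup_add scaleC_add_left b_add1 sum.distrib)
qed

private lemma ev_0: "ev 0 = 0" by (simp add: ev_def)

private lemma ev_diff: "ev (x - y) = ev x - ev y"
  using ev_add[of "x - y" y] by simp

private lemma ev_single: "ev (Poly_Mapping.single (v, w) c) = \<beta> (c *\<^sub>C v) w"
  by (cases "c = 0") (simp_all add: ev_def b_zero1)

private lemma scaleC_single:
  "c *\<^sub>C Poly_Mapping.single p (e::complex) = Poly_Mapping.single p (c * e)"
  by transfer (auto simp: fun_eq_iff when_def scaleC_complex_def)

private lemma ev_relations: "x \<in> tensor_relations \<Longrightarrow> ev x = 0"
  unfolding tensor_relations_def
proof (induction rule: cvs.span_induct_alt)
  case base
  show ?case by (rule ev_0)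
next
  case (step c x y)
  have "ev (c *\<^sub>C x) = 0"
    using step.hyps(1)
    by (auto simp: cvs.scale_right_diff_distrib scaleC_single ev_diff ev_single b_add1 b_add2
        scaleC_add_right scaleC_scaleC b_bal)
  then show ?case using step.IH by (simp add: ev_add)
qed

private lemma tlift_abs: "tlift \<beta> (abs_tensor x) = ev x"
proof -
  have "rep_tensor (abs_tensor x) - x \<in> tensor_relations"
    by (rule Quotient_rep_abs[OF Quotient_tensor])
       (simp add: cvs.subspace_0[OF subspace_tensor_relations])
  then have "ev (rep_tensor (abs_tensor x)) = ev x"
    using ev_relations ev_diff by force
  then show ?thesis by (simp add: tlift_def ev_def)
qed

lemma tlift_tens: "tlift \<beta> (v \<otimes>\<^sub>C w) = \<beta> v w"
  by (simp add: tens.abs_eq tlift_abs ev_single scaleC_one)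

lemma tlift_add: "tlift \<beta> (s + t) = tlift \<beta> s + tlift \<beta> t"
  by (induction s rule: tensor.abs_induct, induction t rule: tensor.abs_induct)
     (simp add: plus_tensor.abs_eq tlift_abs ev_add)

end


section \<open>Compact quantum group algebras\<close>

record (overloaded) 'a hopf =
  comult :: "'a \<Rightarrow> ('a, 'a) tensor"
  counit :: "'a \<Rightarrow> complex"
  antipode :: "'a \<Rightarrow> 'a"

locale hopf_star_algebra =
  fixes A :: "'a::complex_star_algebra hopf"
  assumes comult_linear: "clinear (comult A)"
    and counit_linear: "clinear (counit A)"
    and antipode_linear: "clinear (antipode A)"
    and coassoc: "tassoc (tmap (comult A) id (comult A a)) = tmap id (comult A) (comult A a)"
    and counit_left: "tlift (\<lambda>x y. counit A x *\<^sub>C y) (comult A a) = a"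
    and counit_right: "tlift (\<lambda>x y. counit A y *\<^sub>C x) (comult A a) = a"
    and comult_mult: "comult A (a * b) = tmult (comult A a) (comult A b)"
    and comult_one: "comult A 1 = 1 \<otimes>\<^sub>C 1"
    and counit_mult: "counit A (a * b) = counit A a * counit A b"
    and counit_one: "counit A 1 = 1"
    and antipode_left: "tlift (\<lambda>x y. antipode A x * y) (comult A a) = counit A a *\<^sub>C 1"
    and antipode_right: "tlift (\<lambda>x y. x * antipode A y) (comult A a) = counit A a *\<^sub>C 1"
    and comult_star: "comult A (star a) = tmap star star (comult A a)"
    and counit_star: "counit A (star a) = cnj (counit A a)"

definition subcoalgebra :: "'a::complex_star_algebra hopf \<Rightarrow> 'a set \<Rightarrow> bool"
  where "subcoalgebra A C \<longleftrightarrow> csubspace C \<and> (\<forall>c\<in>C. comult A c \<in> tensor_subspace C C)"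

definition simple_subcoalgebra :: "'a::complex_star_algebra hopf \<Rightarrow> 'a set \<Rightarrow> bool"
  where "simple_subcoalgebra A C \<longleftrightarrow> subcoalgebra A C \<and> C \<noteq> {0} \<and>
    (\<forall>D. subcoalgebra A D \<and> D \<subseteq> C \<longrightarrow> D = {0} \<or> D = C)"

definition haar_functional :: "'a::complex_star_algebra hopf \<Rightarrow> ('a \<Rightarrow> complex) \<Rightarrow> bool"
  where "haar_functional A h \<longleftrightarrow> clinear h \<and> h 1 = 1 \<and>
    (\<forall>a. tlift (\<lambda>x y. h y *\<^sub>C x) (comult A a) = h a *\<^sub>C 1) \<and>
    (\<forall>a. tlift (\<lambda>x y. h x *\<^sub>C y) (comult A a) = h a *\<^sub>C 1)"

definition haar :: "'a::complex_star_algebra hopf \<Rightarrow> 'a \<Rightarrow> complex"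
  where "haar A = (THE h. haar_functional A h)"

text \<open>Cosemisimplicity: the coalgebra is the sum of its simple subcoalgebras.\<close>

locale cqga = hopf_star_algebra A for A :: "'a::complex_star_algebra hopf" +
  assumes cosemisimple: "cspan (\<Union>{C. simple_subcoalgebra A C}) = UNIV"
    and haar_exists: "\<exists>h. haar_functional A h"
    and haar_state: "haar A (star a * a) \<in> \<real> \<and> 0 \<le> Re (haar A (star a * a))"


section \<open>Faithful flatness\<close>

text \<open>Left modules over a ring, as (multiplicatively written) commutative groups with an action.\<close>

definition left_module :: "('m, 'z) monoid_scheme \<Rightarrow> ('b::ring_1 \<Rightarrow> 'm \<Rightarrow> 'm) \<Rightarrow> bool"
  where "left_module M act \<longleftrightarrow> comm_group M \<and>
    (\<forall>b. act b \<in> hom M M) \<and>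
    (\<forall>b b'. \<forall>m\<in>carrier M. act (b + b') m = act b m \<otimes>\<^bsub>M\<^esub> act b' m) \<and>
    (\<forall>b b'. \<forall>m\<in>carrier M. act (b * b') m = act b (act b' m)) \<and>
    (\<forall>m\<in>carrier M. act 1 m = m)"

definition left_module_hom :: "('m, 'z) monoid_scheme \<Rightarrow> ('b::ring_1 \<Rightarrow> 'm \<Rightarrow> 'm) \<Rightarrow>
    ('n, 'y) monoid_scheme \<Rightarrow> ('b \<Rightarrow> 'n \<Rightarrow> 'n) \<Rightarrow> ('m \<Rightarrow> 'n) set"
  where "left_module_hom M actM N actN =
    {f \<in> hom M N. \<forall>b. \<forall>m\<in>carrier M. f (actM b m) = actN b (f m)}"

text \<open>
  For a ring map \<open>\<iota> : B \<rightarrow> A\<close> and a left \<open>B\<close>-module \<open>M\<close>, \<open>A \<otimes>\<^sub>B M\<close> is the group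
  \<open>free_tensor M\<close> of formal integer combinations of pairs modulo \<open>tensor_rel \<iota> M act\<close>.
\<close>

definition free_tensor :: "('m, 'z) monoid_scheme \<Rightarrow> ('a \<times> 'm \<Rightarrow>\<^sub>0 int) set"
  where "free_tensor M = {x. Poly_Mapping.keys x \<subseteq> UNIV \<times> carrier M}"

inductive_set tensor_rel ::
    "('b::ring_1 \<Rightarrow> 'a::ring_1) \<Rightarrow> ('m, 'z) monoid_scheme \<Rightarrow> ('b \<Rightarrow> 'm \<Rightarrow> 'm) \<Rightarrow>
     ('a \<times> 'm \<Rightarrow>\<^sub>0 int) set"
  for \<iota> :: "'b::ring_1 \<Rightarrow> 'a::ring_1" and M :: "('m, 'z) monoid_scheme" and act
  where
    zero: "0 \<in> tensor_rel \<iota> M act"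
  | diff: "\<lbrakk>x \<in> tensor_rel \<iota> M act; y \<in> tensor_rel \<iota> M act\<rbrakk> \<Longrightarrow> x - y \<in> tensor_rel \<iota> M act"
  | add_left: "m \<in> carrier M \<Longrightarrow>
      frag_of (a + a', m) - frag_of (a, m) - frag_of (a', m) \<in> tensor_rel \<iota> M act"
  | add_right: "\<lbrakk>m \<in> carrier M; m' \<in> carrier M\<rbrakk> \<Longrightarrow>
      frag_of (a, m \<otimes>\<^bsub>M\<^esub> m') - frag_of (a, m) - frag_of (a, m') \<in> tensor_rel \<iota> M act"
  | balance: "m \<in> carrier M \<Longrightarrow>
      frag_of (a * \<iota> b, m) - frag_of (a, act b m) \<in> tensor_rel \<iota> M act"

definition free_tensor_map :: "('m \<Rightarrow> 'n) \<Rightarrow> ('a \<times> 'm \<Rightarrow>\<^sub>0 int) \<Rightarrow> ('a \<times> 'n \<Rightarrow>\<^sub>0 int)"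
  where "free_tensor_map f = frag_extend (\<lambda>(a, m). frag_of (a, f m))"

definition exact_at ::
    "('m, 'z) monoid_scheme \<Rightarrow> ('m \<Rightarrow> 'n) \<Rightarrow> ('n, 'y) monoid_scheme \<Rightarrow> ('n \<Rightarrow> 'p) \<Rightarrow>
     ('p, 'x) monoid_scheme \<Rightarrow> bool"
  where "exact_at M f N g P \<longleftrightarrow> f ` carrier M = {n \<in> carrier N. g n = \<one>\<^bsub>P\<^esub>}"

text \<open>Exactness of \<open>A \<otimes>\<^sub>B M \<rightarrow> A \<otimes>\<^sub>B N \<rightarrow> A \<otimes>\<^sub>B P\<close>, in terms of representatives.\<close>

definition tensor_exact_at ::
    "('b::ring_1 \<Rightarrow> 'a::ring_1) \<Rightarrow>
     ('m, 'z) monoid_scheme \<Rightarrow> ('m \<Rightarrow> 'n) \<Rightarrow>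
     ('n, 'y) monoid_scheme \<Rightarrow> ('b \<Rightarrow> 'n \<Rightarrow> 'n) \<Rightarrow> ('n \<Rightarrow> 'p) \<Rightarrow>
     ('p, 'x) monoid_scheme \<Rightarrow> ('b \<Rightarrow> 'p \<Rightarrow> 'p) \<Rightarrow> bool"
  where "tensor_exact_at \<iota> M f N actN g P actP \<longleftrightarrow>
    {free_tensor_map f x + r | x r. x \<in> free_tensor M \<and> r \<in> tensor_rel \<iota> N actN} =
    {y \<in> free_tensor N. free_tensor_map g y \<in> tensor_rel \<iota> P actP}"

text \<open>
  \<open>A\<close> is faithfully flat as a right \<open>B\<close>-module: \<open>A \<otimes>\<^sub>B -\<close> preserves and reflects exactness.
  The modules range over carriers in \<open>'b set\<close>. This is no restriction: up to isomorphism this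
  includes all left ideals and all cyclic modules (whose elements are cosets), which suffice to
  detect faithful flatness.
\<close>

definition faithfully_flat :: "('b::ring_1 \<Rightarrow> 'a::ring_1) \<Rightarrow> bool"
  where "faithfully_flat \<iota> \<longleftrightarrow>
    (\<forall>(M :: 'b set monoid) actM (N :: 'b set monoid) actN (P :: 'b set monoid) actP f g.
       left_module M actM \<and> left_module N actN \<and> left_module P actP \<and>
       f \<in> left_module_hom M actM N actN \<and> g \<in> left_module_hom N actN P actP \<longrightarrow>
       (exact_at M f N g P \<longleftrightarrow> tensor_exact_at \<iota> M f N actN g P actP))"


section \<open>Quantum homogeneous spaces\<close>

text \<open>
  The subalgebra \<open>B \<subseteq> A\<close> is given by its inclusion \<open>\<iota>\<close>, and the quotient \<open>\<pi>\<^sub>B(A) = A / B\<^sup>+A\<close> by a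
  surjection \<open>\<pi>\<close> with kernel \<open>B\<^sup>+A\<close>. The left coideal condition \<open>\<Delta>(B) \<subseteq> A \<otimes> B\<close> is the existence of
  the (unique) corestriction \<open>\<Delta>\<^sub>B\<close>.
\<close>

locale cqga_homogeneous_space = cqga A + quotient: cqga H
  for A :: "'a::complex_star_algebra hopf"
    and H :: "'p::complex_star_algebra hopf" +
  fixes \<iota> :: "'b::complex_star_algebra \<Rightarrow> 'a::complex_star_algebra"
    and \<Delta>\<^sub>B :: "'b \<Rightarrow> ('a, 'b) tensor"
    and \<pi> :: "'a \<Rightarrow> 'p::complex_star_algebra"
  assumes incl_linear: "clinear \<iota>"
    and incl_inj: "inj \<iota>"
    and incl_mult: "\<iota> (b * b') = \<iota> b * \<iota> b'"
    and incl_one: "\<iota> 1 = 1"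
    and incl_star: "\<iota> (star b) = star (\<iota> b)"
    and coideal: "tmap id \<iota> (\<Delta>\<^sub>B b) = comult A (\<iota> b)"
    and flat: "faithfully_flat \<iota>"
    and augmentation_ideal:
      "cspan {\<iota> b * a | a b. counit A (\<iota> b) = 0} = cspan {a * \<iota> b | a b. counit A (\<iota> b) = 0}"
    and proj_surj: "surj \<pi>"
    and proj_kernel: "{a. \<pi> a = 0} = cspan {\<iota> b * a | a b. counit A (\<iota> b) = 0}"
    and proj_linear: "clinear \<pi>"
    and proj_mult: "\<pi> (a * a') = \<pi> a * \<pi> a'"
    and proj_one: "\<pi> 1 = 1"
    and proj_comult: "comult H (\<pi> a) = tmap \<pi> \<pi> (comult A a)"
    and proj_counit: "counit H (\<pi> a) = counit A a"
    and proj_antipode: "antipode H (\<pi> a) = \<pi> (antipode A a)"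
    and proj_star: "\<pi> (star a) = star (\<pi> a)"


section \<open>Bimodules and relative Hopf modules\<close>

locale bimodule =
  fixes lact :: "'b::complex_algebra_1 \<Rightarrow> 'm::complex_vector \<Rightarrow> 'm"
    and ract :: "'m \<Rightarrow> 'b \<Rightarrow> 'm"
  assumes lact_linear_left: "clinear (\<lambda>b. lact b m)"
    and lact_linear_right: "clinear (lact b)"
    and lact_mult: "lact (b * b') m = lact b (lact b' m)"
    and lact_one: "lact 1 m = m"
    and ract_linear_left: "clinear (\<lambda>m. ract m b)"
    and ract_linear_right: "clinear (ract m)"
    and ract_mult: "ract m (b * b') = ract (ract m b) b'"
    and ract_one: "ract m 1 = m"
    and lact_ract: "ract (lact b m) b' = lact b (ract m b')"

definition left_comodule :: "'a::complex_star_algebra hopf \<Rightarrow> ('m::complex_vector \<Rightarrow> ('a, 'm) tensor) \<Rightarrow> bool"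
  where "left_comodule A \<delta> \<longleftrightarrow> clinear \<delta> \<and>
    (\<forall>m. tassoc (tmap (comult A) id (\<delta> m)) = tmap id \<delta> (\<delta> m)) \<and>
    (\<forall>m. tlift (\<lambda>a m'. counit A a *\<^sub>C m') (\<delta> m) = m)"

definition finitely_generated_on ::
    "('b \<Rightarrow> 'm::complex_vector \<Rightarrow> 'm) \<Rightarrow> 'm set \<Rightarrow> bool"
  where "finitely_generated_on lact V \<longleftrightarrow>
    (\<exists>G. finite G \<and> G \<subseteq> V \<and> (\<forall>m\<in>V. \<exists>c. m = (\<Sum>x\<in>G. lact (c x) x)))"

text \<open>
  Objects of \<open>{}\<^sup>A\<^sub>Bmod\<^sub>0\<close>. The condition \<open>right_action\<close> is
  \<open>f b = f\<^sub>(\<^sub>-\<^sub>2\<^sub>) b S(f\<^sub>(\<^sub>-\<^sub>1\<^sub>)) f\<^sub>(\<^sub>0\<^sub>)\<close>, where the tensor \<open>f\<^sub>(\<^sub>-\<^sub>2\<^sub>) b S(f\<^sub>(\<^sub>-\<^sub>1\<^sub>)) \<otimes> f\<^sub>(\<^sub>0\<^sub>)\<close>, a priori in \<open>A \<otimes> F\<close>,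
  lies in (the image of) \<open>B \<otimes> F\<close>, so that the left action of \<open>B\<close> can be applied to it.
\<close>

locale relative_hopf_module_0 = bimodule lact ract
  for A :: "'a::complex_star_algebra hopf"
    and \<iota> :: "'b::complex_star_algebra \<Rightarrow> 'a"
    and \<Delta>\<^sub>B :: "'b \<Rightarrow> ('a, 'b) tensor"
    and lact :: "'b \<Rightarrow> 'm::complex_vector \<Rightarrow> 'm"
    and ract :: "'m \<Rightarrow> 'b \<Rightarrow> 'm"
    and \<delta> :: "'m \<Rightarrow> ('a, 'm) tensor" +
  assumes comodule: "left_comodule A \<delta>"
    and compatible: "\<delta> (lact b m) =
      tlift (\<lambda>a b'. tlift (\<lambda>a' m'. (a * a') \<otimes>\<^sub>C lact b' m') (\<delta> m)) (\<Delta>\<^sub>B b)"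
    and finitely_generated: "finitely_generated_on lact UNIV"
    and right_action: "\<exists>t :: ('b, 'm) tensor.
      tmap \<iota> id t = tmap (tlift (\<lambda>a a'. a * \<iota> b * antipode A a')) id (tmap (comult A) id (\<delta> m)) \<and>
      ract m b = tlift lact t"

definition relative_hopf_subobject_0 ::
    "('b \<Rightarrow> 'm::complex_vector \<Rightarrow> 'm) \<Rightarrow> ('m \<Rightarrow> 'b \<Rightarrow> 'm) \<Rightarrow>
     ('m \<Rightarrow> ('a::complex_vector, 'm) tensor) \<Rightarrow> 'm set \<Rightarrow> bool"
  where "relative_hopf_subobject_0 lact ract \<delta> V \<longleftrightarrow> csubspace V \<and>
    (\<forall>b. \<forall>m\<in>V. lact b m \<in> V) \<and> (\<forall>b. \<forall>m\<in>V. ract m b \<in> V) \<and>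
    (\<forall>m\<in>V. \<delta> m \<in> tensor_subspace UNIV V) \<and> finitely_generated_on lact V"

text \<open>
  A model \<open>\<tau> : V \<times> W \<rightarrow> E\<close> of \<open>V \<otimes>\<^sub>B W\<close>: the space \<open>E\<close> is the quotient of \<open>V \<otimes> W\<close> by the span of
  the elements \<open>v b \<otimes> w - v \<otimes> b w\<close>.
\<close>

definition balanced_tensor_product ::
    "('v::complex_vector \<Rightarrow> 'b \<Rightarrow> 'v) \<Rightarrow> ('b \<Rightarrow> 'w::complex_vector \<Rightarrow> 'w) \<Rightarrow>
     ('v \<Rightarrow> 'w \<Rightarrow> 'e::complex_vector) \<Rightarrow> bool"
  where "balanced_tensor_product ract lact \<tau> \<longleftrightarrow>
    (\<forall>v. clinear (\<tau> v)) \<and> (\<forall>w. clinear (\<lambda>v. \<tau> v w)) \<and>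
    surj (tlift \<tau>) \<and>
    {t. tlift \<tau> t = 0} = cspan {ract v b \<otimes>\<^sub>C w - v \<otimes>\<^sub>C lact b w | v b w. True}"

text \<open>The map \<open>v \<otimes>\<^sub>B w \<mapsto> \<beta> v w\<close> on a model \<open>\<tau>\<close>, for \<open>\<beta>\<close> balanced over \<open>B\<close>.\<close>

definition blift :: "('v::complex_vector \<Rightarrow> 'w::complex_vector \<Rightarrow> 'e::complex_vector) \<Rightarrow>
    ('v \<Rightarrow> 'w \<Rightarrow> 'x::ab_group_add) \<Rightarrow> 'e \<Rightarrow> 'x"
  where "blift \<tau> \<beta> e = tlift \<beta> (SOME t. tlift \<tau> t = e)"


section \<open>Differential calculi and Hermitian structures\<close>

definition direct_sum_decomposition :: "('i \<Rightarrow> 'v::complex_vector set) \<Rightarrow> bool"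
  where "direct_sum_decomposition V \<longleftrightarrow> (\<forall>i. csubspace (V i)) \<and>
    (\<forall>v. \<exists>!f. finite {i. f i \<noteq> 0} \<and> (\<forall>i. f i \<in> V i) \<and> v = (\<Sum>i | f i \<noteq> 0. f i))"

definition component :: "('i \<Rightarrow> 'v::complex_vector set) \<Rightarrow> 'i \<Rightarrow> 'v \<Rightarrow> 'v"
  where "component V i v =
    (THE f. finite {i. f i \<noteq> 0} \<and> (\<forall>i. f i \<in> V i) \<and> v = (\<Sum>i | f i \<noteq> 0. f i)) i"

text \<open>A \<open>*\<close>-dc over \<open>B\<close>, with \<open>\<Omega>\<^sup>0\<close> identified with \<open>B\<close> along \<open>\<eta>\<close>.\<close>

locale star_dc =
  fixes \<eta> :: "'b::complex_star_algebra \<Rightarrow> 'w::complex_algebra_1"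
    and \<Omega> :: "nat \<Rightarrow> 'w set"
    and d :: "'w \<Rightarrow> 'w"
    and st :: "'w \<Rightarrow> 'w"
  assumes grading: "direct_sum_decomposition \<Omega>"
    and grading_mult: "\<lbrakk>\<omega> \<in> \<Omega> k; \<nu> \<in> \<Omega> l\<rbrakk> \<Longrightarrow> \<omega> * \<nu> \<in> \<Omega> (k + l)"
    and degree_zero_linear: "clinear \<eta>"
    and degree_zero_inj: "inj \<eta>"
    and degree_zero_range: "range \<eta> = \<Omega> 0"
    and degree_zero_mult: "\<eta> (b * b') = \<eta> b * \<eta> b'"
    and degree_zero_one: "\<eta> 1 = 1"
    and d_linear: "clinear d"
    and d_degree: "\<omega> \<in> \<Omega> k \<Longrightarrow> d \<omega> \<in> \<Omega> (Suc k)"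
    and d_squared: "d (d \<omega>) = 0"
    and d_leibniz: "\<omega> \<in> \<Omega> k \<Longrightarrow> d (\<omega> * \<nu>) = d \<omega> * \<nu> + (- 1) ^ k * (\<omega> * d \<nu>)"
    and generated: "\<lbrakk>csubspace T; 1 \<in> T; \<And>x y. \<lbrakk>x \<in> T; y \<in> T\<rbrakk> \<Longrightarrow> x * y \<in> T;
        \<And>b. \<eta> b \<in> T; \<And>b. d (\<eta> b) \<in> T\<rbrakk> \<Longrightarrow> T = UNIV"
    and st_extends: "st (\<eta> b) = \<eta> (star b)"
    and st_add: "st (\<omega> + \<nu>) = st \<omega> + st \<nu>"
    and st_scaleC: "st (c *\<^sub>C \<omega>) = cnj c *\<^sub>C st \<omega>"
    and st_st: "st (st \<omega>) = \<omega>"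
    and st_d: "d (st \<omega>) = st (d \<omega>)"
    and st_mult: "\<lbrakk>\<omega> \<in> \<Omega> k; \<nu> \<in> \<Omega> l\<rbrakk> \<Longrightarrow> st (\<omega> * \<nu>) = (- 1) ^ (k * l) * (st \<nu> * st \<omega>)"

definition total_degree :: "(nat \<Rightarrow> 'w::complex_vector set) \<Rightarrow> nat \<Rightarrow> bool"
  where "total_degree \<Omega> m \<longleftrightarrow> \<Omega> m \<noteq> {0} \<and> (\<forall>k>m. \<Omega> k = {0})"

definition complex_structure ::
    "(nat \<Rightarrow> 'w::complex_algebra_1 set) \<Rightarrow> ('w \<Rightarrow> 'w) \<Rightarrow> ('w \<Rightarrow> 'w) \<Rightarrow>
     (nat \<times> nat \<Rightarrow> 'w set) \<Rightarrow> bool"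
  where "complex_structure \<Omega> d st \<Omega>\<^sub>2 \<longleftrightarrow>
    direct_sum_decomposition \<Omega>\<^sub>2 \<and>
    (\<forall>a b a' b'. \<forall>\<omega>\<in>\<Omega>\<^sub>2 (a, b). \<forall>\<nu>\<in>\<Omega>\<^sub>2 (a', b'). \<omega> * \<nu> \<in> \<Omega>\<^sub>2 (a + a', b + b')) \<and>
    1 \<in> \<Omega>\<^sub>2 (0, 0) \<and>
    (\<forall>k. \<Omega> k = cspan (\<Union>{\<Omega>\<^sub>2 (a, b) | a b. a + b = k})) \<and>
    (\<forall>a b. st ` \<Omega>\<^sub>2 (a, b) = \<Omega>\<^sub>2 (b, a)) \<and>
    (\<exists>del delbar. clinear del \<and> clinear delbar \<and>
       (\<forall>a b. del ` \<Omega>\<^sub>2 (a, b) \<subseteq> \<Omega>\<^sub>2 (a + 1, b)) \<and>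
       (\<forall>a b. delbar ` \<Omega>\<^sub>2 (a, b) \<subseteq> \<Omega>\<^sub>2 (a, b + 1)) \<and>
       (\<forall>\<omega>. d \<omega> = del \<omega> + delbar \<omega>))"

definition lefschetz :: "'w::times \<Rightarrow> 'w \<Rightarrow> 'w"
  where "lefschetz \<sigma> \<omega> = \<sigma> * \<omega>"

locale hermitian_structure = star_dc \<eta> \<Omega> d st
  for \<eta> :: "'b::complex_star_algebra \<Rightarrow> 'w::complex_algebra_1"
    and \<Omega> :: "nat \<Rightarrow> 'w set"
    and d :: "'w \<Rightarrow> 'w"
    and st :: "'w \<Rightarrow> 'w"
    and n :: nat
    and \<Omega>\<^sub>2 :: "nat \<times> nat \<Rightarrow> 'w set"
    and \<sigma> :: 'w +
  assumes total_degree: "total_degree \<Omega> (2 * n)"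
    and complex_structure: "complex_structure \<Omega> d st \<Omega>\<^sub>2"
    and sigma_degree: "\<sigma> \<in> \<Omega>\<^sub>2 (1, 1)"
    and sigma_central: "\<sigma> * \<omega> = \<omega> * \<sigma>"
    and sigma_real: "st \<sigma> = \<sigma>"
    and lefschetz_iso: "k < n \<Longrightarrow> bij_betw (lefschetz \<sigma> ^^ (n - k)) (\<Omega> k) (\<Omega> (2 * n - k))"

definition primitive ::
    "(nat \<Rightarrow> 'w::complex_algebra_1 set) \<Rightarrow> nat \<Rightarrow> 'w \<Rightarrow> nat \<Rightarrow> 'w set"
  where "primitive \<Omega> n \<sigma> k =
    (if k \<le> n then {\<alpha> \<in> \<Omega> k. (lefschetz \<sigma> ^^ (n - k + 1)) \<alpha> = 0} else {0})"

text \<open>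
  The exponents \<open>j\<close> are restricted to \<open>j \<le> n - k\<close>, since \<open>L\<^sub>\<sigma>\<^sup>j\<close> vanishes on \<open>P\<^sup>k\<close> for \<open>j > n - k\<close>.
\<close>

definition hodge_map ::
    "(nat \<Rightarrow> 'w::complex_algebra_1 set) \<Rightarrow> nat \<Rightarrow> (nat \<times> nat \<Rightarrow> 'w set) \<Rightarrow> 'w \<Rightarrow> 'w \<Rightarrow> 'w"
  where "hodge_map \<Omega> n \<Omega>\<^sub>2 \<sigma> = (THE s. clinear s \<and>
    (\<forall>a b j. \<forall>\<alpha> \<in> primitive \<Omega> n \<sigma> (a + b) \<inter> \<Omega>\<^sub>2 (a, b). j + (a + b) \<le> n \<longrightarrow>
       s ((lefschetz \<sigma> ^^ j) \<alpha>) =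
         ((- 1) ^ ((a + b) * (a + b + 1) div 2) * \<i> powi (int a - int b) *
            (fact j / fact (n - j - (a + b)))) *\<^sub>C
         (lefschetz \<sigma> ^^ (n - j - (a + b))) \<alpha>))"

text \<open>Elements of degree zero are turned into elements of \<open>B\<close> by inverting \<open>\<eta>\<close>.\<close>

definition metric ::
    "('b::complex_star_algebra \<Rightarrow> 'w::complex_algebra_1) \<Rightarrow> (nat \<Rightarrow> 'w set) \<Rightarrow> ('w \<Rightarrow> 'w) \<Rightarrow>
     nat \<Rightarrow> (nat \<times> nat \<Rightarrow> 'w set) \<Rightarrow> 'w \<Rightarrow> 'w \<Rightarrow> 'w \<Rightarrow> 'b"
  where "metric \<eta> \<Omega> st n \<Omega>\<^sub>2 \<sigma> \<omega> \<nu> =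
    (\<Sum>k\<le>2 * n. the_inv \<eta> (hodge_map \<Omega> n \<Omega>\<^sub>2 \<sigma>
       (hodge_map \<Omega> n \<Omega>\<^sub>2 \<sigma> (st (component \<Omega> k \<omega>)) * component \<Omega> k \<nu>)))"

definition positive_elements :: "'b::complex_star_algebra set"
  where "positive_elements = {b. b \<noteq> 0 \<and> (\<exists>xs. b = (\<Sum>x\<leftarrow>xs. star x * x))}"

locale cqh_hermitian_space =
  cqga_homogeneous_space A H \<iota> \<Delta>\<^sub>B \<pi> +
  hermitian_structure \<eta> \<Omega> d st n \<Omega>\<^sub>2 \<sigma> +
  forms: relative_hopf_module_0 A \<iota> \<Delta>\<^sub>B "\<lambda>b \<omega>. \<eta> b * \<omega>" "\<lambda>\<omega> b. \<omega> * \<eta> b" \<delta>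
  for A :: "'a::complex_star_algebra hopf"
    and H :: "'p::complex_star_algebra hopf"
    and \<iota> :: "'b::complex_star_algebra \<Rightarrow> 'a::complex_star_algebra"
    and \<Delta>\<^sub>B :: "'b \<Rightarrow> ('a, 'b) tensor"
    and \<pi> :: "'a \<Rightarrow> 'p::complex_star_algebra"
    and \<eta> :: "'b \<Rightarrow> 'w::complex_algebra_1"
    and \<Omega> :: "nat \<Rightarrow> 'w set"
    and d :: "'w \<Rightarrow> 'w"
    and st :: "'w \<Rightarrow> 'w"
    and \<delta> :: "'w \<Rightarrow> ('a, 'w) tensor"
    and n :: nat
    and \<Omega>\<^sub>2 :: "nat \<times> nat \<Rightarrow> 'w set"
    and \<sigma> :: 'w +
  assumes coaction_extends: "\<delta> (\<eta> b) = tmap id \<eta> (\<Delta>\<^sub>B b)"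
    and d_covariant: "\<delta> (d \<omega>) = tmap id d (\<delta> \<omega>)"
    and positive_definite: "\<omega> \<noteq> 0 \<Longrightarrow> metric \<eta> \<Omega> st n \<Omega>\<^sub>2 \<sigma> \<omega> \<omega> \<in> positive_elements"
    and bigrading_covariant:
      "relative_hopf_subobject_0 (\<lambda>b \<omega>. \<eta> b * \<omega>) (\<lambda>\<omega> b. \<omega> * \<eta> b) \<delta> (\<Omega>\<^sub>2 (p, q))"
    and sigma_coinvariant: "\<delta> \<sigma> = 1 \<otimes>\<^sub>C \<sigma>"
    and integral_closed: "\<lbrakk>k + 1 = 2 * n; \<omega> \<in> \<Omega> k\<rbrakk> \<Longrightarrow>
      haar A (\<iota> (the_inv \<eta> (hodge_map \<Omega> n \<Omega>\<^sub>2 \<sigma> (d \<omega>)))) = 0"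


section \<open>Hermitian modules\<close>

text \<open>The dual \<open>F\<^sup>\<or>\<close> of right \<open>B\<close>-module maps, with actions \<open>(b \<phi>)(m) = b \<phi>(m)\<close>, \<open>(\<phi> b)(m) = \<phi>(b m)\<close>.\<close>

definition right_dual ::
    "('m::complex_vector \<Rightarrow> 'b::complex_algebra_1 \<Rightarrow> 'm) \<Rightarrow> ('m \<Rightarrow> 'b) set"
  where "right_dual ract = {\<phi>. (\<forall>m m'. \<phi> (m + m') = \<phi> m + \<phi> m') \<and>
    (\<forall>m b. \<phi> (ract m b) = \<phi> m * b)}"

text \<open>
  The conjugate bimodule of \<open>F\<close> has the same underlying additive group, so \<open>h f\<close> stands for the
  value in \<open>F\<^sup>\<or>\<close> at the conjugate of \<open>f\<close>. On conjugates, \<open>b\<close> acts from the left by \<open>f \<mapsto> f b\<^sup>*\<close> and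
  from the right by \<open>f \<mapsto> b\<^sup>* f\<close>.
\<close>

locale weak_hermitian_module = bimodule lact ract
  for lact :: "'b::complex_star_algebra \<Rightarrow> 'm::complex_vector \<Rightarrow> 'm"
    and ract :: "'m \<Rightarrow> 'b \<Rightarrow> 'm"
    and h :: "'m \<Rightarrow> 'm \<Rightarrow> 'b" +
  assumes h_bij: "bij_betw h UNIV (right_dual ract)"
    and h_add: "h (f + f') = (\<lambda>k. h f k + h f' k)"
    and h_left: "h (ract f (star b)) = (\<lambda>k. b * h f k)"
    and h_right: "h (lact (star b) f) = (\<lambda>k. h f (lact b k))"
    and h_symmetric: "h f k = star (h k f)"
    and h_positive: "f \<noteq> 0 \<Longrightarrow> h f f \<in> positive_elements"

text \<open>
  \<open>t\<close> is the coaction of \<open>A\<close> at \<open>\<phi> \<in> F\<^sup>\<or>\<close>, i.e. the element of \<open>A \<otimes> F\<^sup>\<or>\<close> for which evaluation is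
  covariant: \<open>\<Delta>(\<phi>(k)) = \<phi>\<^sub>(\<^sub>-\<^sub>1\<^sub>) k\<^sub>(\<^sub>-\<^sub>1\<^sub>) \<otimes> \<phi>\<^sub>(\<^sub>0\<^sub>)(k\<^sub>(\<^sub>0\<^sub>))\<close>.
\<close>

definition dual_coaction ::
    "('b::complex_star_algebra \<Rightarrow> ('a::complex_star_algebra, 'b) tensor) \<Rightarrow> ('m::complex_vector \<Rightarrow> 'b \<Rightarrow> 'm) \<Rightarrow>
     ('m \<Rightarrow> ('a, 'm) tensor) \<Rightarrow> ('m \<Rightarrow> 'b) \<Rightarrow> ('a, 'm \<Rightarrow> 'b) tensor \<Rightarrow> bool"
  where "dual_coaction \<Delta>\<^sub>B ract \<delta> \<phi> t \<longleftrightarrow> t \<in> tensor_subspace UNIV (right_dual ract) \<and>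
    (\<forall>k. \<Delta>\<^sub>B (\<phi> k) = tlift (\<lambda>a \<psi>. tlift (\<lambda>a' k'. (a * a') \<otimes>\<^sub>C \<psi> k') (\<delta> k)) t)"

text \<open>The form \<open>g\<^sub>F(\<omega> \<otimes> f, \<nu> \<otimes> k) = h(f, g\<^sub>\<sigma>(\<omega>, \<nu>) k)\<close> on a model \<open>\<tau>\<close> of \<open>\<Omega> \<otimes>\<^sub>B F\<close>.\<close>

definition twisted_metric ::
    "('w \<Rightarrow> 'w \<Rightarrow> 'b::complex_star_algebra) \<Rightarrow> ('b \<Rightarrow> 'm \<Rightarrow> 'm) \<Rightarrow> ('m \<Rightarrow> 'm \<Rightarrow> 'b) \<Rightarrow>
     ('w::complex_vector \<Rightarrow> 'm::complex_vector \<Rightarrow> 'e::complex_vector) \<Rightarrow> 'e \<Rightarrow> 'e \<Rightarrow> 'b"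
  where "twisted_metric g lact h \<tau> x y =
    blift \<tau> (\<lambda>\<omega> f. blift \<tau> (\<lambda>\<nu> k. h f (lact (g \<omega> \<nu>) k)) y) x"

text \<open>
  The last assumption is that \<open>h\<close> is a comodule map, the coaction on the conjugate of \<open>F\<close> being
  \<open>f \<mapsto> f\<^sub>(\<^sub>-\<^sub>1\<^sub>)\<^sup>* \<otimes> f\<^sub>(\<^sub>0\<^sub>)\<close>.
\<close>

locale covariant_hermitian_module =
  relative_hopf_module_0 A \<iota> \<Delta>\<^sub>B lact ract \<delta> +
  weak_hermitian_module lact ract h +
  twisted: weak_hermitian_module
    "\<lambda>b. blift \<tau> (\<lambda>\<omega> f. \<tau> (\<eta> b * \<omega>) f)" "\<lambda>e b. blift \<tau> (\<lambda>\<omega> f. \<tau> \<omega> (ract f b)) e"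
    "twisted_metric g lact h \<tau>"
  for A :: "'a::complex_star_algebra hopf"
    and \<iota> :: "'b::complex_star_algebra \<Rightarrow> 'a::complex_star_algebra"
    and \<Delta>\<^sub>B :: "'b \<Rightarrow> ('a, 'b) tensor"
    and \<eta> :: "'b \<Rightarrow> 'w::complex_algebra_1"
    and g :: "'w \<Rightarrow> 'w \<Rightarrow> 'b"
    and lact :: "'b \<Rightarrow> 'm::complex_vector \<Rightarrow> 'm"
    and ract :: "'m \<Rightarrow> 'b \<Rightarrow> 'm"
    and \<delta> :: "'m \<Rightarrow> ('a, 'm) tensor"
    and h :: "'m \<Rightarrow> 'm \<Rightarrow> 'b"
    and \<tau> :: "'w \<Rightarrow> 'm \<Rightarrow> 'e::complex_vector" +
  assumes h_covariant: "dual_coaction \<Delta>\<^sub>B ract \<delta> (h f) (tlift (\<lambda>a f'. star a \<otimes>\<^sub>C h f') (\<delta> f))"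

text \<open>\<open>\<kappa>\<close> exhibits \<open>'h\<close> as the completion of \<open>'e\<close> with respect to the inner product \<open>ip\<close>.\<close>

definition hilbert_completion ::
    "('e::complex_vector \<Rightarrow> 'e \<Rightarrow> complex) \<Rightarrow> ('e \<Rightarrow> 'h::chilbert_space) \<Rightarrow> bool"
  where "hilbert_completion ip \<kappa> \<longleftrightarrow> clinear \<kappa> \<and>
    (\<forall>x y. cinner (\<kappa> x) (\<kappa> y) = ip x y) \<and> closure (range \<kappa>) = UNIV"

end

theory Submission
  imports Defs "HOL-Analysis.Elementary_Metric_Spaces"
begin

text \<open>
  Let \<open>E = \<Omega> \<otimes>\<^sub>B F\<close>, with \<open>B\<close>-valued form \<open>G\<close> and diagonal coaction \<open>x \<mapsto> x\<^sub>-\<^sub>1 \<otimes> x\<^sub>0\<close>, let \<open>\<epsilon>\<close> be the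
  counit and \<open>h\<close> the Haar functional of \<open>A\<close>. Evaluation at the counit gives a scalar form
  \<open>s(x, y) = \<epsilon>(G(x, y))\<close> on \<open>E\<close>, the \<open>fibre\<close> form, and covariance recovers \<open>G\<close> from it:
  \<open>G(x, y) = x\<^sub>-\<^sub>1\<^sup>* y\<^sub>-\<^sub>1 s(x\<^sub>0, y\<^sub>0)\<close>. Hence \<open>x \<mapsto> x\<^sub>-\<^sub>1 \<otimes> x\<^sub>0\<close> is an isometry from \<open>E\<close> into the tensor product
  of \<open>L\<^sup>2(A)\<close> and the quotient of \<open>E\<close> by the null vectors of \<open>s\<close>. If \<open>\<omega>\<close> coacts to \<open>\<Sum> a\<^sub>i \<otimes> \<omega>\<^sub>i\<close>, then
  multiplication by \<open>\<omega>\<close> corresponds to the sum of the operators \<open>a\<^sub>i \<otimes> L\<^sub>i\<close>, where \<open>L\<^sub>i\<close> multiplies by \<open>\<omega>\<^sub>i\<close>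
  (\<open>G_coord\<close>, \<open>coord_Lmult\<close>). The operator \<open>L\<^sub>i\<close> is defined on the quotient because \<open>G\<close> identifies
  \<open>E\<close> with its dual, so that \<open>L\<^sub>i\<close> has an adjoint. So two facts give boundedness: left multiplication
  by an element of \<open>A\<close> is bounded on \<open>L\<^sup>2(A)\<close> (\<open>left_mult_bounded\<close>), and the quotient of \<open>E\<close> is
  finite-dimensional (\<open>fibre_finite_parseval\<close>).

  The first holds because \<open>\<Sum> e e\<^sup>*\<close>, over an orthonormal basis of a finite-dimensional left coideal
  of \<open>A\<close>, is coinvariant and therefore a scalar. For the second, \<open>E\<close> is finitely generated over \<open>B\<close>, so
  it is enough that \<open>b\<close> acts on the quotient by the scalar \<open>\<epsilon>(b)\<close> (\<open>fibre_lactE\<close>). For the right action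
  this is clear from \<open>G(x, y b) = G(x, y) b\<close>. The right action is a twist of the left one by matrix
  coefficients \<open>u\<close>, and the twist can be inverted as soon as the elements \<open>\<Sum>\<^sub>k u\<^sub>j\<^sub>k\<^sup>* b u\<^sub>i\<^sub>k\<close> belong to \<open>B\<close>
  (\<open>left_action_as_right\<close>). They are coinvariant under \<open>\<pi>\<close>, and every coinvariant element is in \<open>B\<close>
  (\<open>coinvariant_in_range\<close>): \<open>A\<close> is the orthogonal sum of \<open>B\<close> and its complement, and a coinvariant element
  of the complement vanishes.

  The covariance of \<open>G\<close> rests on that of the metric of \<open>\<Omega>\<close>, hence on the Hodge map being a comodule
  map (\<open>coaction_hodge\<close>). The Hodge map is a definite description, and the Lefschetz decomposition
  (\<open>lefschetz_decomposition\<close>) shows that it describes a unique map.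
\<close>

section \<open>Linear maps and tensors\<close>

(* Simplification would turn the argument of tmap id f into an abstraction, out of reach of the
   rules about tmap. *)
declare id_apply [simp del]

interpretation cvp: vector_space_pair
  "scaleC :: complex \<Rightarrow> 'a \<Rightarrow> 'a::complex_vector" "scaleC :: complex \<Rightarrow> 'b \<Rightarrow> 'b::complex_vector"
  by unfold_locales

lemma clinearI:
  assumes "\<And>x y. f (x + y) = f x + f y" "\<And>c x. f (c *\<^sub>C x) = c *\<^sub>C f x"
  shows "clinear f"
  using assms by (intro Vector_Spaces.linear_iff[THEN iffD2]) (auto intro: cvs.vector_space_axioms)

lemma clinearD:
  assumes "clinear f"
  shows "f (x + y) = f x + f y" "f (c *\<^sub>C x) = c *\<^sub>C f x" "f 0 = 0" "f (x - y) = f x - f y" "f (- x) = - f x"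
    "f (sum g I) = (\<Sum>i\<in>I. f (g i))"
  using assms by (auto simp: cvp.linear_add cvp.linear_scale cvp.linear_0 cvp.linear_diff cvp.linear_neg cvp.linear_sum)

definition add_hom :: "('a::ab_group_add \<Rightarrow> 'b::ab_group_add) \<Rightarrow> bool"
  where "add_hom f \<longleftrightarrow> (\<forall>x y. f (x + y) = f x + f y)"

lemma add_homI: "(\<And>x y. f (x + y) = f x + f y) \<Longrightarrow> add_hom f"
  by (simp add: add_hom_def)

lemma add_homD:
  assumes "add_hom f"
  shows "f (x + y) = f x + f y" "f 0 = 0" "f (x - y) = f x - f y" "f (- x) = - f x"
    "f (sum g I) = (\<Sum>i\<in>I. f (g i))"
proof -
  show a: "f (x + y) = f x + f y" for x y using assms by (simp add: add_hom_def)
  show z: "f 0 = 0" using a[of 0 0] by simp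
  show "f (x - y) = f x - f y" using a[of "x - y" y] by simp
  show "f (- x) = - f x" using a[of "- x" x] z by (simp add: eq_neg_iff_add_eq_0)
  show "f (sum g I) = (\<Sum>i\<in>I. f (g i))"
    by (induction I rule: infinite_finite_induct) (simp_all add: z a)
qed

lemma clinear_add_hom: "clinear f \<Longrightarrow> add_hom f"
  by (rule add_homI) (rule clinearD)

definition conjlinear :: "('a::complex_vector \<Rightarrow> 'b::complex_vector) \<Rightarrow> bool"
  where "conjlinear f \<longleftrightarrow> (\<forall>x y. f (x + y) = f x + f y) \<and> (\<forall>c x. f (c *\<^sub>C x) = cnj c *\<^sub>C f x)"

lemma conjlinearD:
  assumes "conjlinear f"
  shows "f (x + y) = f x + f y" "f (c *\<^sub>C x) = cnj c *\<^sub>C f x" "f 0 = 0" "f (x - y) = f x - f y"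
    "f (sum g I) = (\<Sum>i\<in>I. f (g i))"
proof -
  have "add_hom f" using assms by (simp add: conjlinear_def add_hom_def)
  note a = add_homD[OF this]
  show "f (x + y) = f x + f y" "f 0 = 0" "f (x - y) = f x - f y" "f (sum g I) = (\<Sum>i\<in>I. f (g i))"
    by (fact a)+
  show "f (c *\<^sub>C x) = cnj c *\<^sub>C f x" using assms by (simp add: conjlinear_def)
qed

lemma conjlinear_star: "conjlinear (star :: 'a::complex_star_algebra \<Rightarrow> 'a)"
  by (simp add: conjlinear_def star_add star_scaleC)

lemmas star_simps = conjlinearD[OF conjlinear_star]

lemma star_one: "star (1::'a::complex_star_algebra) = 1"
proof -
  have "star (1::'a) * star (star 1) = star (star 1 * 1)" by (simp only: star_mult)
  then show ?thesis by (simp add: star_star)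
qed

lemma clinear_id: "clinear id" and clinear_ident: "clinear (\<lambda>x. x)"
  by (rule clinearI; simp add: id_apply)+

lemma clinear_comp: "clinear f \<Longrightarrow> clinear g \<Longrightarrow> clinear (\<lambda>x. f (g x))"
  by (rule clinearI) (simp_all add: clinearD)

lemma clinear_mult_left: "clinear (\<lambda>y::'a::complex_algebra_1. x * y)"
  by (rule clinearI) (simp_all add: distrib_left mult_scaleC_right)

definition cbilinear :: "('a::complex_vector \<Rightarrow> 'b::complex_vector \<Rightarrow> 'c::complex_vector) \<Rightarrow> bool"
  where "cbilinear \<beta> \<longleftrightarrow> (\<forall>v. clinear (\<beta> v)) \<and> (\<forall>w. clinear (\<lambda>v. \<beta> v w))"

lemma cbilinearI:
  assumes "\<And>v v' w. \<beta> (v + v') w = \<beta> v w + \<beta> v' w" "\<And>v w w'. \<beta> v (w + w') = \<beta> v w + \<beta> v w'"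
    "\<And>c v w. \<beta> (c *\<^sub>C v) w = c *\<^sub>C \<beta> v w" "\<And>c v w. \<beta> v (c *\<^sub>C w) = c *\<^sub>C \<beta> v w"
  shows "cbilinear \<beta>"
  unfolding cbilinear_def using assms by (intro conjI allI clinearI) auto

lemma cbilinear_balanced: "cbilinear \<beta> \<Longrightarrow> balanced \<beta>"
  by (simp add: cbilinear_def balanced_def clinearD(1,2))
     (metis clinearD(1,2))

lemma balancedI:
  assumes "\<And>v v' w. \<beta> (v + v') w = \<beta> v w + \<beta> v' w" "\<And>v w w'. \<beta> v (w + w') = \<beta> v w + \<beta> v w'"
    "\<And>c v w. \<beta> (c *\<^sub>C v) w = \<beta> v (c *\<^sub>C w)"
  shows "balanced \<beta>"
  using assms by (simp add: balanced_def)

lemma tens_relation: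
  assumes "x - y \<in> tensor_relations"
  shows "abs_tensor x = abs_tensor y"
  using assms by (simp add: tensor.abs_eq_iff)

lemma tens_add_left: "(v + v') \<otimes>\<^sub>C w = v \<otimes>\<^sub>C w + v' \<otimes>\<^sub>C w"
proof -
  have "Poly_Mapping.single (v + v', w) 1 - Poly_Mapping.single (v, w) 1
      - Poly_Mapping.single (v', w) (1::complex) \<in> tensor_relations"
    unfolding tensor_relations_def by (intro cvs.span_base) blast
  then show ?thesis by (simp add: tens.abs_eq plus_tensor.abs_eq tensor.abs_eq_iff diff_diff_eq)
qed

lemma tens_add_right: "v \<otimes>\<^sub>C (w + w') = v \<otimes>\<^sub>C w + v \<otimes>\<^sub>C w'"
proof -
  have "Poly_Mapping.single (v, w + w') 1 - Poly_Mapping.single (v, w) 1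
      - Poly_Mapping.single (v, w') (1::complex) \<in> tensor_relations"
    unfolding tensor_relations_def by (intro cvs.span_base) blast
  then show ?thesis by (simp add: tens.abs_eq plus_tensor.abs_eq tensor.abs_eq_iff diff_diff_eq)
qed

lemma abs_tensor_single: "abs_tensor (Poly_Mapping.single (v, w) c) = (c *\<^sub>C v) \<otimes>\<^sub>C w"
proof -
  have "Poly_Mapping.single (c *\<^sub>C v, w) 1 - Poly_Mapping.single (v, w) c \<in> tensor_relations"
    unfolding tensor_relations_def by (intro cvs.span_base) blast
  then show ?thesis unfolding tens.abs_eq by (rule tens_relation[symmetric])
qed

lemma scaleC_poly_single: "c *\<^sub>C Poly_Mapping.single p (e::complex) = Poly_Mapping.single p (c * e)"
  by transfer (auto simp: fun_eq_iff when_def scaleC_complex_def)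

lemma scaleC_tens: "c *\<^sub>C (v \<otimes>\<^sub>C w) = (c *\<^sub>C v) \<otimes>\<^sub>C w"
  using abs_tensor_single[of v w c] by (simp add: tens.abs_eq scaleC_tensor.abs_eq scaleC_poly_single)

lemma tens_scaleC_right: "v \<otimes>\<^sub>C (c *\<^sub>C w) = c *\<^sub>C (v \<otimes>\<^sub>C w)"
proof -
  have "Poly_Mapping.single (v, c *\<^sub>C w) 1 - Poly_Mapping.single (v, w) c \<in> tensor_relations"
    unfolding tensor_relations_def by (intro cvs.span_base) blast
  then show ?thesis unfolding scaleC_tens abs_tensor_single[symmetric] by (simp add: tens.abs_eq tens_relation)
qed

lemma tens_scaleC_left: "(c *\<^sub>C v) \<otimes>\<^sub>C w = c *\<^sub>C (v \<otimes>\<^sub>C w)"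
  by (simp add: scaleC_tens)

lemma clinear_tens_left: "clinear (\<lambda>v. v \<otimes>\<^sub>C w)" and clinear_tens_right: "clinear (\<lambda>w. v \<otimes>\<^sub>C w)"
  by (rule clinearI; simp add: tens_add_left tens_add_right tens_scaleC_left tens_scaleC_right)+

text \<open>
  Coefficients are absorbed into the left leg, so there is no separate case for scalar multiples.
\<close>

lemma tensor_induct [case_names tens add]:
  assumes tens: "\<And>v w. P (v \<otimes>\<^sub>C w)" and add: "\<And>s t. P s \<Longrightarrow> P t \<Longrightarrow> P (s + t)"
  shows "P t"
proof (induction t rule: tensor.abs_induct)
  case (1 x)
  have zero: "abs_tensor 0 = (0 :: ('a, 'b) tensor)"
    by (simp add: zero_tensor.abs_eq)
  have "P (abs_tensor (\<Sum>k\<in>K. Poly_Mapping.single k (Poly_Mapping.lookup x k)))" if "finite K" for K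
    using that
  proof (induction K rule: finite_induct)
    case empty
    show ?case using tens[of 0 0] by (simp add: zero clinearD(3)[OF clinear_tens_left])
  next
    case (insert k K)
    then show ?case
      using add tens by (cases k) (simp add: plus_tensor.abs_eq[symmetric] abs_tensor_single)
  qed
  moreover have "x = (\<Sum>k\<in>Poly_Mapping.keys x. Poly_Mapping.single k (Poly_Mapping.lookup x k))"
    by (rule poly_mapping_eqI)
       (auto simp: lookup_sum lookup_single when_def sum.delta' in_keys_iff)
  ultimately show ?case by (metis finite_keys)
qed

text \<open>
  Asking for additivity only covers the maps that are conjugate-linear in both legs as well.
\<close>

lemma tensor_add_hom_eqI:
  assumes "add_hom f" "add_hom g" "\<And>v w. f (v \<otimes>\<^sub>C w) = g (v \<otimes>\<^sub>C w)"
  shows "f t = g t"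
  by (induction t rule: tensor_induct) (simp_all add: assms(3) add_homD(1)[OF assms(1)] add_homD(1)[OF assms(2)])

lemma add_hom_tlift: "balanced \<beta> \<Longrightarrow> add_hom (tlift \<beta>)"
  by (rule add_homI) (rule tlift_add)

lemmas tlift_sum = add_homD(5)[OF add_hom_tlift]

lemma clinear_tlift:
  assumes "cbilinear \<beta>" shows "clinear (tlift \<beta>)"
proof (rule clinearI)
  note b = cbilinear_balanced[OF assms]
  show "tlift \<beta> (x + y) = tlift \<beta> x + tlift \<beta> y" for x y by (rule tlift_add[OF b])
  show "tlift \<beta> (c *\<^sub>C x) = c *\<^sub>C tlift \<beta> x" for c x
  proof (induction x rule: tensor_induct)
    case (tens v w)
    have "\<beta> (c *\<^sub>C v) w = c *\<^sub>C \<beta> v w" using assms clinearD(2) unfolding cbilinear_def by fast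
    then show ?case by (simp add: tlift_tens[OF b] scaleC_tens)
  next
    case (add s t)
    then show ?case by (simp add: tlift_add[OF b] scaleC_add_right)
  qed
qed

lemma cbilinear_tmap: "clinear f \<Longrightarrow> clinear g \<Longrightarrow> cbilinear (\<lambda>v w. f v \<otimes>\<^sub>C g w)"
  by (rule cbilinearI) (simp_all add: clinearD(1,2) tens_add_left tens_add_right tens_scaleC_left tens_scaleC_right)

lemma tmap_tens: "clinear f \<Longrightarrow> clinear g \<Longrightarrow> tmap f g (v \<otimes>\<^sub>C w) = f v \<otimes>\<^sub>C g w"
  unfolding tmap_def by (rule tlift_tens) (intro cbilinear_balanced cbilinear_tmap)

lemma clinear_tmap: "clinear f \<Longrightarrow> clinear g \<Longrightarrow> clinear (tmap f g)"
  unfolding tmap_def by (intro clinear_tlift cbilinear_tmap)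

lemma balanced_conj_tmap: "conjlinear f \<Longrightarrow> conjlinear g \<Longrightarrow> balanced (\<lambda>v w. f v \<otimes>\<^sub>C g w)"
  by (rule balancedI) (simp_all add: conjlinearD(1,2) tens_add_left tens_add_right tens_scaleC_left tens_scaleC_right)

lemma tmap_conj_tens: "conjlinear f \<Longrightarrow> conjlinear g \<Longrightarrow> tmap f g (v \<otimes>\<^sub>C w) = f v \<otimes>\<^sub>C g w"
  unfolding tmap_def by (intro tlift_tens balanced_conj_tmap)

lemma add_hom_conj_tmap: "conjlinear f \<Longrightarrow> conjlinear g \<Longrightarrow> add_hom (tmap f g)"
  unfolding tmap_def by (intro add_hom_tlift balanced_conj_tmap)

lemma tmap_tmap:
  assumes "clinear f" "clinear g" "clinear f'" "clinear g'"
  shows "tmap f g (tmap f' g' t) = tmap (\<lambda>x. f (f' x)) (\<lambda>x. g (g' x)) t"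
  by (rule tensor_add_hom_eqI[of _ _ t])
     (simp_all add: assms tmap_tens clinear_comp clinear_add_hom clinear_tmap)

lemma tmap_id: "tmap id id t = t"
proof (induction t rule: tensor_induct)
  case (tens v w)
  show ?case by (metis tmap_tens[OF clinear_id clinear_id] id_apply)
next
  case (add s t)
  then show ?case by (metis clinearD(1)[OF clinear_tmap[OF clinear_id clinear_id]])
qed

lemma tmap_idl: "clinear g \<Longrightarrow> tmap id g (v \<otimes>\<^sub>C w) = v \<otimes>\<^sub>C g w"
  and tmap_idr: "clinear f \<Longrightarrow> tmap f id (v \<otimes>\<^sub>C w') = f v \<otimes>\<^sub>C w'"
  by (simp_all only: tmap_tens clinear_id) (simp_all add: id_apply)

section \<open>Expansions of tensors\<close>

lemma clinear_dual_vector: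
  assumes "cvs.independent X" "x \<in> X"
  obtains \<phi> :: "'a::complex_vector \<Rightarrow> complex" where "clinear \<phi>" "\<And>y. y \<in> X \<Longrightarrow> \<phi> y = (if y = x then 1 else 0)"
  using cvp.linear_independent_extend[OF assms(1), of "\<lambda>y. if y = x then 1 else 0"] that by blast

lemma balanced_slice: "clinear \<phi> \<Longrightarrow> cbilinear (\<lambda>a m. \<phi> a *\<^sub>C m)" 
  for \<phi> :: "'a::complex_vector \<Rightarrow> complex"
  by (rule cbilinearI)
     (simp_all add: clinearD(1,2) scaleC_complex_def scaleC_add_left scaleC_add_right scaleC_scaleC mult.commute)

lemma balanced_slice_right: "clinear \<phi> \<Longrightarrow> cbilinear (\<lambda>a m. \<phi> m *\<^sub>C a)" 
  for \<phi> :: "'a::complex_vector \<Rightarrow> complex"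
  by (rule cbilinearI)
     (simp_all add: clinearD(1,2) scaleC_complex_def scaleC_add_left scaleC_add_right scaleC_scaleC mult.commute)

lemma tlift_slice: "clinear \<phi> \<Longrightarrow> tlift (\<lambda>a m. \<phi> a *\<^sub>C m) (\<Sum>i\<in>I. x i \<otimes>\<^sub>C y i) = (\<Sum>i\<in>I. \<phi> (x i) *\<^sub>C y i)"
  for \<phi> :: "'a::complex_vector \<Rightarrow> complex"
  by (simp add: tlift_sum tlift_tens cbilinear_balanced balanced_slice)

lemma tlift_slice_right: "clinear \<phi> \<Longrightarrow> tlift (\<lambda>a m. \<phi> m *\<^sub>C a) (\<Sum>i\<in>I. x i \<otimes>\<^sub>C y i) = (\<Sum>i\<in>I. \<phi> (y i) *\<^sub>C x i)"
  for \<phi> :: "'a::complex_vector \<Rightarrow> complex"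
  by (simp add: tlift_sum tlift_tens cbilinear_balanced balanced_slice_right)

lemma sum_delta_scaleC:
  "finite X \<Longrightarrow> x \<in> X \<Longrightarrow> (\<Sum>y\<in>X. (if y = x then 1 else 0) *\<^sub>C f y) = (f x :: 'a::complex_vector)"
  "finite X \<Longrightarrow> x \<in> X \<Longrightarrow> (\<Sum>y\<in>X. (if x = y then 1 else 0) *\<^sub>C f y) = (f x :: 'a::complex_vector)"
proof -
  have "(\<Sum>y\<in>X. (if y = x then 1 else 0) *\<^sub>C f y) = (\<Sum>y\<in>X. if y = x then f y else 0)"
    "(\<Sum>y\<in>X. (if x = y then 1 else 0) *\<^sub>C f y) = (\<Sum>y\<in>X. if x = y then f y else 0)"
    by (auto intro!: sum.cong simp: scaleC_one)
  then show "finite X \<Longrightarrow> x \<in> X \<Longrightarrow> (\<Sum>y\<in>X. (if y = x then 1 else 0) *\<^sub>C f y) = f x"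
    "finite X \<Longrightarrow> x \<in> X \<Longrightarrow> (\<Sum>y\<in>X. (if x = y then 1 else 0) *\<^sub>C f y) = f x" by simp_all
qed

lemma tens_left_unique:
  fixes f g :: "'a::complex_vector \<Rightarrow> 'b::complex_vector"
  assumes "finite X" "cvs.independent X" "(\<Sum>x\<in>X. x \<otimes>\<^sub>C f x) = (\<Sum>x\<in>X. x \<otimes>\<^sub>C g x)" "x \<in> X"
  shows "f x = g x"
proof -
  obtain \<phi> :: "'a \<Rightarrow> complex" where \<phi>: "clinear \<phi>" "\<And>y. y \<in> X \<Longrightarrow> \<phi> y = (if y = x then 1 else 0)"
    using clinear_dual_vector[OF assms(2,4)] by blast
  have "(\<Sum>y\<in>X. \<phi> y *\<^sub>C f y) = (\<Sum>y\<in>X. \<phi> y *\<^sub>C g y)"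
    using arg_cong[OF assms(3), of "tlift (\<lambda>a m. \<phi> a *\<^sub>C m)"] by (simp add: tlift_slice \<phi>(1))
  then show ?thesis using assms(1,4) by (simp add: \<phi>(2) sum_delta_scaleC cong: sum.cong)
qed

lemma tensor_subspace_closed:
  "csubspace (tensor_subspace V W)"
  unfolding tensor_subspace_def by (rule cvs.subspace_span)

lemma tensor_subspace_tens: "v \<in> V \<Longrightarrow> w \<in> W \<Longrightarrow> v \<otimes>\<^sub>C w \<in> tensor_subspace V W"
  unfolding tensor_subspace_def by (rule cvs.span_base) blast

lemma tensor_subspace_mono: "V \<subseteq> V' \<Longrightarrow> W \<subseteq> W' \<Longrightarrow> tensor_subspace V W \<subseteq> tensor_subspace V' W'"
  unfolding tensor_subspace_def by (intro cvs.span_mono) blast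

lemma tensor_subspace_UNIV: "tensor_subspace UNIV UNIV = UNIV"
proof -
  have "t \<in> tensor_subspace UNIV UNIV" for t :: "('a, 'b) tensor"
    by (induction t rule: tensor_induct)
       (auto intro: tensor_subspace_tens cvs.subspace_add[OF tensor_subspace_closed])
  then show ?thesis by auto
qed

lemma tensor_subspace_expansion:
  assumes "t \<in> tensor_subspace V W" "csubspace W"
  obtains X f where "finite X" "X \<subseteq> V" "\<And>x. x \<in> X \<Longrightarrow> f x \<in> W" "t = (\<Sum>x\<in>X. x \<otimes>\<^sub>C f x)"
proof -
  have "\<exists>X f. finite X \<and> X \<subseteq> V \<and> (\<forall>x\<in>X. f x \<in> W) \<and> t = (\<Sum>x\<in>X. x \<otimes>\<^sub>C f x)"
    using assms(1) unfolding tensor_subspace_def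
  proof (induction rule: cvs.span_induct_alt)
    case base
    show ?case by (rule exI[of _ "{}"]) simp
  next
    case (step c s t)
    then obtain v w X f where s: "s = v \<otimes>\<^sub>C w" "v \<in> V" "w \<in> W"
      and X: "finite X" "X \<subseteq> V" "\<forall>x\<in>X. f x \<in> W" "t = (\<Sum>x\<in>X. x \<otimes>\<^sub>C f x)" by auto
    define g where "g x = (if x \<in> X then f x else 0) + (if x = v then c *\<^sub>C w else 0)" for x
    have "(\<Sum>x\<in>insert v X. x \<otimes>\<^sub>C g x)
        = (\<Sum>x\<in>insert v X. x \<otimes>\<^sub>C (if x \<in> X then f x else 0)) + (\<Sum>x\<in>insert v X. x \<otimes>\<^sub>C (if x = v then c *\<^sub>C w else 0))"
      by (simp add: g_def tens_add_right sum.distrib)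
    also have "(\<Sum>x\<in>insert v X. x \<otimes>\<^sub>C (if x \<in> X then f x else 0)) = (\<Sum>x\<in>X. x \<otimes>\<^sub>C f x)"
      using X(1) by (intro sum.mono_neutral_cong_right) (auto simp: clinearD(3)[OF clinear_tens_right])
    also have "(\<Sum>x\<in>insert v X. x \<otimes>\<^sub>C (if x = v then c *\<^sub>C w else 0)) = (\<Sum>x\<in>{v}. x \<otimes>\<^sub>C (c *\<^sub>C w))"
      using X(1) by (intro sum.mono_neutral_cong_right) (auto simp: clinearD(3)[OF clinear_tens_right])
    finally have "c *\<^sub>C s + t = (\<Sum>x\<in>insert v X. x \<otimes>\<^sub>C g x)"
      by (simp add: s(1) X(4) tens_scaleC_right add.commute)
    moreover have "\<forall>x\<in>insert v X. g x \<in> W"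
      using X(3) s(3) assms(2) by (auto simp: g_def cvs.subspace_0 cvs.subspace_add cvs.subspace_scale)
    ultimately show ?case using X(1,2) s(2) by (intro exI[of _ "insert v X"] exI[of _ g]) auto
  qed
  then show thesis using that by blast
qed

lemma span_finite_coords:
  assumes "finite X" "v \<in> cspan X" obtains r where "v = (\<Sum>x\<in>X. r x *\<^sub>C x)"
  using assms by (auto simp: cvs.span_finite)

text \<open>
  Such an expansion is unique (\<open>tens_left_unique\<close>), so a linear condition on a tensor can be checked
  on its right legs one by one. The right legs are merely recombined when the left legs are made
  independent, hence they stay in \<open>W\<close>.
\<close>

lemma tensor_independent_expansion:
  assumes "t \<in> tensor_subspace UNIV W" "csubspace W"
  obtains X f where "finite X" "cvs.independent X" "\<And>x. f x \<in> W" "t = (\<Sum>x\<in>X. x \<otimes>\<^sub>C f x)"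
proof -
  obtain Y g where Y: "finite Y" "\<And>y. y \<in> Y \<Longrightarrow> g y \<in> W" "t = (\<Sum>y\<in>Y. y \<otimes>\<^sub>C g y)"
    using tensor_subspace_expansion[OF assms] by metis
  obtain X where X: "X \<subseteq> Y" "cvs.independent X" "Y \<subseteq> cspan X"
    using cvs.maximal_independent_subset[of Y] by blast
  have fX: "finite X" using X(1) Y(1) finite_subset by blast
  have "\<exists>r. y = (\<Sum>x\<in>X. r x *\<^sub>C x)" if "y \<in> Y" for y
    using X(3) that span_finite_coords[OF fX] by blast
  then obtain r where r: "\<And>y. y \<in> Y \<Longrightarrow> y = (\<Sum>x\<in>X. r y x *\<^sub>C x)" by metis
  have "t = (\<Sum>y\<in>Y. (\<Sum>x\<in>X. r y x *\<^sub>C x) \<otimes>\<^sub>C g y)" using r by (simp add: Y(3) cong: sum.cong)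
  also have "\<dots> = (\<Sum>y\<in>Y. \<Sum>x\<in>X. x \<otimes>\<^sub>C (r y x *\<^sub>C g y))"
    by (simp add: clinearD(6)[OF clinear_tens_left] tens_scaleC_left tens_scaleC_right)
  also have "\<dots> = (\<Sum>x\<in>X. x \<otimes>\<^sub>C (\<Sum>y\<in>Y. r y x *\<^sub>C g y))"
    by (subst sum.swap) (simp add: clinearD(6)[OF clinear_tens_right])
  finally show thesis using that[OF fX X(2), of "\<lambda>x. \<Sum>y\<in>Y. r y x *\<^sub>C g y"] Y(2) assms(2)
    by (simp add: cvs.subspace_sum cvs.subspace_scale)
qed

lemma tensor_expansion_UNIV:
  obtains X f where "finite X" "cvs.independent X" "t = (\<Sum>x\<in>X. x \<otimes>\<^sub>C f x)"
  using tensor_independent_expansion[of t UNIV] by (auto simp: tensor_subspace_UNIV)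

lemma tensor_span_expansion:
  assumes "t \<in> tensor_subspace UNIV (cspan Y)" "finite Y"
  obtains g where "t = (\<Sum>y\<in>Y. g y \<otimes>\<^sub>C y)"
proof -
  obtain X f where X: "finite X" "\<And>x. f x \<in> cspan Y" "t = (\<Sum>x\<in>X. x \<otimes>\<^sub>C f x)"
    using tensor_independent_expansion[OF assms(1) cvs.subspace_span] by metis
  have "\<exists>r. f x = (\<Sum>y\<in>Y. r y *\<^sub>C y)" for x
    using X(2) span_finite_coords[OF assms(2)] by blast
  then obtain r where r: "\<And>x. f x = (\<Sum>y\<in>Y. r x y *\<^sub>C y)" by metis
  have "t = (\<Sum>x\<in>X. \<Sum>y\<in>Y. (r x y *\<^sub>C x) \<otimes>\<^sub>C y)"
    by (simp add: X(3) r clinearD(6)[OF clinear_tens_right] tens_scaleC_left tens_scaleC_right)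
  also have "\<dots> = (\<Sum>y\<in>Y. (\<Sum>x\<in>X. r x y *\<^sub>C x) \<otimes>\<^sub>C y)"
    by (subst sum.swap) (simp add: clinearD(6)[OF clinear_tens_left])
  finally show thesis by (rule that)
qed

lemma tmap_inj:
  assumes "clinear f" "inj f" "tmap f id s = tmap f id t"
  shows "s = t"
proof -
  obtain g where g: "clinear g" "g \<circ> f = id"
    using cvp.linear_injective_left_inverse[OF assms(1,2)] by blast
  then have gf: "(\<lambda>x. g (f x)) = id" by (auto simp: fun_eq_iff)
  have "tmap g id (tmap f id t) = t" for t :: "('a, 'c) tensor"
    using tmap_tmap[OF g(1) clinear_id assms(1) clinear_id, of t] gf tmap_id[of t] by (simp add: id_def)
  then show ?thesis using assms(3) by metis
qed

section \<open>Comodules and orthonormal bases\<close>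

lemma clinear_tlift_param:
  assumes "\<And>u v. clinear (\<lambda>w. \<beta> w u v)"
  shows "clinear (\<lambda>w. tlift (\<beta> w) t)"
  unfolding tlift_def
  by (rule clinearI) (simp_all add: clinearD[OF assms] sum.distrib cvs.scale_sum_right)

lemma cbilinear_tens3: "cbilinear (\<lambda>u v. u \<otimes>\<^sub>C (v \<otimes>\<^sub>C w))"
  by (rule cbilinearI) (simp_all add: tens_add_left tens_add_right tens_scaleC_left tens_scaleC_right)

lemma cbilinear_tassoc: "cbilinear (\<lambda>t w. tlift (\<lambda>u v. u \<otimes>\<^sub>C (v \<otimes>\<^sub>C w)) t)"
  unfolding cbilinear_def
  by (intro conjI allI clinear_tlift_param clinear_tlift cbilinear_tens3)
     (rule clinearI; simp add: tens_add_right tens_scaleC_right)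

lemma clinear_tassoc: "clinear tassoc"
  unfolding tassoc_def by (rule clinear_tlift[OF cbilinear_tassoc])

lemma tassoc_tens: "tassoc (t \<otimes>\<^sub>C w) = tlift (\<lambda>u v. u \<otimes>\<^sub>C (v \<otimes>\<^sub>C w)) t"
  unfolding tassoc_def by (rule tlift_tens[OF cbilinear_balanced[OF cbilinear_tassoc]])

lemma tassoc_tens3: "tassoc ((u \<otimes>\<^sub>C v) \<otimes>\<^sub>C w) = u \<otimes>\<^sub>C (v \<otimes>\<^sub>C w)"
  unfolding tassoc_tens by (rule tlift_tens[OF cbilinear_balanced[OF cbilinear_tens3]])

lemma clinear_comodule: "left_comodule A \<delta> \<Longrightarrow> clinear \<delta>"
  by (simp add: left_comodule_def)

definition subcomodule :: "('m::complex_vector \<Rightarrow> ('a::complex_vector, 'm) tensor) \<Rightarrow> 'm set \<Rightarrow> bool"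
  where "subcomodule \<delta> V \<longleftrightarrow> csubspace V \<and> (\<forall>v\<in>V. \<delta> v \<in> tensor_subspace UNIV V)"

lemma subcomodule_spanI:
  assumes "clinear \<delta>" "\<And>x. x \<in> X \<Longrightarrow> \<delta> x \<in> tensor_subspace UNIV (cspan X)"
  shows "subcomodule \<delta> (cspan X)"
  unfolding subcomodule_def
proof (intro conjI ballI cvs.subspace_span)
  fix v assume "v \<in> cspan X"
  then show "\<delta> v \<in> tensor_subspace UNIV (cspan X)"
    by (induction rule: cvs.span_induct_alt)
       (auto simp: clinearD[OF assms(1)] assms(2) intro!: cvs.subspace_0[OF tensor_subspace_closed]
         cvs.subspace_add[OF tensor_subspace_closed] cvs.subspace_scale[OF tensor_subspace_closed])
qed

text \<open>
  The span of \<open>W\<close> is a comodule with matrix \<open>u\<close> of coefficients, indexed by the elements of \<open>W\<close> themselves.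
\<close>

definition corep_basis ::
    "'a::complex_star_algebra hopf \<Rightarrow> ('m::complex_vector \<Rightarrow> ('a, 'm) tensor) \<Rightarrow> 'm set \<Rightarrow> ('m \<Rightarrow> 'm \<Rightarrow> 'a) \<Rightarrow> bool"
  where "corep_basis A \<delta> W u \<longleftrightarrow> finite W \<and>
    (\<forall>x\<in>W. \<delta> x = (\<Sum>y\<in>W. u x y \<otimes>\<^sub>C y)) \<and>
    (\<forall>x\<in>W. \<forall>y\<in>W. comult A (u x y) = (\<Sum>z\<in>W. u x z \<otimes>\<^sub>C u z y)) \<and>
    (\<forall>x\<in>W. \<forall>y\<in>W. counit A (u x y) = (if x = y then 1 else 0))"

context hopf_star_algebra
begin

text \<open>
  The identities for \<open>u\<close> come from comparing the coefficients of the elements of \<open>W\<close> in the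
  coassociativity and counit identities of the comodule.
\<close>

lemma subcomodule_corep_basis:
  fixes \<delta> :: "'m::complex_vector \<Rightarrow> ('a, 'm) tensor"
  assumes "left_comodule A \<delta>" "finite W" "cvs.independent W" "subcomodule \<delta> (cspan W)"
  obtains u where "corep_basis A \<delta> W u"
proof -
  note \<delta> = clinearD[OF clinear_comodule[OF assms(1)]]
  have "\<exists>g. \<delta> x = (\<Sum>y\<in>W. g y \<otimes>\<^sub>C y)" if "x \<in> W" for x
    using assms(2,4) cvs.span_base[OF that] tensor_span_expansion unfolding subcomodule_def by metis
  then obtain u where u: "\<And>x. x \<in> W \<Longrightarrow> \<delta> x = (\<Sum>y\<in>W. u x y \<otimes>\<^sub>C y)" by metis
  have co: "tassoc (tmap (comult A) id (\<delta> m)) = tmap id \<delta> (\<delta> m)"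
    and cu: "tlift (\<lambda>a m'. counit A a *\<^sub>C m') (\<delta> m) = m" for m
    using assms(1) by (auto simp: left_comodule_def)
  have comult: "comult A (u x y) = (\<Sum>z\<in>W. u x z \<otimes>\<^sub>C u z y)" and counit: "counit A (u x y) = (if x = y then 1 else 0)"
    if x: "x \<in> W" and y: "y \<in> W" for x y
  proof -
    obtain \<phi> :: "'m \<Rightarrow> complex" where \<phi>: "clinear \<phi>" "\<And>z. z \<in> W \<Longrightarrow> \<phi> z = (if z = y then 1 else 0)"
      using clinear_dual_vector[OF assms(3) y] by blast
    define q where "q = tmap id (tlift (\<lambda>a m. \<phi> m *\<^sub>C a)) \<circ> (tassoc :: (('a, 'a) tensor, 'm) tensor \<Rightarrow> _)"
    have l: "clinear (tlift (\<lambda>(a::'a) m. \<phi> m *\<^sub>C a))"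
      by (intro clinear_tlift balanced_slice_right \<phi>(1))
    have q_lin: "clinear q" unfolding q_def
      using clinear_comp[OF clinear_tmap[OF clinear_id l] clinear_tassoc] by (simp add: o_def)
    have q_tens: "q (t \<otimes>\<^sub>C m) = \<phi> m *\<^sub>C t" for t m
    proof (induction t rule: tensor_induct)
      case (tens v w)
      show ?case by (simp add: q_def tassoc_tens3 tmap_idl[OF l]
            tlift_tens[OF cbilinear_balanced[OF balanced_slice_right[OF \<phi>(1)]]] tens_scaleC_right)
    next
      case (add s t)
      then show ?case by (simp add: tens_add_left clinearD[OF q_lin] scaleC_add_right)
    qed
    have "tassoc (tmap (comult A) id (\<delta> x)) = (\<Sum>y\<in>W. tassoc (comult A (u x y) \<otimes>\<^sub>C y))"
      by (simp add: u[OF x] clinearD[OF clinear_tmap[OF comult_linear clinear_id]]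
          clinearD[OF clinear_tassoc] tmap_idr[OF comult_linear])
    then have "tmap id (tlift (\<lambda>a m. \<phi> m *\<^sub>C a)) (tassoc (tmap (comult A) id (\<delta> x)))
        = (\<Sum>z\<in>W. q (comult A (u x z) \<otimes>\<^sub>C z))"
      by (simp add: q_def clinearD[OF clinear_tmap[OF clinear_id l]])
    also have "\<dots> = comult A (u x y)"
      using assms(2) y by (simp add: q_tens \<phi>(2) sum_delta_scaleC cong: sum.cong)
    finally have 1: "tmap id (tlift (\<lambda>a m. \<phi> m *\<^sub>C a)) (tassoc (tmap (comult A) id (\<delta> x))) = comult A (u x y)" .
    have "tmap id \<delta> (\<delta> x) = (\<Sum>z\<in>W. u x z \<otimes>\<^sub>C (\<Sum>y\<in>W. u z y \<otimes>\<^sub>C y))"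
      by (simp add: u[OF x] clinearD[OF clinear_tmap[OF clinear_id clinear_comodule[OF assms(1)]]]
          tmap_idl[OF clinear_comodule[OF assms(1)]] u cong: sum.cong)
    then have 2: "tmap id (tlift (\<lambda>a m. \<phi> m *\<^sub>C a)) (tmap id \<delta> (\<delta> x)) = (\<Sum>z\<in>W. u x z \<otimes>\<^sub>C u z y)"
      using assms(2) y
      by (simp add: clinearD[OF clinear_tmap[OF clinear_id l]] tmap_idl[OF l]
          tlift_slice_right[OF \<phi>(1)] \<phi>(2) sum_delta_scaleC cong: sum.cong)
    show "comult A (u x y) = (\<Sum>z\<in>W. u x z \<otimes>\<^sub>C u z y)" using 1 2 co by metis
    have "(\<Sum>z\<in>W. counit A (u x z) *\<^sub>C z) = x"
      using cu[of x] by (simp add: u[OF x] tlift_slice[OF counit_linear])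
    then have "\<phi> x = (\<Sum>z\<in>W. counit A (u x z) *\<^sub>C \<phi> z)"
      by (metis (no_types, lifting) clinearD(2,6)[OF \<phi>(1)] sum.cong)
    also have "\<dots> = (\<Sum>z\<in>W. if z = y then counit A (u x z) else 0)"
      by (rule sum.cong) (auto simp: \<phi>(2) scaleC_complex_def)
    finally show "counit A (u x y) = (if x = y then 1 else 0)"
      using assms(2) x y by (simp add: \<phi>(2))
  qed
  show thesis
    by (rule that[of u]) (simp add: corep_basis_def assms(2) u comult counit)
qed

text \<open>
  If \<open>\<delta> m\<close> is expanded with independent left legs, the right legs span a subcomodule: a functional dual
  to the left legs, applied to the coassociativity identity, expresses their coaction through \<open>\<delta> m\<close>
  and the comultiplication.
\<close>

lemma comodule_locally_finite_single:
  fixes \<delta> :: "'m::complex_vector \<Rightarrow> ('a, 'm) tensor"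
  assumes "left_comodule A \<delta>"
  obtains X where "finite X" "m \<in> cspan X" "subcomodule \<delta> (cspan X)"
proof -
  obtain X f where X: "finite X" "cvs.independent X" "\<delta> m = (\<Sum>x\<in>X. x \<otimes>\<^sub>C f x)"
    using tensor_expansion_UNIV by blast
  have co: "tassoc (tmap (comult A) id (\<delta> m)) = tmap id \<delta> (\<delta> m)"
    and cu: "tlift (\<lambda>a m'. counit A a *\<^sub>C m') (\<delta> m) = m" 
    using assms(1) by (auto simp: left_comodule_def)
  have "m = (\<Sum>x\<in>X. counit A x *\<^sub>C f x)"
    using cu by (simp add: X(3) tlift_slice[OF counit_linear])
  then have m: "m \<in> cspan (f ` X)"
    by (metis (no_types, lifting) cvs.span_base cvs.span_scale cvs.span_sum imageI)
  have sub: "\<delta> y \<in> tensor_subspace UNIV (cspan (f ` X))" if "y \<in> f ` X" for y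
  proof -
    obtain x where x: "x \<in> X" "y = f x" using \<open>y \<in> f ` X\<close> by blast
    obtain \<phi> :: "'a \<Rightarrow> complex" where \<phi>: "clinear \<phi>" "\<And>z. z \<in> X \<Longrightarrow> \<phi> z = (if z = x then 1 else 0)"
      using clinear_dual_vector[OF X(2) x(1)] by blast
    define q where "q = tlift (\<lambda>a (t :: ('a, 'm) tensor). \<phi> a *\<^sub>C t)"
    have ql: "clinear q" unfolding q_def by (intro clinear_tlift balanced_slice \<phi>(1))
    have qt: "q (a \<otimes>\<^sub>C t) = \<phi> a *\<^sub>C t" for a t
      unfolding q_def by (rule tlift_tens[OF cbilinear_balanced[OF balanced_slice[OF \<phi>(1)]]])
    have in_span: "q (tassoc (t \<otimes>\<^sub>C m)) \<in> tensor_subspace UNIV (cspan {m})" for t m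
    proof (induction t rule: tensor_induct)
      case (tens v w)
      show ?case by (simp add: tassoc_tens3 qt cvs.subspace_scale[OF tensor_subspace_closed]
            tensor_subspace_tens cvs.span_base)
    next
      case (add s t)
      then show ?case by (simp add: tens_add_left clinearD[OF clinear_tassoc] clinearD[OF ql]
            cvs.subspace_add[OF tensor_subspace_closed])
    qed
    have lin: "clinear \<delta>" by (rule clinear_comodule[OF assms])
    have "q (tmap id \<delta> (\<delta> m)) = (\<Sum>z\<in>X. \<phi> z *\<^sub>C \<delta> (f z))"
      by (simp add: X(3) clinearD[OF clinear_tmap[OF clinear_id lin]] tmap_idl[OF lin]
          clinearD[OF ql] qt)
    also have "\<dots> = \<delta> (f x)"
      using X(1) x(1) by (simp add: \<phi>(2) sum_delta_scaleC cong: sum.cong)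
    finally have "\<delta> y = q (tassoc (tmap (comult A) id (\<delta> m)))" by (simp add: co x(2))
    also have "\<dots> = (\<Sum>z\<in>X. q (tassoc (comult A z \<otimes>\<^sub>C f z)))"
      by (simp add: X(3) clinearD[OF clinear_tmap[OF comult_linear clinear_id]]
          tmap_idr[OF comult_linear] clinearD[OF clinear_tassoc] clinearD[OF ql])
    also have "\<dots> \<in> tensor_subspace UNIV (cspan (f ` X))"
    proof (rule cvs.subspace_sum[OF tensor_subspace_closed])
      fix z assume "z \<in> X"
      then have "cspan {f z} \<subseteq> cspan (f ` X)" by (intro cvs.span_mono) auto
      then show "q (tassoc (comult A z \<otimes>\<^sub>C f z)) \<in> tensor_subspace UNIV (cspan (f ` X))"
        using in_span tensor_subspace_mono by blast
    qed
    finally show ?thesis .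
  qed
  show thesis
    by (rule that[of "f ` X"]) (use X(1) m sub subcomodule_spanI clinear_comodule[OF assms] in auto)
qed

lemma comodule_locally_finite:
  fixes \<delta> :: "'m::complex_vector \<Rightarrow> ('a, 'm) tensor"
  assumes "left_comodule A \<delta>" "finite S"
  obtains X where "finite X" "S \<subseteq> cspan X" "subcomodule \<delta> (cspan X)"
proof -
  have "\<exists>X. finite X \<and> m \<in> cspan X \<and> subcomodule \<delta> (cspan X)" for m
    using comodule_locally_finite_single[OF assms(1)] by metis
  then obtain X where X: "\<And>m. finite (X m)" "\<And>m. m \<in> cspan (X m)" "\<And>m. subcomodule \<delta> (cspan (X m))"
    by metis
  let ?X = "\<Union>m\<in>S. X m"
  have le: "cspan (X m) \<subseteq> cspan ?X" if "m \<in> S" for m using that by (intro cvs.span_mono) auto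
  have "subcomodule \<delta> (cspan ?X)"
  proof (rule subcomodule_spanI[OF clinear_comodule[OF assms(1)]])
    fix x assume "x \<in> ?X"
    then obtain m where m: "m \<in> S" "x \<in> X m" by blast
    then have "\<delta> x \<in> tensor_subspace UNIV (cspan (X m))"
      using X(3)[of m] cvs.span_base[OF m(2)] by (auto simp: subcomodule_def)
    then show "\<delta> x \<in> tensor_subspace UNIV (cspan ?X)"
      using le[OF m(1)] tensor_subspace_mono by blast
  qed
  moreover have "S \<subseteq> cspan ?X" using X(2) le by blast
  ultimately show thesis using that[of ?X] assms(2) X(1) by simp
qed

lemma comodule_comult: "left_comodule A (comult A)"
  by (simp add: left_comodule_def comult_linear coassoc counit_left)

end

section \<open>Positive forms\<close>

locale psd_form =
  fixes s :: "'v::complex_vector \<Rightarrow> 'v \<Rightarrow> complex"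
  assumes add_right: "s x (y + z) = s x y + s x z"
    and scale_right: "s x (c *\<^sub>C y) = c * s x y"
    and hermitian: "s x y = cnj (s y x)"
    and nonneg: "0 \<le> Re (s x x)"
begin

lemma cnj_form: "cnj (s x y) = s y x"
  by (rule hermitian[symmetric])

lemma add_left: "s (x + y) z = s x z + s y z"
  by (metis add_right complex_cnj_add hermitian)

lemma scale_left: "s (c *\<^sub>C x) y = cnj c * s x y"
  by (metis scale_right complex_cnj_mult hermitian)

lemma linear_right: "clinear (s x)"
  by (rule clinearI) (simp_all add: add_right scale_right scaleC_complex_def)

lemma add_hom_left: "add_hom (\<lambda>x. s x y)"
  by (rule add_homI) (rule add_left)

lemmas right_simps = clinearD[OF linear_right]
lemmas left_simps = add_homD[OF add_hom_left]

lemma diag_real: "s x x = of_real (Re (s x x))"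
  using hermitian[of x x] by (simp add: complex_eq_iff)

lemma null_right:
  assumes "s x x = 0" shows "s y x = 0"
proof (rule ccontr)
  assume n: "s y x \<noteq> 0"
  define c where "c = s y x"
  \<comment> \<open>With this \<open>r\<close> the vector \<open>?z\<close> below would satisfy \<open>Re (s ?z ?z) = - 1\<close>.\<close>
  define r where "r = (Re (s y y) + 1) / (2 * (cmod c)\<^sup>2)"
  let ?z = "y - (of_real r * cnj c) *\<^sub>C x"
  have cc: "cnj c * c = of_real ((cmod c)\<^sup>2)" by (metis complex_norm_square mult.commute of_real_power)
  have "s ?z ?z = s y y - (of_real r * cnj c) * c - (of_real r * c) * cnj c"
    using assms hermitian[of x y] by (simp add: right_simps left_simps scale_left scaleC_complex_def c_def algebra_simps)
  also have "\<dots> = s y y - 2 * of_real (r * (cmod c)\<^sup>2)"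
    using cc by (simp add: algebra_simps)
  finally have "Re (s ?z ?z) = Re (s y y) - 2 * (r * (cmod c)\<^sup>2)" by simp
  also have "2 * (r * (cmod c)\<^sup>2) = Re (s y y) + 1" using n by (simp add: r_def c_def)
  finally show False using nonneg[of ?z] by simp
qed

text \<open>
  For a semidefinite form, an orthonormal family need not span. What survives is the expansion of the
  form itself: a vector whose orthogonal remainder is null contributes nothing to it.
\<close>

lemma gram_schmidt:
  assumes "finite X"
  shows "\<exists>R. finite R \<and> R \<subseteq> cspan X \<and> (\<forall>x\<in>R. \<forall>y\<in>R. s x y = (if x = y then 1 else 0)) \<and>
    (\<forall>x\<in>cspan X. \<forall>y. s y x = (\<Sum>e\<in>R. s y e * s e x))"
  using assms
proof (induction X)
  case empty
  show ?case by (rule exI[of _ "{}"]) (simp add: right_simps)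
next
  case (insert v X)
  then obtain R where R: "finite R" "R \<subseteq> cspan X"
    and orth: "\<And>x y. x \<in> R \<Longrightarrow> y \<in> R \<Longrightarrow> s x y = (if x = y then 1 else 0)"
    and parseval: "\<And>x y. x \<in> cspan X \<Longrightarrow> s y x = (\<Sum>e\<in>R. s y e * s e x)"
    by auto
  have sub: "cspan X \<subseteq> cspan (insert v X)" by (intro cvs.span_mono) auto
  define w where "w = v - (\<Sum>e\<in>R. s e v *\<^sub>C e)"
  have R_in: "(\<Sum>e\<in>R. s e v *\<^sub>C e) \<in> cspan X"
    using R(2) by (intro cvs.span_sum cvs.span_scale) auto
  have v_eq: "s y v = s y w + (\<Sum>e\<in>R. s y e * s e v)" for y
    by (simp add: w_def right_simps scaleC_complex_def mult.commute)
  have w_orth: "s w x = 0" if "x \<in> cspan X" for x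
  proof -
    have "s w x = s v x - (\<Sum>e\<in>R. s v e * s e x)"
      by (simp add: w_def left_simps scale_left cnj_form)
    then show ?thesis using parseval[OF that, of v] by (metis right_minus_eq)
  qed
  have decomp: "\<exists>c. \<exists>x'\<in>cspan X. x = c *\<^sub>C v + x'" if "x \<in> cspan (insert v X)" for x
    using that unfolding cvs.span_breakdown_eq by (metis diff_add_cancel add.commute)
  show ?case
  proof (cases "s w w = 0")
    case True
    have "s y x = (\<Sum>e\<in>R. s y e * s e x)" if "x \<in> cspan (insert v X)" for x y
    proof -
      obtain c x' where x: "x' \<in> cspan X" "x = c *\<^sub>C v + x'" using decomp[OF \<open>x \<in> cspan (insert v X)\<close>] by blast
      have "s y x = c * (\<Sum>e\<in>R. s y e * s e v) + (\<Sum>e\<in>R. s y e * s e x')"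
        using parseval[OF x(1), of y] v_eq[of y] null_right[OF True, of y]
        by (simp add: x(2) right_simps scaleC_complex_def)
      then show ?thesis
        by (simp add: x(2) right_simps scaleC_complex_def sum_distrib_left sum.distrib[symmetric] algebra_simps)
    qed
    then show ?thesis using R orth sub by (intro exI[of _ R]) auto
  next
    case False
    define c where "c = sqrt (Re (s w w))"
    have pos: "Re (s w w) > 0"
      using False nonneg[of w] diag_real[of w] by (metis less_eq_real_def of_real_0)
    have c0: "c > 0" using pos by (simp add: c_def)
    have cc: "of_real c * of_real c = s w w"
      using pos diag_real[of w] by (simp add: c_def flip: of_real_mult)
    define f where "f = (1 / of_real c) *\<^sub>C w"
    have f_orth: "s f x = 0" "s x f = 0" if "x \<in> cspan X" for x
      using w_orth[OF that] hermitian[of x f] by (simp_all add: f_def scale_left)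
    have ff: "s f f = 1" using c0 by (simp add: f_def scale_left right_simps scaleC_complex_def flip: cc)
    have fR: "f \<notin> cspan X" using f_orth(1)[of f] ff by auto
    have wv: "s y f * s f v = s y w" for y
    proof -
      have "s w v = s w w" using v_eq[of w] w_orth R(2) by (simp add: subset_iff)
      then have "s f v = of_real c" using c0 by (simp add: f_def scale_left flip: cc)
      then show ?thesis using c0 by (simp add: f_def right_simps scaleC_complex_def)
    qed
    have pars: "s y x = (\<Sum>e\<in>insert f R. s y e * s e x)" if "x \<in> cspan (insert v X)" for x y
    proof -
      obtain d x' where x: "x' \<in> cspan X" "x = d *\<^sub>C v + x'" using decomp[OF \<open>x \<in> cspan (insert v X)\<close>] by blast
      have sv: "s y v = (\<Sum>e\<in>insert f R. s y e * s e v)"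
        using R(1) fR R(2) v_eq[of y] wv[of y] by (subst sum.insert) auto
      have sx: "s y x' = (\<Sum>e\<in>insert f R. s y e * s e x')"
        using R(1) fR R(2) parseval[OF x(1), of y] f_orth(1)[OF x(1)] by (subst sum.insert) auto
      show ?thesis
        by (simp add: x(2) add_right scale_right sv sx sum_distrib_left sum.distrib distrib_left mult.assoc mult.left_commute
            del: sum.insert)
    qed
    have "w \<in> cspan (insert v X)" unfolding w_def
      using R_in sub by (intro cvs.span_diff) (auto intro: cvs.span_base)
    then have fin: "f \<in> cspan (insert v X)" unfolding f_def by (rule cvs.span_scale)
    have "s x y = (if x = y then 1 else 0)" if "x \<in> insert f R" "y \<in> insert f R" for x y
      using that orth f_orth ff R(2) fR by (metis insert_iff subset_iff)
    then show ?thesis using R(1,2) fin sub pars by (intro exI[of _ "insert f R"]) auto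
  qed
qed

lemma ex_orthonormal_basis:
  assumes "finite X" and definite: "\<forall>x. s x x = 0 \<longrightarrow> x = 0"
  shows "\<exists>R. finite R \<and> cspan R = cspan X \<and> cvs.independent R \<and>
    (\<forall>x\<in>R. \<forall>y\<in>R. s x y = (if x = y then 1 else 0)) \<and>
    (\<forall>x\<in>cspan X. x = (\<Sum>e\<in>R. s e x *\<^sub>C e))"
proof -
  obtain R where R: "finite R" "R \<subseteq> cspan X"
    and orth: "\<And>x y. x \<in> R \<Longrightarrow> y \<in> R \<Longrightarrow> s x y = (if x = y then 1 else 0)"
    and parseval: "\<And>x y. x \<in> cspan X \<Longrightarrow> s y x = (\<Sum>e\<in>R. s y e * s e x)"
    using gram_schmidt[OF assms(1)] by blast
  have expand: "x = (\<Sum>e\<in>R. s e x *\<^sub>C e)" if "x \<in> cspan X" for x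
  proof -
    let ?z = "x - (\<Sum>e\<in>R. s e x *\<^sub>C e)"
    have "s ?z ?z = 0" using parseval[OF that, of ?z]
      by (simp add: right_simps[of ?z] scaleC_complex_def mult.commute)
    then show ?thesis using definite by force
  qed
  have "cspan X \<subseteq> cspan R"
  proof
    fix x assume "x \<in> cspan X"
    then have "x = (\<Sum>e\<in>R. s e x *\<^sub>C e)" by (rule expand)
    also have "\<dots> \<in> cspan R" by (intro cvs.span_sum cvs.span_scale cvs.span_base)
    finally show "x \<in> cspan R" .
  qed
  moreover have "cspan R \<subseteq> cspan X" using R(2) by (simp add: cvs.span_minimal cvs.subspace_span)
  moreover have "cvs.independent R"
  proof (rule cvs.independent_if_scalars_zero[OF R(1)])
    fix f x assume z: "(\<Sum>y\<in>R. f y *\<^sub>C y) = 0" and x: "x \<in> R"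
    have "0 = s x (\<Sum>y\<in>R. f y *\<^sub>C y)" by (simp add: z right_simps)
    also have "\<dots> = (\<Sum>y\<in>R. if x = y then f y else 0)"
      unfolding right_simps by (rule sum.cong) (auto simp: scaleC_complex_def orth x)
    finally show "f x = 0" using R(1) x by simp
  qed
  ultimately show ?thesis using R(1)
    by (intro exI[of _ R] conjI ballI subset_antisym orth expand)
qed

lemma orthonormal_projection:
  assumes "finite R" and orth: "\<forall>x\<in>R. \<forall>y\<in>R. s x y = (if x = y then 1 else 0)" and "x \<in> cspan R"
  shows "s x (a - (\<Sum>e\<in>R. s e a *\<^sub>C e)) = 0"
  using assms(3)
proof (induction rule: cvs.span_induct_alt)
  case (step c y z)
  have "s y (\<Sum>e\<in>R. s e a *\<^sub>C e) = (\<Sum>e\<in>R. if y = e then s e a else 0)"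
    unfolding right_simps using orth step.hyps(1) by (intro sum.cong) (auto simp: scaleC_complex_def)
  then have "s y (a - (\<Sum>e\<in>R. s e a *\<^sub>C e)) = 0"
    using assms(1) step.hyps(1) by (simp add: right_simps)
  then show ?case using step.IH by (simp add: add_left scale_left)
qed (simp add: left_simps)

end

text \<open>
  Hermitian symmetry follows by polarization from real values at \<open>x + y\<close> and \<open>x + \<i> y\<close>.
\<close>

lemma psd_formI:
  fixes s :: "'v::complex_vector \<Rightarrow> 'v \<Rightarrow> complex"
  assumes r: "\<And>x y z. s x (y + z) = s x y + s x z" "\<And>x c y. s x (c *\<^sub>C y) = c * s x y"
    and l: "\<And>x y z. s (x + y) z = s x z + s y z" "\<And>x c y. s (c *\<^sub>C x) y = cnj c * s x y"
    and pos: "\<And>x. s x x \<in> \<real>" "\<And>x. 0 \<le> Re (s x x)"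
  shows "psd_form s"
proof
  fix x y
  have d: "Im (s z z) = 0" for z using pos(1)[of z] by (simp add: complex_is_Real_iff)
  have "Im (s x y + s y x) = 0" using d[of "x + y"] by (simp add: r l d)
  moreover have "Im (\<i> * s x y - \<i> * s y x) = 0" using d[of "x + \<i> *\<^sub>C y"] by (simp add: r l d)
  ultimately show "s x y = cnj (s y x)" by (simp add: complex_eq_iff)
qed (use assms in auto)

context psd_form
begin

definition seminorm :: "'v \<Rightarrow> real"
  where "seminorm x = sqrt (Re (s x x))"

lemma seminorm_nonneg: "0 \<le> seminorm x"
  by (simp add: seminorm_def nonneg)

lemma seminorm_square: "s x x = of_real ((seminorm x)\<^sup>2)"
  using diag_real[of x] nonneg[of x] by (simp add: seminorm_def)

lemma seminorm_scale: "seminorm (c *\<^sub>C x) = cmod c * seminorm x"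
proof -
  have "s (c *\<^sub>C x) (c *\<^sub>C x) = of_real ((cmod c * seminorm x)\<^sup>2)"
  proof -
    have "s (c *\<^sub>C x) (c *\<^sub>C x) = (c * cnj c) * s x x" by (simp add: scale_left scale_right)
    then show ?thesis by (simp add: seminorm_square power_mult_distrib flip: complex_norm_square)
  qed
  then show ?thesis by (simp add: seminorm_def nonneg)
qed

lemma cauchy_schwarz: "cmod (s x y) \<le> seminorm x * seminorm y"
proof (cases "seminorm y = 0")
  case True
  then have "s y y = 0" using seminorm_square[of y] by simp
  then show ?thesis using null_right[of y x] True by simp
next
  case False
  define n where "n = seminorm y"
  have n: "n > 0" using False seminorm_nonneg[of y] by (simp add: n_def)
  define c where "c = s y x / of_real (n\<^sup>2)"
  let ?z = "x - c *\<^sub>C y"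
  have "s ?z ?z = s x x - c * s x y - cnj c * s y x + c * (cnj c * s y y)"
    by (simp add: right_simps left_simps scale_left scaleC_complex_def algebra_simps)
  also have "\<dots> = s x x - c * s x y"
  proof -
    have "c * s y y = s y x" using n by (simp add: seminorm_square[of y] n_def[symmetric] c_def)
    then have "c * (cnj c * s y y) = cnj c * s y x" by (metis mult.left_commute)
    then show ?thesis by simp
  qed
  also have "c * s x y = of_real ((cmod (s x y))\<^sup>2 / n\<^sup>2)"
  proof -
    have "s y x * s x y = of_real ((cmod (s x y))\<^sup>2)"
      by (metis cnj_form complex_norm_square mult.commute of_real_power)
    then show ?thesis by (simp add: c_def)
  qed
  finally have "(cmod (s x y))\<^sup>2 / n\<^sup>2 \<le> Re (s x x)" using nonneg[of ?z] by simp
  then have "(cmod (s x y))\<^sup>2 \<le> (seminorm x * n)\<^sup>2"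
    using n by (simp add: seminorm_square power_mult_distrib field_simps)
  from power2_le_imp_le[OF this] have "cmod (s x y) \<le> seminorm x * n"
    using n seminorm_nonneg[of x] by simp
  then show ?thesis by (simp add: n_def)
qed

lemma seminorm_triangle: "seminorm (x + y) \<le> seminorm x + seminorm y"
proof -
  have "Re (s (x + y) (x + y)) = Re (s x x) + Re (s y y) + 2 * Re (s x y)"
    using arg_cong[OF cnj_form[of x y], of Re] by (simp add: add_left add_right)
  also have "\<dots> \<le> (seminorm x)\<^sup>2 + (seminorm y)\<^sup>2 + 2 * (seminorm x * seminorm y)"
    using cauchy_schwarz[of x y] complex_Re_le_cmod[of "s x y"] by (simp add: seminorm_square)
  finally have "(seminorm (x + y))\<^sup>2 \<le> (seminorm x + seminorm y)\<^sup>2"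
    by (simp add: seminorm_square power2_sum)
  from power2_le_imp_le[OF this] show ?thesis
    using seminorm_nonneg[of x] seminorm_nonneg[of y] by simp
qed

lemma seminorm_sum: "seminorm (\<Sum>i\<in>I. f i) \<le> (\<Sum>i\<in>I. seminorm (f i))"
proof (induction I rule: infinite_finite_induct)
  case (insert i I)
  then show ?case using seminorm_triangle[of "f i" "sum f I"] by simp
qed (simp_all add: seminorm_def right_simps)

end

section \<open>Lifts from pairs of tensors\<close>

text \<open>
  Lifts of maps in the four legs of two tensors. Balancedness in each pair of legs allows both
  multilinear maps and maps that are conjugate-linear in the legs of the first tensor.
\<close>

definition pair_lift ::
    "('a::complex_vector \<Rightarrow> 'm::complex_vector \<Rightarrow> 'b::complex_vector \<Rightarrow> 'n::complex_vector \<Rightarrow> 'c::ab_group_add) \<Rightarrow>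
     ('a, 'm) tensor \<Rightarrow> ('b, 'n) tensor \<Rightarrow> 'c"
  where "pair_lift \<beta> t t' = tlift (\<lambda>a x. tlift (\<beta> a x) t') t"

definition pair_balanced ::
    "('a::complex_vector \<Rightarrow> 'm::complex_vector \<Rightarrow> 'b::complex_vector \<Rightarrow> 'n::complex_vector \<Rightarrow> 'c::ab_group_add) \<Rightarrow> bool"
  where "pair_balanced \<beta> \<longleftrightarrow> (\<forall>a x. balanced (\<beta> a x)) \<and> (\<forall>b y. balanced (\<lambda>a x. \<beta> a x b y))"

lemma pair_balanced_outer:
  assumes "pair_balanced \<beta>" shows "balanced (\<lambda>a x. tlift (\<beta> a x) t)"
  using assms unfolding pair_balanced_def balanced_def tlift_def by (simp add: sum.distrib)

lemma pair_lift_sum: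
  assumes "pair_balanced \<beta>"
  shows "pair_lift \<beta> (\<Sum>i\<in>I. a i \<otimes>\<^sub>C x i) (\<Sum>j\<in>J. b j \<otimes>\<^sub>C y j) = (\<Sum>i\<in>I. \<Sum>j\<in>J. \<beta> (a i) (x i) (b j) (y j))"
proof -
  have b: "balanced (\<beta> v w)" for v w using assms by (simp add: pair_balanced_def)
  show ?thesis unfolding pair_lift_def
    by (simp only: tlift_sum[OF pair_balanced_outer[OF assms]] tlift_tens[OF pair_balanced_outer[OF assms]])
       (simp only: tlift_sum[OF b] tlift_tens[OF b])
qed

lemma cbilinear_pair_lift:
  assumes "\<And>a x. cbilinear (\<beta> a x)" "\<And>b y. cbilinear (\<lambda>a x. \<beta> a x b y)"
  shows "cbilinear (pair_lift \<beta>)"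
proof -
  have c: "cbilinear (\<lambda>a x. tlift (\<beta> a x) t)" for t
    using assms(2) unfolding cbilinear_def by (intro conjI allI clinear_tlift_param) auto
  show ?thesis unfolding cbilinear_def pair_lift_def[abs_def]
    by (intro conjI allI clinear_tlift c clinear_tlift_param assms(1))
qed

lemma cbilinear_pair_balanced:
  assumes "\<And>a x. cbilinear (\<beta> a x)" "\<And>b y. cbilinear (\<lambda>a x. \<beta> a x b y)"
  shows "pair_balanced \<beta>"
  using assms by (simp add: pair_balanced_def cbilinear_balanced)

lemma pair_balanced_tmult: "pair_balanced (\<lambda>(u::'a::complex_algebra_1) (v::'b::complex_algebra_1) u' v'. (u * u') \<otimes>\<^sub>C (v * v'))"
  unfolding pair_balanced_def
  by (intro conjI allI balancedI)
     (simp_all add: distrib_left distrib_right tens_add_left tens_add_right mult_scaleC_left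
       mult_scaleC_right tens_scaleC_left tens_scaleC_right)

lemma tmult_sum: "tmult (\<Sum>i\<in>I. a i \<otimes>\<^sub>C x i) (\<Sum>j\<in>J. b j \<otimes>\<^sub>C y j)
    = (\<Sum>i\<in>I. \<Sum>j\<in>J. (a i * b j) \<otimes>\<^sub>C (x i * y j))"
  using pair_lift_sum[OF pair_balanced_tmult] by (simp add: pair_lift_def tmult_def)

lemma sum_delta_mult:
  fixes f :: "'i \<Rightarrow> 'a::ring_1"
  assumes "finite X" "x \<in> X"
  shows "(\<Sum>y\<in>X. (if y = x then 1 else 0) * f y) = f x" "(\<Sum>y\<in>X. (if x = y then 1 else 0) * f y) = f x"
    "(\<Sum>y\<in>X. f y * (if y = x then 1 else 0)) = f x" "(\<Sum>y\<in>X. f y * (if x = y then 1 else 0)) = f x"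
proof -
  have "(\<Sum>y\<in>X. (if y = x then 1 else 0) * f y) = (\<Sum>y\<in>X. if y = x then f y else 0)"
    "(\<Sum>y\<in>X. (if x = y then 1 else 0) * f y) = (\<Sum>y\<in>X. if x = y then f y else 0)"
    "(\<Sum>y\<in>X. f y * (if y = x then 1 else 0)) = (\<Sum>y\<in>X. if y = x then f y else 0)"
    "(\<Sum>y\<in>X. f y * (if x = y then 1 else 0)) = (\<Sum>y\<in>X. if x = y then f y else 0)"
    by (auto intro!: sum.cong)
  then show "(\<Sum>y\<in>X. (if y = x then 1 else 0) * f y) = f x" "(\<Sum>y\<in>X. (if x = y then 1 else 0) * f y) = f x"
    "(\<Sum>y\<in>X. f y * (if y = x then 1 else 0)) = f x" "(\<Sum>y\<in>X. f y * (if x = y then 1 else 0)) = f x"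
    using assms by simp_all
qed

lemma scaleC_if: "(if P then 1 else 0) *\<^sub>C x = (if P then x else (0::'a::complex_vector))"
  by (simp add: scaleC_one)

lemma star_if: "star (if P then 1 else 0 :: 'a::complex_star_algebra) = (if P then 1 else 0)"
  by (simp add: star_one star_simps)

section \<open>The Haar functional\<close>

context hopf_star_algebra
begin

lemma comodule_corep_basis:
  fixes \<delta> :: "'m::complex_vector \<Rightarrow> ('a, 'm) tensor"
  assumes "left_comodule A \<delta>" "finite S"
  obtains W u where "corep_basis A \<delta> W u" "S \<subseteq> cspan W" "finite W"
proof -
  obtain X where X: "finite X" "S \<subseteq> cspan X" "subcomodule \<delta> (cspan X)"
    using comodule_locally_finite[OF assms] by blast
  obtain W where W: "W \<subseteq> X" "cvs.independent W" "X \<subseteq> cspan W"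
    using cvs.maximal_independent_subset[of X] by blast
  have eq: "cspan W = cspan X"
    using W(1,3) by (metis cvs.span_minimal cvs.span_mono cvs.subspace_span subset_antisym)
  have "finite W" using W(1) X(1) finite_subset by blast
  with W(2) X(2,3) eq show thesis
    using subcomodule_corep_basis[OF assms(1) \<open>finite W\<close>] that by metis
qed

lemma balanced_antipode:
  "balanced (\<lambda>x y. antipode A x * y)" "balanced (\<lambda>x y. x * antipode A y)"
  by (rule balancedI; simp add: clinearD[OF antipode_linear] distrib_left distrib_right mult_scaleC_left mult_scaleC_right)+

lemma corep_antipode:
  assumes "corep_basis A \<delta> W u" "x \<in> W" "y \<in> W"
  shows "(\<Sum>z\<in>W. antipode A (u x z) * u z y) = (if x = y then 1 else 0)"
    "(\<Sum>z\<in>W. u x z * antipode A (u z y)) = (if x = y then 1 else 0)"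
proof -
  have c: "comult A (u x y) = (\<Sum>z\<in>W. u x z \<otimes>\<^sub>C u z y)" "counit A (u x y) = (if x = y then 1 else 0)"
    using assms by (auto simp: corep_basis_def)
  show "(\<Sum>z\<in>W. antipode A (u x z) * u z y) = (if x = y then 1 else 0)"
    using antipode_left[of "u x y"] balanced_antipode(1)
    by (simp add: c tlift_sum tlift_tens scaleC_one)
  show "(\<Sum>z\<in>W. u x z * antipode A (u z y)) = (if x = y then 1 else 0)"
    using antipode_right[of "u x y"] balanced_antipode(2)
    by (simp add: c tlift_sum tlift_tens scaleC_one)
qed

lemma comult_star_sum: "comult A a = (\<Sum>i\<in>I. x i \<otimes>\<^sub>C y i) \<Longrightarrow> comult A (star a) = (\<Sum>i\<in>I. star (x i) \<otimes>\<^sub>C star (y i))"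
  by (simp add: comult_star add_homD[OF add_hom_conj_tmap[OF conjlinear_star conjlinear_star]]
      tmap_conj_tens conjlinear_star)

lemma comult_mult_sum:
  "comult A a = (\<Sum>i\<in>I. x i \<otimes>\<^sub>C y i) \<Longrightarrow> comult A b = (\<Sum>j\<in>J. x' j \<otimes>\<^sub>C y' j) \<Longrightarrow>
   comult A (a * b) = (\<Sum>i\<in>I. \<Sum>j\<in>J. (x i * x' j) \<otimes>\<^sub>C (y i * y' j))"
  by (simp add: comult_mult tmult_sum)

lemma counit_left_sum: "comult A a = (\<Sum>i\<in>I. x i \<otimes>\<^sub>C y i) \<Longrightarrow> (\<Sum>i\<in>I. counit A (x i) *\<^sub>C y i) = a"
  using counit_left[of a] by (simp add: tlift_slice counit_linear)

lemma counit_right_sum: "comult A a = (\<Sum>i\<in>I. x i \<otimes>\<^sub>C y i) \<Longrightarrow> (\<Sum>i\<in>I. counit A (y i) *\<^sub>C x i) = a"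
  using counit_right[of a] by (simp add: tlift_slice_right counit_linear)

lemma corep_star_antipode:
  assumes "corep_basis A \<delta> W u" "k \<in> W" "m \<in> W"
  shows "(\<Sum>x\<in>W. u x k * star (antipode A (star (u m x)))) = (if m = k then 1 else 0)"
proof -
  have c: "comult A (u m k) = (\<Sum>x\<in>W. u m x \<otimes>\<^sub>C u x k)" "counit A (u m k) = (if m = k then 1 else 0)"
    using assms by (auto simp: corep_basis_def)
  have "(\<Sum>x\<in>W. antipode A (star (u m x)) * star (u x k)) = cnj (counit A (u m k)) *\<^sub>C 1"
    using antipode_left[of "star (u m k)"] balanced_antipode(1)
    by (simp add: comult_star_sum[OF c(1)] tlift_sum tlift_tens counit_star)
  also have "\<dots> = (if m = k then 1 else 0)" by (simp add: c(2) scaleC_one)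
  finally have "(\<Sum>x\<in>W. antipode A (star (u m x)) * star (u x k)) = (if m = k then 1 else 0)" .
  from arg_cong[OF this, of star] show ?thesis
    by (simp add: star_simps star_mult star_star star_if)
qed

end

text \<open>
  That is, \<open>x\<^sub>-\<^sub>1\<^sup>* y\<^sub>-\<^sub>1 s(x\<^sub>0, y\<^sub>0) = s(x, y) 1\<close>.
\<close>

definition invariant_form ::
    "'a::complex_star_algebra hopf \<Rightarrow> ('m::complex_vector \<Rightarrow> ('a, 'm) tensor) \<Rightarrow> ('m \<Rightarrow> 'm \<Rightarrow> complex) \<Rightarrow> bool"
  where "invariant_form A \<delta> s \<longleftrightarrow>
    (\<forall>x y. pair_lift (\<lambda>a x' b y'. s x' y' *\<^sub>C (star a * b)) (\<delta> x) (\<delta> y) = s x y *\<^sub>C (1::'a))"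

lemma (in psd_form) pair_balanced_form:
  "pair_balanced (\<lambda>(a::'a::complex_star_algebra) x b y. s x y *\<^sub>C (star a * b))"
  unfolding pair_balanced_def
  by (intro conjI allI balancedI)
     (simp_all add: add_left add_right scale_left scale_right distrib_left distrib_right star_simps
      scaleC_add_left scaleC_add_right mult_scaleC_left mult_scaleC_right scaleC_scaleC mult.commute)

text \<open>
  Orthonormality of the basis makes the conjugate matrix a one-sided inverse of the transpose of
  \<open>u\<close>. The antipode provides an inverse on the other side, so the conjugate is a two-sided inverse.
\<close>

lemma (in hopf_star_algebra) orthonormal_corep_unitary:
  assumes "psd_form s" "invariant_form A \<delta> s" "corep_basis A \<delta> W u"
    and orth: "\<And>x y. x \<in> W \<Longrightarrow> y \<in> W \<Longrightarrow> s x y = (if x = y then 1 else 0)"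
    and "x \<in> W" "y \<in> W"
  shows "(\<Sum>z\<in>W. star (u x z) * u y z) = (if x = y then 1 else 0)"
    "(\<Sum>z\<in>W. u z x * star (u z y)) = (if x = y then 1 else 0)"
proof -
  have W: "finite W" "\<And>x. x \<in> W \<Longrightarrow> \<delta> x = (\<Sum>y\<in>W. u x y \<otimes>\<^sub>C y)"
    using assms(3) by (auto simp: corep_basis_def)
  have 1: "(\<Sum>z\<in>W. star (u x z) * u y z) = (if x = y then 1 else 0)" if "x \<in> W" "y \<in> W" for x y
  proof -
    have "s x y *\<^sub>C 1 = pair_lift (\<lambda>a x' b y'. s x' y' *\<^sub>C (star a * b)) (\<delta> x) (\<delta> y)"
      using assms(2) by (simp add: invariant_form_def)
    also have "\<dots> = (\<Sum>z\<in>W. \<Sum>z'\<in>W. s z z' *\<^sub>C (star (u x z) * u y z'))"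
      by (simp add: W that pair_lift_sum[OF psd_form.pair_balanced_form[OF assms(1)]])
    also have "\<dots> = (\<Sum>z\<in>W. star (u x z) * u y z)"
      by (rule sum.cong) (simp_all add: orth W(1) sum_delta_scaleC cong: sum.cong)
    finally show ?thesis unfolding orth[OF that] scaleC_if by (rule sym)
  qed
  then show "(\<Sum>z\<in>W. star (u x z) * u y z) = (if x = y then 1 else 0)" using assms(5,6) by simp
  define v where "v x m = star (antipode A (star (u m x)))" for x m
  have v: "(\<Sum>x\<in>W. u x k * v x m) = (if m = k then 1 else 0)" if "k \<in> W" "m \<in> W" for k m
    unfolding v_def by (rule corep_star_antipode[OF assms(3) that])
  have "v z m = star (u z m)" if "z \<in> W" "m \<in> W" for z m
  proof -
    have "v z m = (\<Sum>x\<in>W. (if z = x then 1 else 0) * v x m)"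
      using that W(1) by (simp add: sum_delta_mult)
    also have "\<dots> = (\<Sum>x\<in>W. \<Sum>k\<in>W. star (u z k) * (u x k * v x m))"
      by (rule sum.cong) (simp_all add: 1[symmetric] that sum_distrib_right mult.assoc)
    also have "\<dots> = (\<Sum>k\<in>W. star (u z k) * (if m = k then 1 else 0))"
      by (subst sum.swap) (rule sum.cong, simp_all add: v[symmetric] that sum_distrib_left)
    also have "\<dots> = star (u z m)" using that W(1) by (simp add: sum_delta_mult)
    finally show ?thesis .
  qed
  then have "(\<Sum>z\<in>W. u z x * star (u z y)) = (\<Sum>z\<in>W. u z x * v z y)"
    using assms(6) by (intro sum.cong) auto
  also have "\<dots> = (if x = y then 1 else 0)" using v[OF assms(5,6)] by auto
  finally show "(\<Sum>z\<in>W. u z x * star (u z y)) = (if x = y then 1 else 0)" .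
qed

lemma (in hopf_star_algebra) orthonormal_corep_basis:
  fixes \<delta> :: "'m::complex_vector \<Rightarrow> ('a, 'm) tensor"
  assumes "left_comodule A \<delta>" "finite S" "psd_form s" "\<And>x. s x x = 0 \<Longrightarrow> x = 0"
  obtains W u where "corep_basis A \<delta> W u" "S \<subseteq> cspan W" "finite W"
    "\<And>x y. x \<in> W \<Longrightarrow> y \<in> W \<Longrightarrow> s x y = (if x = y then 1 else 0)"
proof -
  obtain X where X: "finite X" "S \<subseteq> cspan X" "subcomodule \<delta> (cspan X)"
    using comodule_locally_finite[OF assms(1,2)] by blast
  interpret psd_form s by fact
  obtain W where W: "finite W" "cspan W = cspan X" "cvs.independent W"
    "\<And>x y. x \<in> W \<Longrightarrow> y \<in> W \<Longrightarrow> s x y = (if x = y then 1 else 0)"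
    using ex_orthonormal_basis[OF X(1)] assms(4) by auto
  then show thesis
    using subcomodule_corep_basis[OF assms(1) W(1,3)] X(2,3) that by metis
qed

text \<open>
  Apply one functional to the left leg and the other to the right leg of \<open>\<Delta>(a)\<close>.
\<close>

lemma haar_functional_unique:
  assumes "haar_functional A h" "haar_functional A h'"
  shows "h = h'"
proof
  fix a
  have l: "clinear h" "clinear h'" and one: "h 1 = 1" "h' 1 = 1" using assms by (auto simp: haar_functional_def)
  obtain X f where X: "comult A a = (\<Sum>x\<in>X. x \<otimes>\<^sub>C f x)" using tensor_expansion_UNIV by blast
  have "(\<Sum>x\<in>X. h (f x) *\<^sub>C x) = h a *\<^sub>C 1" "(\<Sum>x\<in>X. h' x *\<^sub>C f x) = h' a *\<^sub>C 1"
    using assms by (auto simp: haar_functional_def X tlift_slice[OF l(2)] tlift_slice_right[OF l(1)]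
      dest!: spec[of _ a])
  from arg_cong[OF this(1), of h'] arg_cong[OF this(2), of h] show "h a = h' a"
    by (simp add: clinearD[OF l(1)] clinearD[OF l(2)] one scaleC_complex_def mult.commute)
qed

context cqga
begin

lemma haar_functional_haar: "haar_functional A (haar A)"
  unfolding haar_def using haar_exists haar_functional_unique by (metis theI)

lemma haar_linear: "clinear (haar A)" and haar_one: "haar A 1 = 1"
  using haar_functional_haar by (auto simp: haar_functional_def)

lemma haar_left: "comult A a = (\<Sum>i\<in>I. x i \<otimes>\<^sub>C y i) \<Longrightarrow> (\<Sum>i\<in>I. haar A (y i) *\<^sub>C x i) = haar A a *\<^sub>C 1"
  using haar_functional_haar tlift_slice_right[OF haar_linear, of x y I]
  by (simp add: haar_functional_def) metis

lemma haar_right: "comult A a = (\<Sum>i\<in>I. x i \<otimes>\<^sub>C y i) \<Longrightarrow> (\<Sum>i\<in>I. haar A (x i) *\<^sub>C y i) = haar A a *\<^sub>C 1"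
  using haar_functional_haar tlift_slice[OF haar_linear, of x y I]
  by (simp add: haar_functional_def) metis

lemma haar_form: "psd_form (\<lambda>x y. haar A (star x * y))"
  by (rule psd_formI)
     (use haar_state in \<open>auto simp: distrib_left distrib_right clinearD[OF haar_linear] star_simps
       mult_scaleC_left mult_scaleC_right scaleC_complex_def\<close>)

sublocale haar: psd_form "\<lambda>x y. haar A (star x * y)"
  by (rule haar_form)

lemma haar_invariant: "invariant_form A (comult A) (\<lambda>x y. haar A (star x * y))"
  unfolding invariant_form_def
proof (intro allI)
  fix x y
  obtain X f where X: "comult A x = (\<Sum>p\<in>X. p \<otimes>\<^sub>C f p)" using tensor_expansion_UNIV by blast
  obtain Y g where Y: "comult A y = (\<Sum>q\<in>Y. q \<otimes>\<^sub>C g q)" using tensor_expansion_UNIV by blast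
  have "comult A (star x * y) = (\<Sum>(p, q)\<in>X \<times> Y. (star p * q) \<otimes>\<^sub>C (star (f p) * g q))"
    by (simp add: comult_mult_sum[OF comult_star_sum[OF X] Y] sum.cartesian_product)
  then have "haar A (star x * y) *\<^sub>C 1 = (\<Sum>(p, q)\<in>X \<times> Y. haar A (star (f p) * g q) *\<^sub>C (star p * q))"
    using haar_left[of "star x * y" "\<lambda>(p, q). star p * q" "\<lambda>(p, q). star (f p) * g q" "X \<times> Y"]
    by (simp add: case_prod_beta)
  then show "pair_lift (\<lambda>a x' b y'. haar A (star x' * y') *\<^sub>C (star a * b)) (comult A x) (comult A y)
      = haar A (star x * y) *\<^sub>C 1"
    by (simp add: X Y pair_lift_sum[OF haar.pair_balanced_form] sum.cartesian_product)
qed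

text \<open>
  This is the strong invariance \<open>a\<^sub>1 h(b a\<^sub>2) = S(b\<^sub>1) h(b\<^sub>2 a)\<close> for \<open>b = w x\<close>. The invariance of the Haar
  functional at the elements \<open>w y * a\<close> is a linear system with matrix \<open>u\<close>, which the antipode inverts.
\<close>

lemma haar_strong_left:
  assumes I: "finite I" "\<And>x. x \<in> I \<Longrightarrow> comult A (w x) = (\<Sum>y\<in>I. u x y \<otimes>\<^sub>C w y)"
    and S: "\<And>x y. x \<in> I \<Longrightarrow> y \<in> I \<Longrightarrow> (\<Sum>z\<in>I. antipode A (u x z) * u z y) = (if x = y then 1 else 0)"
    and x: "x \<in> I" and a: "comult A a = (\<Sum>p\<in>P. p \<otimes>\<^sub>C f p)"
  shows "(\<Sum>p\<in>P. haar A (w x * f p) *\<^sub>C p) = (\<Sum>y\<in>I. haar A (w y * a) *\<^sub>C antipode A (u x y))"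
proof -
  define T where "T z = (\<Sum>p\<in>P. haar A (w z * f p) *\<^sub>C p)" for z
  have T: "haar A (w y * a) *\<^sub>C 1 = (\<Sum>z\<in>I. u y z * T z)" if "y \<in> I" for y
  proof -
    have "comult A (w y * a) = (\<Sum>(z, p)\<in>I \<times> P. (u y z * p) \<otimes>\<^sub>C (w z * f p))"
      by (simp add: comult_mult_sum[OF I(2)[OF that] a] sum.cartesian_product)
    then have "haar A (w y * a) *\<^sub>C 1 = (\<Sum>(z, p)\<in>I \<times> P. haar A (w z * f p) *\<^sub>C (u y z * p))"
      using haar_left[of "w y * a" "\<lambda>(z, p). u y z * p" "\<lambda>(z, p). w z * f p" "I \<times> P"]
      by (simp add: case_prod_beta)
    then show ?thesis
      by (simp add: T_def sum.cartesian_product[symmetric] sum_distrib_left mult_scaleC_right)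
  qed
  have "(\<Sum>y\<in>I. haar A (w y * a) *\<^sub>C antipode A (u x y))
      = (\<Sum>y\<in>I. antipode A (u x y) * (haar A (w y * a) *\<^sub>C 1))"
    by (simp add: mult_scaleC_right)
  also have "\<dots> = (\<Sum>y\<in>I. \<Sum>z\<in>I. antipode A (u x y) * u y z * T z)"
    by (rule sum.cong) (simp_all add: T sum_distrib_left mult.assoc)
  also have "\<dots> = (\<Sum>z\<in>I. (if x = z then 1 else 0) * T z)"
    by (subst sum.swap) (rule sum.cong, simp_all add: S[symmetric] x sum_distrib_right)
  also have "\<dots> = T x" using x I(1) by (simp add: sum_delta_mult)
  finally show ?thesis by (simp add: T_def)
qed

text \<open>
  The counterpart for the other leg. The system has the matrix of conjugates of \<open>u\<close>, so the composite of
  antipode and involution takes the place of the antipode.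
\<close>

lemma haar_strong_right:
  assumes W: "corep_basis A \<delta> W u" "x \<in> W" "j \<in> W" and a: "comult A a = (\<Sum>p\<in>P. p \<otimes>\<^sub>C f p)"
  shows "(\<Sum>p\<in>P. haar A (star (u x j) * p) *\<^sub>C f p)
    = (\<Sum>k\<in>W. haar A (star (u x k) * a) *\<^sub>C star (antipode A (u k j)))"
proof -
  have fin: "finite W" using W(1) by (simp add: corep_basis_def)
  define T where "T m = (\<Sum>p\<in>P. haar A (star (u x m) * p) *\<^sub>C f p)" for m
  have T: "haar A (star (u x k) * a) *\<^sub>C 1 = (\<Sum>m\<in>W. star (u m k) * T m)" if "k \<in> W" for k
  proof -
    have "comult A (u x k) = (\<Sum>m\<in>W. u x m \<otimes>\<^sub>C u m k)" using W that by (simp add: corep_basis_def)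
    then have "comult A (star (u x k) * a) = (\<Sum>(m, p)\<in>W \<times> P. (star (u x m) * p) \<otimes>\<^sub>C (star (u m k) * f p))"
      by (simp add: comult_mult_sum[OF comult_star_sum a] sum.cartesian_product)
    then have "haar A (star (u x k) * a) *\<^sub>C 1 = (\<Sum>(m, p)\<in>W \<times> P. haar A (star (u x m) * p) *\<^sub>C (star (u m k) * f p))"
      using haar_right[of "star (u x k) * a" "\<lambda>(m, p). star (u x m) * p" "\<lambda>(m, p). star (u m k) * f p" "W \<times> P"]
      by (simp add: case_prod_beta)
    then show ?thesis
      by (simp add: T_def sum.cartesian_product[symmetric] sum_distrib_left mult_scaleC_right)
  qed
  have S: "(\<Sum>k\<in>W. star (antipode A (u k j)) * star (u m k)) = (if m = j then 1 else 0)" if "m \<in> W" for m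
    using arg_cong[OF corep_antipode(2)[OF W(1) that W(3)], of star]
    by (simp add: star_simps star_mult star_if)
  have "(\<Sum>k\<in>W. haar A (star (u x k) * a) *\<^sub>C star (antipode A (u k j)))
      = (\<Sum>k\<in>W. star (antipode A (u k j)) * (haar A (star (u x k) * a) *\<^sub>C 1))"
    by (simp add: mult_scaleC_right)
  also have "\<dots> = (\<Sum>k\<in>W. \<Sum>m\<in>W. star (antipode A (u k j)) * star (u m k) * T m)"
    by (rule sum.cong) (simp_all add: T sum_distrib_left mult.assoc)
  also have "\<dots> = (\<Sum>m\<in>W. (if m = j then 1 else 0) * T m)"
    by (subst sum.swap) (rule sum.cong, simp_all add: S[symmetric] sum_distrib_right)
  also have "\<dots> = T j" using W(3) fin by (simp add: sum_delta_mult)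
  finally show ?thesis by (simp add: T_def)
qed

text \<open>
  By strong invariance, if \<open>h(y a) = 0\<close> for all \<open>y\<close> in a subcomodule of \<open>A\<close>, the right legs of \<open>\<Delta>(a)\<close> inherit this.
  The map \<open>j\<close> embeds the comodule into \<open>A\<close>; it is the identity of \<open>A\<close> or the inclusion of \<open>B\<close> below.
\<close>

lemma haar_orthogonal_comult:
  assumes W: "corep_basis A \<delta> W u" and j: "clinear j"
    and comult: "\<And>x. x \<in> W \<Longrightarrow> comult A (j x) = (\<Sum>y\<in>W. u x y \<otimes>\<^sub>C j y)"
    and orth: "\<And>y. haar A (j y * a) = 0" and b: "b \<in> cspan W"
    and P: "finite P" "cvs.independent P" "comult A a = (\<Sum>p\<in>P. p \<otimes>\<^sub>C f p)" and "p \<in> P"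
  shows "haar A (j b * f p) = 0"
proof -
  have fW: "finite W" using W by (simp add: corep_basis_def)
  have 0: "(\<Sum>p\<in>P. haar A (j x * f p) *\<^sub>C p) = 0" if "x \<in> W" for x
  proof -
    have "(\<Sum>p\<in>P. haar A (j x * f p) *\<^sub>C p) = (\<Sum>y\<in>W. haar A (j y * a) *\<^sub>C antipode A (u x y))"
      by (rule haar_strong_left[where w = j, OF fW comult corep_antipode(1)[OF W] that P(3)])
    then show ?thesis by (simp add: orth)
  qed
  have "(\<Sum>p\<in>P. haar A (j b * f p) *\<^sub>C p) = 0"
    using b
  proof (induction rule: cvs.span_induct_alt)
    case (step c x y)
    have "(\<Sum>p\<in>P. haar A (j (c *\<^sub>C x + y) * f p) *\<^sub>C p)
        = c *\<^sub>C (\<Sum>p\<in>P. haar A (j x * f p) *\<^sub>C p) + (\<Sum>p\<in>P. haar A (j y * f p) *\<^sub>C p)"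
      by (simp add: clinearD[OF haar_linear] clinearD[OF j] distrib_right mult_scaleC_left scaleC_add_left sum.distrib
          scaleC_complex_def cvs.scale_sum_right)
    then show ?case using step 0 by simp
  qed (simp add: clinearD[OF haar_linear] clinearD[OF j])
  from cvs.independentD[OF P(2,1) subset_refl this \<open>p \<in> P\<close>] show ?thesis .
qed

lemma haar_null_comult:
  assumes a: "\<And>y. haar A (y * a) = 0"
    and P: "finite P" "cvs.independent P" "comult A a = (\<Sum>p\<in>P. p \<otimes>\<^sub>C f p)" "p \<in> P"
  shows "haar A (b * f p) = 0"
proof -
  obtain W u where W: "corep_basis A (comult A) W u" "{b} \<subseteq> cspan W"
    using comodule_corep_basis[OF comodule_comult, of "{b}"] by blast
  show ?thesis
    by (rule haar_orthogonal_comult[OF W(1) clinear_ident _ a _ P]) (use W in \<open>auto simp: corep_basis_def\<close>)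
qed

text \<open>
  The null vectors \<open>a\<close> of the Haar functional form a left ideal that contains the right legs of \<open>\<Delta>(a)\<close>.
  Therefore \<open>S(a\<^sub>1) a\<^sub>2 = \<epsilon>(a) 1\<close> is null, which forces \<open>\<epsilon>(a) = 0\<close>. Applied to the right legs, this
  gives \<open>a = a\<^sub>1 \<epsilon>(a\<^sub>2) = 0\<close>.
\<close>

theorem haar_faithful:
  assumes "haar A (star a * a) = 0" shows "a = 0"
proof -
  have counit0: "counit A a = 0" if a: "\<And>y. haar A (y * a) = 0" for a
  proof -
    obtain P f where P: "finite P" "cvs.independent P" "comult A a = (\<Sum>p\<in>P. p \<otimes>\<^sub>C f p)"
      using tensor_expansion_UNIV by blast
    have "(\<Sum>p\<in>P. antipode A p * f p) = counit A a *\<^sub>C 1"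
      using antipode_left[of a] balanced_antipode(1) by (simp add: P(3) tlift_sum tlift_tens)
    from arg_cong[OF this, of "haar A"] show ?thesis
      using haar_null_comult[OF a P(1-3)] by (simp add: clinearD[OF haar_linear] haar_one scaleC_complex_def)
  qed
  have a: "haar A (y * a) = 0" for y
    using haar.null_right[OF assms, of "star y"] by (simp add: star_star)
  obtain P f where P: "finite P" "cvs.independent P" "comult A a = (\<Sum>p\<in>P. p \<otimes>\<^sub>C f p)"
    using tensor_expansion_UNIV by blast
  have "counit A (f p) = 0" if "p \<in> P" for p
    by (rule counit0) (rule haar_null_comult[OF a P(1-3) that])
  then have "(\<Sum>p\<in>P. counit A (f p) *\<^sub>C p) = 0" by (intro sum.neutral) simp
  then show "a = 0" by (simp only: counit_right_sum[OF P(3)])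
qed

end

context cqga
begin

lemma coinvariant_scalar:
  assumes "comult A a = 1 \<otimes>\<^sub>C a" shows "a = counit A a *\<^sub>C 1"
proof -
  have "comult A a = (\<Sum>i\<in>{()}. 1 \<otimes>\<^sub>C a)" by (simp add: assms)
  from counit_right_sum[OF this] show ?thesis by simp
qed

text \<open>
  For an orthonormal basis of a left coideal, unitarity of its matrix makes \<open>\<Sum> e e\<^sup>*\<close> coinvariant,
  hence equal to a scalar \<open>c\<close>. So \<open>\<Sum> h((e\<^sup>* x)\<^sup>* e\<^sup>* x) = c h(x\<^sup>* x)\<close>, which bounds multiplication by each \<open>e\<^sup>*\<close>;
  the coideal is chosen to contain \<open>a\<^sup>*\<close>.
\<close>

theorem left_mult_bounded: "\<exists>K\<ge>0. \<forall>x. haar.seminorm (a * x) \<le> K * haar.seminorm x"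
proof -
  obtain W u where W: "corep_basis A (comult A) W u" "{star a} \<subseteq> cspan W" "finite W"
    and orth: "\<And>x y. x \<in> W \<Longrightarrow> y \<in> W \<Longrightarrow> haar A (star x * y) = (if x = y then 1 else 0)"
    using orthonormal_corep_basis[OF comodule_comult _ haar_form haar_faithful, of "{star a}"] by blast
  define D where "D = (\<Sum>e\<in>W. e * star e)"
  have ce: "comult A e = (\<Sum>y\<in>W. u e y \<otimes>\<^sub>C y)" if "e \<in> W" for e
    using W(1) that by (simp add: corep_basis_def)
  have "comult A D = (\<Sum>e\<in>W. \<Sum>y\<in>W. \<Sum>z\<in>W. (u e y * star (u e z)) \<otimes>\<^sub>C (y * star z))"
    unfolding D_def clinearD(6)[OF comult_linear]
    by (rule sum.cong) (simp_all add: comult_mult_sum[OF ce comult_star_sum[OF ce]])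
  also have "\<dots> = (\<Sum>y\<in>W. \<Sum>z\<in>W. (\<Sum>e\<in>W. u e y * star (u e z)) \<otimes>\<^sub>C (y * star z))"
    by (subst sum.swap, rule sum.cong, simp, subst sum.swap)
       (simp add: clinearD(6)[OF clinear_tens_left])
  also have "\<dots> = (\<Sum>y\<in>W. \<Sum>z\<in>W. if y = z then 1 \<otimes>\<^sub>C (y * star z) else 0)"
    by (intro sum.cong) (simp_all add: orthonormal_corep_unitary(2)[OF haar_form haar_invariant W(1) orth]
        clinearD(3)[OF clinear_tens_left])
  also have "\<dots> = 1 \<otimes>\<^sub>C D"
    using W(3) by (simp add: D_def clinearD(6)[OF clinear_tens_right])
  finally have "D = counit A D *\<^sub>C 1" by (rule coinvariant_scalar)
  moreover have "counit A D = of_real (\<Sum>e\<in>W. (cmod (counit A e))\<^sup>2)"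
    by (simp add: D_def clinearD[OF counit_linear] counit_mult counit_star complex_norm_square del: of_real_power)
  ultimately obtain c where c: "D = of_real c *\<^sub>C 1" by metis
  have bound: "haar.seminorm (star e * x) \<le> sqrt c * haar.seminorm x" if "e \<in> W" for e x
  proof -
    have "(\<Sum>e\<in>W. haar A (star (star e * x) * (star e * x))) = haar A (star x * (D * x))"
      by (simp add: D_def sum_distrib_left sum_distrib_right clinearD[OF haar_linear] star_mult star_star mult.assoc)
    also have "\<dots> = of_real c * haar A (star x * x)"
      by (simp add: c mult_scaleC_left mult_scaleC_right clinearD[OF haar_linear] scaleC_complex_def)
    finally have "(\<Sum>e\<in>W. Re (haar A (star (star e * x) * (star e * x)))) = c * Re (haar A (star x * x))"
      by (simp flip: Re_sum)
    moreover have "Re (haar A (star (star e * x) * (star e * x)))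
        \<le> (\<Sum>e\<in>W. Re (haar A (star (star e * x) * (star e * x))))"
      using W(3) that by (intro member_le_sum) (auto intro: haar.nonneg)
    ultimately show ?thesis by (simp add: haar.seminorm_def flip: real_sqrt_mult)
  qed
  obtain r where r: "star a = (\<Sum>e\<in>W. r e *\<^sub>C e)" using W(2,3) span_finite_coords[of W "star a"] by auto
  have a: "a * x = (\<Sum>e\<in>W. cnj (r e) *\<^sub>C (star e * x))" for x
    using arg_cong[OF r, of star] by (simp add: star_star star_simps sum_distrib_right mult_scaleC_left)
  define K where "K = (\<Sum>e\<in>W. cmod (r e) * \<bar>sqrt c\<bar>)"
  have "haar.seminorm (a * x) \<le> K * haar.seminorm x" for x
  proof -
    have "haar.seminorm (a * x) \<le> (\<Sum>e\<in>W. cmod (r e) * haar.seminorm (star e * x))"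
      unfolding a using haar.seminorm_sum[of "\<lambda>e. cnj (r e) *\<^sub>C (star e * x)" W] by (simp add: haar.seminorm_scale)
    also have "\<dots> \<le> (\<Sum>e\<in>W. cmod (r e) * (\<bar>sqrt c\<bar> * haar.seminorm x))"
      by (intro sum_mono mult_left_mono order_trans[OF bound] mult_right_mono) (auto simp: haar.seminorm_nonneg)
    finally show ?thesis by (simp add: K_def sum_distrib_right mult.assoc)
  qed
  moreover have "K \<ge> 0" by (simp add: K_def sum_nonneg)
  ultimately show ?thesis by blast
qed

end

lemma (in cqga) haar_definite: "\<forall>x. haar A (star x * x) = 0 \<longrightarrow> x = 0"
  using haar_faithful by blast

section \<open>The coideal subalgebra as an algebra of coinvariants\<close>

lemma tmap_inj_right:
  assumes "clinear g" "inj g" "tmap id g s = tmap id g t"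
  shows "s = t"
proof -
  obtain k where k: "clinear k" "k \<circ> g = id"
    using cvp.linear_injective_left_inverse[OF assms(1,2)] by blast
  then have kg: "(\<lambda>x. k (g x)) = id" by (auto simp: fun_eq_iff)
  have "tmap id k (tmap id g t) = t" for t :: "('c, 'a) tensor"
    using tmap_tmap[OF clinear_id k(1) clinear_id assms(1), of t] kg tmap_id[of t] by (simp add: id_def)
  then show ?thesis using assms(3) by metis
qed

lemma tassoc_natural:
  assumes "clinear f" "clinear g" "clinear k"
  shows "tmap f (tmap g k) (tassoc t) = tassoc (tmap (tmap f g) k t)"
proof (induction t rule: tensor_induct)
  case (tens t w)
  show ?case
  proof (induction t rule: tensor_induct)
    case (tens u v)
    show ?case by (simp add: tassoc_tens3 tmap_tens assms clinear_tmap)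
  next
    case (add s t)
    then show ?case
      by (simp add: tens_add_left tassoc_tens3 tmap_tens assms clinear_tmap clinearD(1)[OF clinear_tassoc]
          clinearD(1)[OF clinear_tmap[OF clinear_tmap[OF assms(1,2)] assms(3)]]
          clinearD(1)[OF clinear_tmap[OF assms(1) clinear_tmap[OF assms(2,3)]]])
  qed
next
  case (add s t)
  then show ?case
    by (simp add: clinearD(1)[OF clinear_tassoc]
        clinearD(1)[OF clinear_tmap[OF clinear_tmap[OF assms(1,2)] assms(3)]]
        clinearD(1)[OF clinear_tmap[OF assms(1) clinear_tmap[OF assms(2,3)]]])
qed

context cqga_homogeneous_space
begin

lemma coideal_sum: "\<Delta>\<^sub>B b = (\<Sum>i\<in>I. x i \<otimes>\<^sub>C y i) \<Longrightarrow> comult A (\<iota> b) = (\<Sum>i\<in>I. x i \<otimes>\<^sub>C \<iota> (y i))"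
  unfolding coideal[symmetric]
  by (simp add: clinearD[OF clinear_tmap[OF clinear_id incl_linear]] tmap_idl[OF incl_linear])

lemma incl_counit_right: "\<Delta>\<^sub>B b = (\<Sum>i\<in>I. x i \<otimes>\<^sub>C y i) \<Longrightarrow> \<iota> b = (\<Sum>i\<in>I. counit A (\<iota> (y i)) *\<^sub>C x i)"
  by (rule counit_right_sum[OF coideal_sum, symmetric])

lemma clinear_coideal: "clinear \<Delta>\<^sub>B"
proof -
  note l = clinearD[OF clinear_tmap[OF clinear_id incl_linear]]
  show ?thesis
    by (rule clinearI; rule tmap_inj_right[OF incl_linear incl_inj])
       (simp_all add: l coideal clinearD[OF comult_linear] clinearD[OF incl_linear])
qed

text \<open>
  The identities for \<open>\<Delta>\<^sub>B\<close> are those for \<open>\<Delta>\<close>, seen through the injection \<open>id \<otimes> \<iota>\<close>.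
\<close>

lemma comodule_coideal: "left_comodule A \<Delta>\<^sub>B"
  unfolding left_comodule_def
proof (intro conjI allI clinear_coideal)
  fix b
  note li = clinear_tmap[OF clinear_id incl_linear]
  have "inj (tmap id \<iota>)" using tmap_inj_right[OF incl_linear incl_inj] by (intro injI) blast
  moreover have "tmap id (tmap id \<iota>) (tassoc (tmap (comult A) id (\<Delta>\<^sub>B b))) = tmap id (tmap id \<iota>) (tmap id \<Delta>\<^sub>B (\<Delta>\<^sub>B b))"
  proof -
    have "tmap id (tmap id \<iota>) (tassoc (tmap (comult A) id (\<Delta>\<^sub>B b)))
        = tassoc (tmap (tmap id id) \<iota> (tmap (comult A) id (\<Delta>\<^sub>B b)))"
      by (rule tassoc_natural) (simp_all add: clinear_id incl_linear)
    also have "tmap id id = (id :: ('a, 'a) tensor \<Rightarrow> _)" by (rule ext) (simp add: tmap_id id_apply)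
    also have "tmap id \<iota> (tmap (comult A) id (\<Delta>\<^sub>B b)) = tmap (comult A) id (tmap id \<iota> (\<Delta>\<^sub>B b))"
      by (simp add: tmap_tmap clinear_id incl_linear comult_linear) (simp add: id_apply)
    also have "tassoc \<dots> = tmap id (comult A) (tmap id \<iota> (\<Delta>\<^sub>B b))"
      by (simp add: coideal coassoc)
    also have "\<dots> = tmap (\<lambda>x. id (id x)) (\<lambda>x. comult A (\<iota> x)) (\<Delta>\<^sub>B b)"
      by (rule tmap_tmap) (simp_all add: clinear_id incl_linear comult_linear)
    also have "\<dots> = tmap id (tmap id \<iota>) (tmap id \<Delta>\<^sub>B (\<Delta>\<^sub>B b))"
      by (subst tmap_tmap) (simp_all add: clinear_id clinear_coideal li coideal)
    finally show ?thesis .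
  qed
  ultimately show "tassoc (tmap (comult A) id (\<Delta>\<^sub>B b)) = tmap id \<Delta>\<^sub>B (\<Delta>\<^sub>B b)"
    using tmap_inj_right[OF li] by blast
  obtain X f where X: "\<Delta>\<^sub>B b = (\<Sum>x\<in>X. x \<otimes>\<^sub>C f x)" using tensor_expansion_UNIV by blast
  have "\<iota> (\<Sum>x\<in>X. counit A x *\<^sub>C f x) = \<iota> b"
    using counit_left_sum[OF coideal_sum[OF X]] by (simp add: clinearD[OF incl_linear])
  then show "tlift (\<lambda>a b'. counit A a *\<^sub>C b') (\<Delta>\<^sub>B b) = b"
    using incl_inj by (simp add: X tlift_slice[OF counit_linear] inj_def)
qed

lemma proj_incl: "\<pi> (\<iota> b) = counit A (\<iota> b) *\<^sub>C 1"
proof -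
  let ?c = "counit A (\<iota> b)"
  have "\<iota> (b - ?c *\<^sub>C 1) * 1 \<in> cspan {\<iota> b * a | a b. counit A (\<iota> b) = 0}"
    by (intro cvs.span_base) (auto simp: clinearD[OF incl_linear] clinearD[OF counit_linear] incl_one counit_one
        scaleC_complex_def intro!: exI[of _ "1::'a"] exI[of _ "b - ?c *\<^sub>C 1"])
  then have "\<pi> (\<iota> (b - ?c *\<^sub>C 1)) = 0" using proj_kernel by auto
  then show ?thesis by (simp add: clinearD[OF incl_linear] clinearD[OF proj_linear] incl_one proj_one)
qed

text \<open>
  For a finite-dimensional subcoalgebra \<open>C\<close> of \<open>A\<close>, spanned by matrix coefficients, the orthogonal
  projection onto \<open>C\<close> is given by \<open>a \<mapsto> \<phi>(a\<^sub>1) a\<^sub>2\<close> for the functional \<open>\<phi>\<close> that composes it with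
  the counit. Since \<open>\<Delta>(B) \<subseteq> A \<otimes> B\<close>, it maps \<open>B\<close> into \<open>B\<close>.
\<close>

lemma projection_subcoalgebra:
  assumes W: "corep_basis A \<delta> W u"
  defines "C \<equiv> cspan {u x y | x y. x \<in> W \<and> y \<in> W}"
  shows "\<exists>p. p \<in> C \<and> p \<in> range \<iota> \<and> (\<forall>f\<in>C. haar A (star f * (\<iota> b - p)) = 0)"
proof -
  define U where "U = {u x y | x y. x \<in> W \<and> y \<in> W}"
  have fW: "finite W" using W by (simp add: corep_basis_def)
  then have fU: "finite U" unfolding U_def by (intro finite_image_set2) simp_all
  have C: "C = cspan U" by (simp add: C_def U_def)
  from haar.ex_orthonormal_basis[OF fU haar_definite, folded C]
  obtain R where R: "finite R" "cspan R = C" and "cvs.independent R"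
    and orth: "\<forall>x\<in>R. \<forall>y\<in>R. haar A (star x * y) = (if x = y then 1 else 0)"
    and expand: "\<forall>x\<in>C. x = (\<Sum>e\<in>R. haar A (star e * x) *\<^sub>C e)"
    by (elim exE conjE) (rule that)
  note expand = expand[rule_format]
  define p where "p = (\<Sum>e\<in>R. haar A (star e * \<iota> b) *\<^sub>C e)"
  have RC: "e \<in> C" if "e \<in> R" for e using that R(2) cvs.span_base by blast
  have pC: "p \<in> C" unfolding p_def C
    by (intro cvs.span_sum cvs.span_scale) (use RC C in blast)
  have y_orth: "haar A (star f * (\<iota> b - p)) = 0" if "f \<in> C" for f
    unfolding p_def by (rule haar.orthonormal_projection[OF R(1) orth]) (simp add: R(2) that)
  define \<phi> where "\<phi> x = (\<Sum>e\<in>R. counit A e * haar A (star e * x))" for x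
  have \<phi>_lin: "clinear \<phi>"
    by (rule clinearI)
       (simp_all add: \<phi>_def clinearD[OF haar_linear] mult_scaleC_right scaleC_complex_def distrib_left sum.distrib
         sum_distrib_left mult.left_commute)
  have \<phi>_C: "\<phi> z = counit A z" if "z \<in> C" for z
    using arg_cong[OF expand[OF that], of "counit A"]
    by (simp add: \<phi>_def clinearD[OF counit_linear] scaleC_complex_def mult.commute)
  \<comment> \<open>\<open>F\<close> is the projection: it fixes \<open>C\<close>, and it annihilates the complement by strong invariance.\<close>
  define F where "F z = tlift (\<lambda>x y. \<phi> x *\<^sub>C y) (comult A z)" for z
  have F_lin: "clinear F" unfolding F_def
    by (rule clinear_comp[OF clinear_tlift[OF balanced_slice[OF \<phi>_lin]] comult_linear])
  have F_C: "F z = z" if "z \<in> C" for z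
  proof -
    have "F (u x y) = u x y" if "x \<in> W" "y \<in> W" for x y
    proof -
      have c: "comult A (u x y) = (\<Sum>z\<in>W. u x z \<otimes>\<^sub>C u z y)" using W that by (simp add: corep_basis_def)
      have "F (u x y) = (\<Sum>z\<in>W. \<phi> (u x z) *\<^sub>C u z y)"
        by (simp add: F_def c tlift_slice[OF \<phi>_lin])
      also have "\<dots> = (\<Sum>z\<in>W. counit A (u x z) *\<^sub>C u z y)"
        using that by (intro sum.cong refl arg_cong2[where f = scaleC] \<phi>_C) (auto simp: C_def intro: cvs.span_base)
      also have "\<dots> = u x y" by (rule counit_left_sum[OF c])
      finally show ?thesis .
    qed
    then have "F z = z" if "z \<in> U" for z using that by (auto simp: U_def)
    then show ?thesis using cvp.linear_eq_on[OF F_lin clinear_ident] that C by blast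
  qed
  have "F (\<iota> b - p) = 0"
  proof -
    obtain P f where P: "comult A (\<iota> b - p) = (\<Sum>q\<in>P. q \<otimes>\<^sub>C f q)" using tensor_expansion_UNIV by blast
    define T where "T e = (\<Sum>q\<in>P. haar A (star e * q) *\<^sub>C f q)" for e
    have T_u: "T (u x j) = 0" if "x \<in> W" "j \<in> W" for x j
    proof -
      have "T (u x j) = (\<Sum>k\<in>W. haar A (star (u x k) * (\<iota> b - p)) *\<^sub>C star (antipode A (u k j)))"
        unfolding T_def by (rule haar_strong_right[OF W that P])
      also have "\<dots> = 0"
        using that by (intro sum.neutral ballI) (subst y_orth, auto simp: C_def intro: cvs.span_base)
      finally show ?thesis .
    qed
    have T_C: "T e = 0" if "e \<in> C" for e
      using that unfolding C
    proof (induction rule: cvs.span_induct_alt)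
      case base
      show ?case by (simp add: T_def haar.left_simps)
    next
      case (step c x y)
      have "T (c *\<^sub>C x + y) = cnj c *\<^sub>C T x + T y"
        unfolding T_def haar.add_left haar.scale_left
        by (simp add: scaleC_add_left sum.distrib cvs.scale_sum_right)
      then show ?case using step T_u by (auto simp: U_def)
    qed
    have "F (\<iota> b - p) = (\<Sum>q\<in>P. \<phi> q *\<^sub>C f q)" by (simp add: F_def P tlift_slice[OF \<phi>_lin])
    also have "\<dots> = (\<Sum>e\<in>R. counit A e *\<^sub>C T e)"
      unfolding \<phi>_def T_def cvs.scale_sum_left cvs.scale_sum_right
      by (subst sum.swap) simp
    also have "\<dots> = 0" using T_C RC by simp
    finally show ?thesis .
  qed
  then have "F (\<iota> b) = p" using F_C[OF pC] by (simp add: clinearD[OF F_lin])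
  moreover have "F (\<iota> b) \<in> range \<iota>"
  proof -
    obtain P f where P: "\<Delta>\<^sub>B b = (\<Sum>q\<in>P. q \<otimes>\<^sub>C f q)" using tensor_expansion_UNIV by blast
    have "F (\<iota> b) = \<iota> (\<Sum>q\<in>P. \<phi> q *\<^sub>C f q)"
      by (simp add: F_def coideal_sum[OF P] tlift_slice[OF \<phi>_lin] clinearD[OF incl_linear])
    then show ?thesis by blast
  qed
  ultimately show ?thesis using pC y_orth by (intro exI[of _ p]) simp
qed

lemma subspace_range_incl: "csubspace (range \<iota>)"
  by (rule cvp.linear_subspace_image[OF incl_linear]) (rule cvs.subspace_UNIV)

text \<open>
  \<open>B\<close> may be infinite-dimensional, so \<open>a\<close> is projected onto the intersection of \<open>B\<close> with a
  finite-dimensional subcoalgebra that contains \<open>a\<close>. This is the projection onto all of \<open>B\<close>, since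
  the components of elements of \<open>B\<close> along the subcoalgebra are again in \<open>B\<close>
  (\<open>projection_subcoalgebra\<close>).
\<close>

lemma orthogonal_decomposition:
  obtains e where "\<And>b. haar A (star (\<iota> b) * (a - \<iota> e)) = 0"
proof -
  obtain W u where W: "corep_basis A (comult A) W u" "{a} \<subseteq> cspan W" "finite W"
    using comodule_corep_basis[OF comodule_comult, of "{a}"] by blast
  define U where "U = {u x y | x y. x \<in> W \<and> y \<in> W}"
  have fU: "finite U" unfolding U_def using W(3) by (intro finite_image_set2) simp_all
  have "x \<in> cspan U" if "x \<in> W" for x
  proof -
    have "comult A x = (\<Sum>y\<in>W. u x y \<otimes>\<^sub>C y)" using W(1) that by (simp add: corep_basis_def)
    from counit_right_sum[OF this] have "x = (\<Sum>y\<in>W. counit A y *\<^sub>C u x y)" by simp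
    moreover have "\<dots> \<in> cspan U"
      using that by (intro cvs.span_sum cvs.span_scale cvs.span_base) (auto simp: U_def)
    ultimately show ?thesis by simp
  qed
  then have "cspan W \<subseteq> cspan U" by (intro cvs.span_minimal cvs.subspace_span) blast
  then have a: "a \<in> cspan U" using W(2) by blast
  define V where "V = cspan U \<inter> range \<iota>"
  have V: "csubspace V" unfolding V_def
    by (intro cvs.subspace_inter cvs.subspace_span subspace_range_incl)
  obtain X where X: "X \<subseteq> V" "cvs.independent X" "V \<subseteq> cspan X"
    using cvs.basis_exists[of V] by metis
  have fX: "finite X"
    using cvs.independent_span_bound[OF fU X(2)] X(1) by (auto simp: V_def)
  have spanX: "cspan X = V"
    using X(1,3) V by (simp add: cvs.span_minimal subset_antisym)
  from haar.ex_orthonormal_basis[OF fX haar_definite]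
  obtain R where R: "finite R" "cspan R = V" and "cvs.independent R"
    and orth: "\<forall>x\<in>R. \<forall>y\<in>R. haar A (star x * y) = (if x = y then 1 else 0)"
    and "\<forall>x\<in>V. x = (\<Sum>e\<in>R. haar A (star e * x) *\<^sub>C e)"
    unfolding spanX by (elim exE conjE) (rule that)
  define e where "e = (\<Sum>g\<in>R. haar A (star g * a) *\<^sub>C g)"
  have eV: "e \<in> V" unfolding e_def R(2)[symmetric]
    by (intro cvs.span_sum cvs.span_scale cvs.span_base)
  have orthV: "haar A (star p * (a - e)) = 0" if "p \<in> V" for p
    unfolding e_def by (rule haar.orthonormal_projection[OF R(1) orth]) (simp add: R(2) that)
  have "haar A (star (\<iota> b) * (a - e)) = 0" for b
  proof -
    from projection_subcoalgebra[OF W(1), of b, folded U_def]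
    obtain p where p: "p \<in> cspan U" "p \<in> range \<iota>" "\<forall>f\<in>cspan U. haar A (star f * (\<iota> b - p)) = 0"
      by (elim exE conjE) (rule that)
    have "a - e \<in> cspan U" using a eV by (intro cvs.span_diff) (auto simp: V_def)
    then have "haar A (star (\<iota> b - p) * (a - e)) = 0"
      using p(3)[rule_format, of "a - e"] arg_cong[of _ _ cnj, OF p(3)[rule_format, of "a - e"]] haar.cnj_form[of "a - e" "\<iota> b - p"] by simp
    then show ?thesis using orthV[of p] p(1,2) by (simp add: V_def haar.left_simps)
  qed
  then show thesis using eV that by (auto simp: V_def)
qed

definition coinvariant :: "'a \<Rightarrow> bool"
  where "coinvariant a \<longleftrightarrow> tmap id \<pi> (comult A a) = a \<otimes>\<^sub>C 1"

lemma coinvariant_comult: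
  assumes "coinvariant a" "finite P" "cvs.independent P" "comult A a = (\<Sum>p\<in>P. p \<otimes>\<^sub>C f p)" "p \<in> P"
  shows "coinvariant (f p)"
proof -
  have "tmap id (tmap id \<pi>) (tassoc (tmap (comult A) id (comult A a)))
      = tassoc (tmap (tmap id id) \<pi> (tmap (comult A) id (comult A a)))"
    by (rule tassoc_natural) (simp_all add: clinear_id proj_linear)
  also have "tmap id id = (id :: ('a, 'a) tensor \<Rightarrow> _)" by (rule ext) (simp add: tmap_id id_apply)
  also have "tmap id \<pi> (tmap (comult A) id (comult A a)) = tmap (comult A) id (tmap id \<pi> (comult A a))"
    by (simp add: tmap_tmap clinear_id proj_linear comult_linear) (simp add: id_apply)
  also have "\<dots> = comult A a \<otimes>\<^sub>C 1"
    using assms(1) by (simp add: coinvariant_def tmap_idr[OF comult_linear])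
  also have "tassoc \<dots> = (\<Sum>p\<in>P. p \<otimes>\<^sub>C (f p \<otimes>\<^sub>C 1))"
    by (simp add: assms(4) clinearD[OF clinear_tens_left] clinearD[OF clinear_tassoc] tassoc_tens3)
  finally have "tmap id (tmap id \<pi>) (tassoc (tmap (comult A) id (comult A a))) = (\<Sum>p\<in>P. p \<otimes>\<^sub>C (f p \<otimes>\<^sub>C 1))" .
  moreover have "tmap id (tmap id \<pi>) (tmap id (comult A) (comult A a)) = (\<Sum>p\<in>P. p \<otimes>\<^sub>C tmap id \<pi> (comult A (f p)))"
    unfolding assms(4)
    by (simp add: clinearD[OF clinear_tmap[OF clinear_id comult_linear]] tmap_idl[OF comult_linear]
        clinearD[OF clinear_tmap[OF clinear_id clinear_tmap[OF clinear_id proj_linear]]]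
        tmap_idl[OF clinear_tmap[OF clinear_id proj_linear]])
  ultimately have "(\<Sum>p\<in>P. p \<otimes>\<^sub>C tmap id \<pi> (comult A (f p))) = (\<Sum>p\<in>P. p \<otimes>\<^sub>C (f p \<otimes>\<^sub>C 1))"
    by (simp add: coassoc)
  from tens_left_unique[OF assms(2,3) this assms(5)] show ?thesis by (simp add: coinvariant_def)
qed

lemma orthogonal_comult:
  assumes orth: "\<And>b. haar A (star (\<iota> b) * a) = 0" and P: "finite P" "cvs.independent P"
    "comult A a = (\<Sum>p\<in>P. p \<otimes>\<^sub>C f p)" "p \<in> P"
  shows "haar A (star (\<iota> b) * f p) = 0"
proof -
  obtain W u where W: "corep_basis A \<Delta>\<^sub>B W u" "{star b} \<subseteq> cspan W"
    using comodule_corep_basis[OF comodule_coideal, of "{star b}"] by blast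
  have a: "haar A (\<iota> y * a) = 0" for y
    using orth[of "star y"] by (simp add: incl_star star_star)
  have c: "comult A (\<iota> x) = (\<Sum>y\<in>W. u x y \<otimes>\<^sub>C \<iota> y)" if "x \<in> W" for x
    using W(1) that by (intro coideal_sum) (simp add: corep_basis_def)
  have "star b \<in> cspan W" using W(2) by simp
  from haar_orthogonal_comult[OF W(1) incl_linear c a this P] show ?thesis by (simp add: incl_star)
qed

lemma coinvariant_incl: "coinvariant (\<iota> b)"
proof -
  obtain P f where P: "\<Delta>\<^sub>B b = (\<Sum>q\<in>P. q \<otimes>\<^sub>C f q)" using tensor_expansion_UNIV by blast
  have "tmap id \<pi> (comult A (\<iota> b)) = (\<Sum>q\<in>P. counit A (\<iota> (f q)) *\<^sub>C q) \<otimes>\<^sub>C 1"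
    by (simp add: coideal_sum[OF P] clinearD[OF clinear_tmap[OF clinear_id proj_linear]] tmap_idl[OF proj_linear]
        proj_incl clinearD(6)[OF clinear_tens_left] tens_scaleC_left tens_scaleC_right)
  then show ?thesis by (simp add: coinvariant_def incl_counit_right[OF P, symmetric])
qed

lemma coinvariant_proj:
  assumes "coinvariant a" shows "\<pi> a = counit A a *\<^sub>C 1"
proof -
  obtain P f where P: "comult A a = (\<Sum>p\<in>P. p \<otimes>\<^sub>C f p)" using tensor_expansion_UNIV by blast
  have "(\<Sum>p\<in>P. p \<otimes>\<^sub>C \<pi> (f p)) = (\<Sum>i\<in>{()}. a \<otimes>\<^sub>C 1)"
    using assms by (simp add: coinvariant_def P clinearD[OF clinear_tmap[OF clinear_id proj_linear]] tmap_idl[OF proj_linear])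
  from arg_cong[OF this, of "tlift (\<lambda>a q. counit A a *\<^sub>C q)"]
  have "(\<Sum>p\<in>P. counit A p *\<^sub>C \<pi> (f p)) = counit A a *\<^sub>C 1"
    unfolding tlift_slice[OF counit_linear] by simp
  moreover have "(\<Sum>p\<in>P. counit A p *\<^sub>C \<pi> (f p)) = \<pi> (\<Sum>p\<in>P. counit A p *\<^sub>C f p)"
    by (simp add: clinearD[OF proj_linear])
  ultimately show ?thesis by (simp add: counit_left_sum[OF P])
qed

text \<open>
  Write \<open>B\<^sup>+\<close> for the kernel of \<open>\<epsilon>\<close> in \<open>B\<close> and \<open>B\<^sup>\<bottom>\<close> for the orthogonal complement of \<open>B\<close>. From
  \<open>A = B + B\<^sup>\<bottom>\<close> one gets \<open>B\<^sup>+ A \<subseteq> B\<^sup>+ + B\<^sup>\<bottom>\<close>. The element \<open>a - \<epsilon>(a) 1\<close> is in the kernel \<open>B\<^sup>+ A\<close> of \<open>\<pi>\<close>, and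
  \<open>a\<close> is in \<open>B\<^sup>\<bottom>\<close>, so \<open>\<epsilon>(a) 1\<close> is in \<open>B\<^sup>+\<close> because \<open>B\<close> meets \<open>B\<^sup>\<bottom>\<close> in zero.
\<close>

lemma coinvariant_orthogonal_counit:
  assumes "coinvariant a" and orth: "\<And>b. haar A (star (\<iota> b) * a) = 0"
  shows "counit A a = 0"
proof -
  have "\<pi> (a - counit A a *\<^sub>C 1) = 0"
    by (simp add: clinearD[OF proj_linear] coinvariant_proj[OF assms(1)] proj_one)
  then have "a - counit A a *\<^sub>C 1 \<in> cspan {\<iota> b * a | a b. counit A (\<iota> b) = 0}"
    using proj_kernel by auto
  then have "\<exists>b y. a - counit A a *\<^sub>C 1 = \<iota> b + y \<and> counit A (\<iota> b) = 0 \<and> (\<forall>b'. haar A (star (\<iota> b') * y) = 0)"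
  proof (induction rule: cvs.span_induct_alt)
    case base
    show ?case by (rule exI[of _ 0], rule exI[of _ 0])
        (simp add: clinearD[OF incl_linear] clinearD[OF counit_linear] clinearD[OF haar_linear])
  next
    case (step c z z')
    then obtain b y where z': "z' = \<iota> b + y" "counit A (\<iota> b) = 0" "\<forall>b'. haar A (star (\<iota> b') * y) = 0" by blast
    obtain b0 a0 where z: "z = \<iota> b0 * a0" "counit A (\<iota> b0) = 0" using step.hyps(1) by blast
    obtain e where e: "\<And>b. haar A (star (\<iota> b) * (a0 - \<iota> e)) = 0" using orthogonal_decomposition[of a0] by blast
    have "c *\<^sub>C z + z' = \<iota> (c *\<^sub>C (b0 * e) + b) + (c *\<^sub>C (\<iota> b0 * (a0 - \<iota> e)) + y)"
      by (simp add: z(1) z'(1) clinearD[OF incl_linear] incl_mult right_diff_distrib cvs.scale_right_diff_distrib)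
    moreover have "counit A (\<iota> (c *\<^sub>C (b0 * e) + b)) = 0"
      by (simp add: clinearD[OF incl_linear] clinearD[OF counit_linear] incl_mult counit_mult z(2) z'(2)
          scaleC_complex_def)
    moreover have "haar A (star (\<iota> b') * (c *\<^sub>C (\<iota> b0 * (a0 - \<iota> e)) + y)) = 0" for b'
    proof -
      have "haar A (star (\<iota> b') * (\<iota> b0 * (a0 - \<iota> e))) = haar A (star (\<iota> (star b0 * b')) * (a0 - \<iota> e))"
        by (simp add: incl_mult star_mult incl_star star_star mult.assoc)
      then show ?thesis using z'(3) by (simp add: haar.add_right haar.scale_right e)
    qed
    ultimately show ?case by blast
  qed
  then obtain b y where y: "a - counit A a *\<^sub>C 1 = \<iota> b + y" "counit A (\<iota> b) = 0"
    "\<And>b'. haar A (star (\<iota> b') * y) = 0" by blast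
  define b1 where "b1 = counit A a *\<^sub>C 1 + b"
  have b1: "\<iota> b1 = a - y"
    using y(1) by (simp add: b1_def clinearD[OF incl_linear] incl_one algebra_simps)
  have "haar A (star (\<iota> b1) * \<iota> b1) = 0"
    using orth[of b1] y(3)[of b1] by (simp add: b1 haar.right_simps)
  then have "\<iota> b1 = 0" by (rule haar_faithful)
  then have "counit A (\<iota> b1) = 0" by (simp add: clinearD[OF counit_linear])
  then show ?thesis
    using y(2) by (simp add: b1_def clinearD[OF incl_linear] clinearD[OF counit_linear] incl_one counit_one scaleC_complex_def)
qed

text \<open>
  The right legs of \<open>\<Delta>(y)\<close>, for the component \<open>y\<close> of \<open>a\<close> orthogonal to \<open>B\<close>, are coinvariant and
  orthogonal to \<open>B\<close> as well. The counit vanishes on them, hence \<open>y = y\<^sub>1 \<epsilon>(y\<^sub>2) = 0\<close>.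
\<close>

theorem coinvariant_in_range:
  assumes "coinvariant a" shows "a \<in> range \<iota>"
proof -
  obtain e where e: "\<And>b. haar A (star (\<iota> b) * (a - \<iota> e)) = 0" using orthogonal_decomposition[of a] by blast
  have y: "coinvariant (a - \<iota> e)"
    using assms coinvariant_incl[of e]
    by (simp add: coinvariant_def clinearD[OF comult_linear] clinearD[OF clinear_tmap[OF clinear_id proj_linear]]
        clinearD(4)[OF clinear_tens_left])
  obtain P f where P: "finite P" "cvs.independent P" "comult A (a - \<iota> e) = (\<Sum>p\<in>P. p \<otimes>\<^sub>C f p)"
    using tensor_expansion_UNIV by blast
  have "counit A (f p) = 0" if "p \<in> P" for p
    by (rule coinvariant_orthogonal_counit[OF coinvariant_comult[OF y P that] orthogonal_comult[OF e P that]])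
  then have "(\<Sum>p\<in>P. counit A (f p) *\<^sub>C p) = 0" by (intro sum.neutral) simp
  then have "a - \<iota> e = 0" by (simp only: counit_right_sum[OF P(3)])
  then show ?thesis by (simp add: image_iff) blast
qed

end

section \<open>Relative Hopf modules\<close>

lemma (in bimodule) cbilinear_lact: "cbilinear lact"
  using lact_linear_left lact_linear_right by (simp add: cbilinear_def)

context cqga_homogeneous_space
begin

lemma proj_mult_incl: "\<pi> (x * \<iota> b * y) = counit A (\<iota> b) *\<^sub>C \<pi> (x * y)"
  by (simp add: proj_mult proj_incl mult_scaleC_left mult_scaleC_right)

text \<open>
  In the right leg of the comultiplication, \<open>\<pi>\<close> replaces the factor from \<open>B\<close> by its counit; the
  remaining factors are then contracted by unitarity of \<open>u\<close>.
\<close>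

lemma conjugate_coinvariant:
  assumes "psd_form s" "invariant_form A \<delta> s" "corep_basis A \<delta> W u"
    and orth: "\<And>x y. x \<in> W \<Longrightarrow> y \<in> W \<Longrightarrow> s x y = (if x = y then 1 else 0)"
    and x: "x \<in> W" and y: "y \<in> W"
  shows "coinvariant (\<Sum>k\<in>W. star (u y k) * \<iota> b * u x k)"
proof -
  have fW: "finite W" using assms(3) by (simp add: corep_basis_def)
  have c: "comult A (u x y) = (\<Sum>z\<in>W. u x z \<otimes>\<^sub>C u z y)" if "x \<in> W" "y \<in> W" for x y
    using assms(3) that by (simp add: corep_basis_def)
  obtain P f where P: "\<Delta>\<^sub>B b = (\<Sum>q\<in>P. q \<otimes>\<^sub>C f q)" using tensor_expansion_UNIV by blast
  note lp = clinear_tmap[OF clinear_id proj_linear]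
  have 1: "tmap id \<pi> (comult A (star (u y k) * \<iota> b * u x k))
      = (\<Sum>m\<in>W. \<Sum>q\<in>P. \<Sum>l\<in>W. (star (u y m) * (counit A (\<iota> (f q)) *\<^sub>C q) * u x l) \<otimes>\<^sub>C \<pi> (star (u m k) * u l k))"
    if "k \<in> W" for k
  proof -
    have "comult A (star (u y k) * \<iota> b)
        = (\<Sum>(m, q)\<in>W \<times> P. (star (u y m) * q) \<otimes>\<^sub>C (star (u m k) * \<iota> (f q)))"
      by (simp add: comult_mult_sum[OF comult_star_sum[OF c[OF y that]] coideal_sum[OF P]] sum.cartesian_product)
    then have "comult A (star (u y k) * \<iota> b) =
        (\<Sum>i\<in>W \<times> P. (star (u y (fst i)) * snd i) \<otimes>\<^sub>C (star (u (fst i) k) * \<iota> (f (snd i))))"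
      by (simp add: case_prod_beta)
    from comult_mult_sum[OF this c[OF x that]]
    have "comult A (star (u y k) * \<iota> b * u x k)
        = (\<Sum>m\<in>W. \<Sum>q\<in>P. \<Sum>l\<in>W. (star (u y m) * q * u x l) \<otimes>\<^sub>C (star (u m k) * \<iota> (f q) * u l k))"
      by (simp add: sum.cartesian_product')
    then show ?thesis
      by (simp add: clinearD[OF lp] tmap_idl[OF proj_linear] proj_mult_incl tens_scaleC_right tens_scaleC_left
          mult_scaleC_left mult_scaleC_right)
  qed
  have "tmap id \<pi> (comult A (\<Sum>k\<in>W. star (u y k) * \<iota> b * u x k))
      = (\<Sum>k\<in>W. tmap id \<pi> (comult A (star (u y k) * \<iota> b * u x k)))"
    by (simp add: clinearD[OF comult_linear] clinearD[OF lp])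
  also have "\<dots> = (\<Sum>k\<in>W. \<Sum>m\<in>W. \<Sum>q\<in>P. \<Sum>l\<in>W.
      (star (u y m) * (counit A (\<iota> (f q)) *\<^sub>C q) * u x l) \<otimes>\<^sub>C \<pi> (star (u m k) * u l k))"
    by (rule sum.cong) (simp_all add: 1)
  also have "\<dots> = (\<Sum>m\<in>W. \<Sum>q\<in>P. \<Sum>l\<in>W. \<Sum>k\<in>W.
      (star (u y m) * (counit A (\<iota> (f q)) *\<^sub>C q) * u x l) \<otimes>\<^sub>C \<pi> (star (u m k) * u l k))"
    by (subst sum.swap, rule sum.cong[OF refl], subst sum.swap, rule sum.cong[OF refl], rule sum.swap)
  also have "\<dots> = (\<Sum>m\<in>W. \<Sum>q\<in>P. \<Sum>l\<in>W.
      (star (u y m) * (counit A (\<iota> (f q)) *\<^sub>C q) * u x l) \<otimes>\<^sub>C \<pi> (\<Sum>k\<in>W. star (u m k) * u l k))"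
    by (simp add: clinearD(6)[OF proj_linear] clinearD(6)[OF clinear_tens_right])
  also have "\<dots> = (\<Sum>m\<in>W. \<Sum>q\<in>P. \<Sum>l\<in>W.
      if l = m then (star (u y m) * (counit A (\<iota> (f q)) *\<^sub>C q) * u x l) \<otimes>\<^sub>C 1 else 0)"
    by (intro sum.cong refl)
       (simp add: orthonormal_corep_unitary(1)[OF assms(1-3) orth] clinearD(3)[OF proj_linear] proj_one
         clinearD(3)[OF clinear_tens_right])
  also have "\<dots> = (\<Sum>m\<in>W. \<Sum>q\<in>P. (star (u y m) * (counit A (\<iota> (f q)) *\<^sub>C q) * u x m) \<otimes>\<^sub>C 1)"
    using fW by simp
  also have "\<dots> = (\<Sum>m\<in>W. star (u y m) * (\<Sum>q\<in>P. counit A (\<iota> (f q)) *\<^sub>C q) * u x m) \<otimes>\<^sub>C 1"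
    by (simp add: clinearD(6)[OF clinear_tens_left] sum_distrib_left sum_distrib_right)
  finally show ?thesis unfolding coinvariant_def by (simp add: incl_counit_right[OF P, symmetric])
qed

text \<open>
  On the basis \<open>W\<close>, the right action of \<open>c\<close> is the left action of the matrix \<open>u c u\<^sup>-\<^sup>1\<close>. Acting from the
  right by the elements \<open>\<Sum>\<^sub>k u\<^sub>y\<^sub>k\<^sup>* b u\<^sub>x\<^sub>k\<close>, which are in \<open>B\<close> because they are coinvariant, undoes this twist:
  the conjugate of \<open>u\<close> is the inverse of its transpose.
\<close>

theorem left_action_as_right:
  fixes lact :: "'b \<Rightarrow> 'm::complex_vector \<Rightarrow> 'm"
  assumes M: "relative_hopf_module_0 A \<iota> \<Delta>\<^sub>B lact ract \<delta>"
    and s: "psd_form s" "invariant_form A \<delta> s" "corep_basis A \<delta> W u"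
    and orth: "\<And>x y. x \<in> W \<Longrightarrow> y \<in> W \<Longrightarrow> s x y = (if x = y then 1 else 0)"
  shows "\<exists>a. (\<forall>x\<in>W. lact b x = (\<Sum>y\<in>W. ract y (a x y))) \<and>
    (\<forall>x\<in>W. \<forall>y\<in>W. counit A (\<iota> (a x y)) = (if x = y then counit A (\<iota> b) else 0))"
proof -
  interpret M: relative_hopf_module_0 A \<iota> \<Delta>\<^sub>B lact ract \<delta> by (rule M)
  have fW: "finite W" and \<delta>: "\<And>x. x \<in> W \<Longrightarrow> \<delta> x = (\<Sum>y\<in>W. u x y \<otimes>\<^sub>C y)"
    and cu: "\<And>x y. x \<in> W \<Longrightarrow> y \<in> W \<Longrightarrow> comult A (u x y) = (\<Sum>z\<in>W. u x z \<otimes>\<^sub>C u z y)"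
    and eu: "\<And>x y. x \<in> W \<Longrightarrow> y \<in> W \<Longrightarrow> counit A (u x y) = (if x = y then 1 else 0)"
    using s(3) by (auto simp: corep_basis_def)
  define \<alpha> where "\<alpha> x y = (\<Sum>k\<in>W. star (u y k) * \<iota> b * u x k)" for x y
  have "\<exists>c. \<iota> c = \<alpha> x y" if "x \<in> W" "y \<in> W" for x y
  proof -
    have "coinvariant (\<alpha> x y)" unfolding \<alpha>_def
      by (rule conjugate_coinvariant[OF s _ that]) (simp add: orth)
    then show ?thesis using coinvariant_in_range by force
  qed
  then obtain a where a: "\<And>x y. x \<in> W \<Longrightarrow> y \<in> W \<Longrightarrow> \<iota> (a x y) = \<alpha> x y" by metis
  have counit: "counit A (\<iota> (a x y)) = (if x = y then counit A (\<iota> b) else 0)" if xy: "x \<in> W" "y \<in> W" for x y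
  proof -
    have "counit A (\<iota> (a x y)) = (\<Sum>k\<in>W. cnj (counit A (u y k)) * counit A (\<iota> b) * counit A (u x k))"
      by (simp add: a xy \<alpha>_def clinearD[OF counit_linear] counit_mult counit_star)
    also have "\<dots> = (\<Sum>k\<in>W. (if y = k then 1 else 0) * (counit A (\<iota> b) * counit A (u x k)))"
      by (intro sum.cong refl) (simp add: eu xy)
    also have "\<dots> = counit A (\<iota> b) * counit A (u x y)" by (rule sum_delta_mult(2)[OF fW xy(2)])
    finally show ?thesis by (simp add: eu xy)
  qed
  have act: "lact b x = (\<Sum>y\<in>W. ract y (a x y))" if x: "x \<in> W" for x
  proof -
    have ex: "\<exists>t. tmap \<iota> id t = (\<Sum>l\<in>W. (\<Sum>k\<in>W. u y k * \<alpha> x y * antipode A (u k l)) \<otimes>\<^sub>C l) \<and>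
        ract y (a x y) = tlift lact t" if y: "y \<in> W" for y
    proof -
      obtain t where t: "tmap \<iota> id t = tmap (tlift (\<lambda>p p'. p * \<iota> (a x y) * antipode A p')) id (tmap (comult A) id (\<delta> y))"
        "ract y (a x y) = tlift lact t"
        using M.right_action by blast
      have b: "cbilinear (\<lambda>p p'. p * \<iota> (a x y) * antipode A p')"
        by (rule cbilinearI) (simp_all add: distrib_left distrib_right mult_scaleC_left mult_scaleC_right
            clinearD[OF antipode_linear])
      note b' = cbilinear_balanced[OF b]
      have "tmap \<iota> id t = (\<Sum>l\<in>W. tlift (\<lambda>p p'. p * \<iota> (a x y) * antipode A p') (comult A (u y l)) \<otimes>\<^sub>C l)"
        by (simp add: t(1) \<delta> y clinearD[OF clinear_tmap[OF comult_linear clinear_id]] tmap_idr[OF comult_linear]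
            clinearD[OF clinear_tmap[OF clinear_tlift[OF b] clinear_id]] tmap_idr[OF clinear_tlift[OF b]])
      also have "\<dots> = (\<Sum>l\<in>W. (\<Sum>k\<in>W. u y k * \<alpha> x y * antipode A (u k l)) \<otimes>\<^sub>C l)"
        by (intro sum.cong refl) (simp add: cu y tlift_sum[OF b'] tlift_tens[OF b'], simp add: a x y)
      finally show ?thesis using t(2) by blast
    qed
    then have "\<forall>y\<in>W. \<exists>t. tmap \<iota> id t = (\<Sum>l\<in>W. (\<Sum>k\<in>W. u y k * \<alpha> x y * antipode A (u k l)) \<otimes>\<^sub>C l) \<and>
        ract y (a x y) = tlift lact t" by (intro ballI)
    from bchoice[OF this]
    obtain t where t: "\<And>y. y \<in> W \<Longrightarrow> tmap \<iota> id (t y) = (\<Sum>l\<in>W. (\<Sum>k\<in>W. u y k * \<alpha> x y * antipode A (u k l)) \<otimes>\<^sub>C l)"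
      "\<And>y. y \<in> W \<Longrightarrow> ract y (a x y) = tlift lact (t y)" by (elim exE) (rule that, simp_all)
    have co: "(\<Sum>y\<in>W. \<Sum>k\<in>W. u y k * \<alpha> x y * antipode A (u k l)) = (if x = l then \<iota> b else 0)" if l: "l \<in> W" for l
    proof -
      have "(\<Sum>y\<in>W. \<Sum>k\<in>W. u y k * \<alpha> x y * antipode A (u k l))
          = (\<Sum>k\<in>W. (\<Sum>y\<in>W. u y k * \<alpha> x y) * antipode A (u k l))"
        by (subst sum.swap) (simp add: sum_distrib_right)
      also have "\<dots> = (\<Sum>k\<in>W. (\<iota> b * u x k) * antipode A (u k l))"
      proof (intro sum.cong refl arg_cong2[where f = times])
        fix k assume k: "k \<in> W"
        have "(\<Sum>y\<in>W. u y k * \<alpha> x y) = (\<Sum>y\<in>W. \<Sum>m\<in>W. (u y k * star (u y m)) * (\<iota> b * u x m))"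
          by (simp add: \<alpha>_def sum_distrib_left mult.assoc)
        also have "\<dots> = (\<Sum>m\<in>W. (\<Sum>y\<in>W. u y k * star (u y m)) * (\<iota> b * u x m))"
          by (subst sum.swap) (simp add: sum_distrib_right)
        also have "\<dots> = (\<Sum>m\<in>W. (if k = m then 1 else 0) * (\<iota> b * u x m))"
          by (intro sum.cong refl arg_cong2[where f = times] orthonormal_corep_unitary(2)[OF s orth] k)
        also have "\<dots> = \<iota> b * u x k" by (rule sum_delta_mult(2)[OF fW k])
        finally show "(\<Sum>y\<in>W. u y k * \<alpha> x y) = \<iota> b * u x k" .
      qed
      also have "\<dots> = \<iota> b * (\<Sum>k\<in>W. u x k * antipode A (u k l))"
        by (simp add: sum_distrib_left mult.assoc)
      also have "\<dots> = (if x = l then \<iota> b else 0)" by (simp add: corep_antipode(2)[OF s(3) x l])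
      finally show ?thesis .
    qed
    note li = clinear_tmap[OF incl_linear clinear_id]
    have "tmap \<iota> id (\<Sum>y\<in>W. t y) = (\<Sum>y\<in>W. \<Sum>l\<in>W. (\<Sum>k\<in>W. u y k * \<alpha> x y * antipode A (u k l)) \<otimes>\<^sub>C l)"
      unfolding clinearD(6)[OF li] by (intro sum.cong refl) (rule t)
    also have "\<dots> = (\<Sum>l\<in>W. (\<Sum>y\<in>W. \<Sum>k\<in>W. u y k * \<alpha> x y * antipode A (u k l)) \<otimes>\<^sub>C l)"
      by (subst sum.swap) (simp add: clinearD(6)[OF clinear_tens_left])
    also have "\<dots> = (\<Sum>l\<in>W. if x = l then \<iota> b \<otimes>\<^sub>C l else 0)"
      by (intro sum.cong refl) (simp add: co clinearD(3)[OF clinear_tens_left])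
    also have "\<dots> = tmap \<iota> id (b \<otimes>\<^sub>C x)" using fW x by (simp add: tmap_idr[OF incl_linear])
    finally have "(\<Sum>y\<in>W. t y) = b \<otimes>\<^sub>C x" by (rule tmap_inj[OF incl_linear incl_inj])
    from arg_cong[OF this, of "tlift lact"] show ?thesis
      using t(2) by (simp add: tlift_sum[OF cbilinear_balanced[OF M.cbilinear_lact]]
          tlift_tens[OF cbilinear_balanced[OF M.cbilinear_lact]])
  qed
  show ?thesis using counit act by (intro exI[of _ a]) blast
qed

end

section \<open>Direct sum decompositions\<close>

context
  fixes V :: "'i \<Rightarrow> 'v::complex_vector set"
  assumes V: "direct_sum_decomposition V"
begin

lemma dsd_subspace: "csubspace (V i)"
  using V by (simp add: direct_sum_decomposition_def)

lemma component_decomposition: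
  "finite {i. component V i v \<noteq> 0} \<and> (\<forall>i. component V i v \<in> V i) \<and> v = (\<Sum>i | component V i v \<noteq> 0. component V i v)"
proof -
  have "\<exists>!f. finite {i. f i \<noteq> 0} \<and> (\<forall>i. f i \<in> V i) \<and> v = (\<Sum>i | f i \<noteq> 0. f i)"
    using V by (simp add: direct_sum_decomposition_def)
  from theI'[OF this] show ?thesis unfolding component_def .
qed

lemma component_mem: "component V i v \<in> V i"
  using component_decomposition by blast

lemma component_unique:
  assumes "finite I" "\<And>i. i \<in> I \<Longrightarrow> f i \<in> V i"
  shows "component V j (\<Sum>i\<in>I. f i) = (if j \<in> I then f j else 0)"
proof -
  define g where "g i = (if i \<in> I then f i else 0)" for i
  have sub: "{i. g i \<noteq> 0} \<subseteq> I" by (auto simp: g_def)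
  have "(\<Sum>i\<in>I. f i) = (\<Sum>i | g i \<noteq> 0. g i)"
    using assms(1) by (intro sum.mono_neutral_cong_right) (auto simp: g_def)
  moreover have "\<forall>i. g i \<in> V i" using assms(2) cvs.subspace_0[OF dsd_subspace] by (simp add: g_def)
  moreover define P where
    "P f' \<longleftrightarrow> finite {i. f' i \<noteq> 0} \<and> (\<forall>i. f' i \<in> V i) \<and> (\<Sum>i\<in>I. f i) = (\<Sum>i | f' i \<noteq> 0. f' i)" for f'
  ultimately have "P g" using sub assms(1) finite_subset by blast
  moreover have "\<exists>!f'. P f'" using V by (simp add: P_def direct_sum_decomposition_def)
  moreover have "P (\<lambda>i. component V i (\<Sum>i\<in>I. f i))" unfolding P_def by (rule component_decomposition)
  ultimately have "(\<lambda>i. component V i (\<Sum>i\<in>I. f i)) = g" by blast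
  then have "component V j (\<Sum>i\<in>I. f i) = g j" by (rule fun_cong)
  then show ?thesis by (simp add: g_def)
qed

lemma component_sum_superset:
  assumes "finite I" "{i. component V i v \<noteq> 0} \<subseteq> I"
  shows "(\<Sum>i\<in>I. component V i v) = v"
proof -
  have "v = (\<Sum>i | component V i v \<noteq> 0. component V i v)" using component_decomposition by blast
  also have "\<dots> = (\<Sum>i\<in>I. component V i v)" using assms by (intro sum.mono_neutral_left) auto
  finally show ?thesis by simp
qed

lemma clinear_component: "clinear (component V i)"
proof (rule clinearI)
  fix v w :: 'v and c
  let ?I = "{i. component V i v \<noteq> 0} \<union> {i. component V i w \<noteq> 0}"
  have fin: "finite ?I" using component_decomposition by blast
  have v: "v = (\<Sum>i\<in>?I. component V i v)" and w: "w = (\<Sum>i\<in>?I. component V i w)"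
    by (simp_all add: component_sum_superset[OF fin, of v] component_sum_superset[OF fin, of w])
  have "component V i (\<Sum>i\<in>?I. component V i v + component V i w)
      = (if i \<in> ?I then component V i v + component V i w else 0)"
    by (rule component_unique[OF fin]) (intro cvs.subspace_add dsd_subspace component_mem)
  then show "component V i (v + w) = component V i v + component V i w"
    unfolding sum.distrib v[symmetric] w[symmetric] by auto
  have "component V i (\<Sum>i\<in>?I. c *\<^sub>C component V i v) = (if i \<in> ?I then c *\<^sub>C component V i v else 0)"
    by (rule component_unique[OF fin]) (intro cvs.subspace_scale dsd_subspace component_mem)
  then show "component V i (c *\<^sub>C v) = c *\<^sub>C component V i v"
    unfolding cvs.scale_sum_right[symmetric] v[symmetric] by auto
qed

lemma component_homogeneous:
  assumes "v \<in> V i" shows "component V j v = (if j = i then v else 0)"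
  using component_unique[of "{i}" "\<lambda>_. v" j] assms by simp

lemma dsd_span: "cspan (\<Union>i. V i) = UNIV"
proof -
  have "v \<in> cspan (\<Union>i. V i)" for v
  proof -
    have "v = (\<Sum>i | component V i v \<noteq> 0. component V i v)" using component_decomposition by blast
    also have "\<dots> \<in> cspan (\<Union>i. V i)" by (intro cvs.span_sum cvs.span_base) (use component_mem in blast)
    finally show ?thesis .
  qed
  then show ?thesis by blast
qed

lemma dsd_linear_extension:
  assumes add: "\<And>i x y. x \<in> V i \<Longrightarrow> y \<in> V i \<Longrightarrow> r i (x + y) = r i x + r i y"
    and scale: "\<And>i c x. x \<in> V i \<Longrightarrow> r i (c *\<^sub>C x) = c *\<^sub>C (r i x :: 'u::complex_vector)"
  shows "\<exists>s. clinear s \<and> (\<forall>i. \<forall>x\<in>V i. s x = r i x)"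
proof -
  have r0: "r i 0 = 0" for i using scale[of 0 i 0] cvs.subspace_0[OF dsd_subspace] by simp
  define s where "s v = (\<Sum>i | component V i v \<noteq> 0. r i (component V i v))" for v
  have s: "s v = (\<Sum>i\<in>I. r i (component V i v))" if "finite I" "{i. component V i v \<noteq> 0} \<subseteq> I" for I v
    unfolding s_def using that by (intro sum.mono_neutral_left) (auto simp: r0)
  have "clinear s"
  proof (rule clinearI)
    fix v w :: 'v and c
    let ?I = "{i. component V i v \<noteq> 0} \<union> {i. component V i w \<noteq> 0}"
    have fin: "finite ?I" using component_decomposition by blast
    have "s (v + w) = (\<Sum>i\<in>?I. r i (component V i (v + w)))"
      by (rule s[OF fin]) (auto simp: clinearD[OF clinear_component])
    also have "\<dots> = (\<Sum>i\<in>?I. r i (component V i v)) + (\<Sum>i\<in>?I. r i (component V i w))"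
      by (simp add: clinearD[OF clinear_component] add component_mem sum.distrib)
    also have "\<dots> = s v + s w" using s[OF fin, of v] s[OF fin, of w] by simp
    finally show "s (v + w) = s v + s w" .
    have "s (c *\<^sub>C v) = (\<Sum>i\<in>?I. r i (component V i (c *\<^sub>C v)))"
      by (rule s[OF fin]) (auto simp: clinearD[OF clinear_component])
    also have "\<dots> = c *\<^sub>C (\<Sum>i\<in>?I. r i (component V i v))"
      by (simp add: clinearD[OF clinear_component] scale component_mem cvs.scale_sum_right)
    also have "\<dots> = c *\<^sub>C s v" using s[OF fin, of v] by simp
    finally show "s (c *\<^sub>C v) = c *\<^sub>C s v" .
  qed
  moreover have "s x = r i x" if "x \<in> V i" for i x
  proof -
    have "s x = (\<Sum>i\<in>{i}. r i (component V i x))"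
      by (rule s) (auto simp: component_homogeneous[OF that] split: if_splits)
    then show ?thesis by (simp add: component_homogeneous[OF that])
  qed
  ultimately show ?thesis by blast
qed

end

lemma direct_sum_decompositionI:
  fixes V :: "'i \<Rightarrow> 'v::complex_vector set"
  assumes sub: "\<And>i. csubspace (V i)" and span: "cspan (\<Union>i. V i) = UNIV"
    and indep: "\<And>I f. finite I \<Longrightarrow> (\<And>i. i \<in> I \<Longrightarrow> f i \<in> V i) \<Longrightarrow> (\<Sum>i\<in>I. f i) = 0 \<Longrightarrow> (\<And>i. i \<in> I \<Longrightarrow> f i = 0)"
  shows "direct_sum_decomposition V"
  unfolding direct_sum_decomposition_def
proof (intro conjI allI sub)
  fix v
  have "v \<in> cspan (\<Union>i. V i)" using span by simp
  then have "\<exists>f. finite {i. f i \<noteq> 0} \<and> (\<forall>i. f i \<in> V i) \<and> v = (\<Sum>i | f i \<noteq> 0. f i)"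
  proof (induction rule: cvs.span_induct_alt)
    case base
    show ?case by (rule exI[of _ "\<lambda>_. 0"]) (simp add: cvs.subspace_0[OF sub])
  next
    case (step c x y)
    then obtain f i where f: "finite {i. f i \<noteq> 0}" "\<forall>i. f i \<in> V i" "y = (\<Sum>i | f i \<noteq> 0. f i)" and i: "x \<in> V i"
      by blast
    define g where "g = f(i := f i + c *\<^sub>C x)"
    let ?I = "insert i {i. f i \<noteq> 0}"
    have fin: "finite ?I" using f(1) by simp
    have gI: "{i. g i \<noteq> 0} \<subseteq> ?I" by (auto simp: g_def)
    have "(\<Sum>i | g i \<noteq> 0. g i) = (\<Sum>j\<in>?I. g j)" using fin gI by (intro sum.mono_neutral_left) auto
    also have "\<dots> = (\<Sum>j\<in>?I. f j + (if j = i then c *\<^sub>C x else 0))" by (rule sum.cong) (auto simp: g_def)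
    also have "\<dots> = (\<Sum>j\<in>?I. f j) + c *\<^sub>C x" using fin by (simp add: sum.distrib del: sum.insert)
    also have "(\<Sum>j\<in>?I. f j) = y" unfolding f(3) using fin by (intro sum.mono_neutral_right) auto
    finally have "c *\<^sub>C x + y = (\<Sum>i | g i \<noteq> 0. g i)" by (simp add: add.commute)
    moreover have "\<forall>j. g j \<in> V j"
      using f(2) i by (auto simp: g_def intro!: cvs.subspace_add[OF sub] cvs.subspace_scale[OF sub])
    moreover have "finite {i. g i \<noteq> 0}" using gI fin by (rule finite_subset)
    ultimately show ?case by blast
  qed
  then show "\<exists>!f. finite {i. f i \<noteq> 0} \<and> (\<forall>i. f i \<in> V i) \<and> v = (\<Sum>i | f i \<noteq> 0. f i)"
  proof (rule ex_ex1I)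
    fix f g
    assume f: "finite {i. f i \<noteq> 0} \<and> (\<forall>i. f i \<in> V i) \<and> v = (\<Sum>i | f i \<noteq> 0. f i)"
      and g: "finite {i. g i \<noteq> 0} \<and> (\<forall>i. g i \<in> V i) \<and> v = (\<Sum>i | g i \<noteq> 0. g i)"
    let ?I = "{i. f i \<noteq> 0} \<union> {i. g i \<noteq> 0}"
    have fin: "finite ?I" using f g by blast
    have "(\<Sum>i\<in>?I. f i) = (\<Sum>i | f i \<noteq> 0. f i)" "(\<Sum>i\<in>?I. g i) = (\<Sum>i | g i \<noteq> 0. g i)"
      by (rule sum.mono_neutral_right[OF fin]; auto)+
    with f g have "(\<Sum>i\<in>?I. f i) = v" "(\<Sum>i\<in>?I. g i) = v" by simp_all
    then have "(\<Sum>i\<in>?I. f i - g i) = 0" by (simp add: sum_subtractf)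
    then have "f i - g i = 0" if "i \<in> ?I" for i
      using indep[OF fin, of "\<lambda>i. f i - g i" i] f g that by (simp add: cvs.subspace_diff[OF sub])
    then show "f = g" by (intro ext) force
  qed
qed

section \<open>The Lefschetz decomposition and the Hodge map\<close>

context hermitian_structure
begin

lemma lefschetz_power: "(lefschetz \<sigma> ^^ j) x = \<sigma> ^ j * x"
  by (induction j) (simp_all add: lefschetz_def mult.assoc id_apply)

lemma sigma_power_central: "\<sigma> ^ j * x = x * \<sigma> ^ j"
proof (induction j)
  case (Suc j)
  have "\<sigma> ^ Suc j * x = \<sigma> * (x * \<sigma> ^ j)" using Suc by (simp add: mult.assoc)
  also have "\<dots> = x * \<sigma> * \<sigma> ^ j" by (metis sigma_central mult.assoc)
  finally show ?case by (simp add: mult.assoc)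
qed simp

lemmas complex_structure_conjuncts = complex_structure[unfolded complex_structure_def]

lemma bigrading: "direct_sum_decomposition \<Omega>\<^sub>2"
  by (rule conjunct1[OF complex_structure_conjuncts])

lemma bigrading_mult: "x \<in> \<Omega>\<^sub>2 (a, b) \<Longrightarrow> y \<in> \<Omega>\<^sub>2 (a', b') \<Longrightarrow> x * y \<in> \<Omega>\<^sub>2 (a + a', b + b')"
  using complex_structure_conjuncts[THEN conjunct2, THEN conjunct1] by simp

lemma bigrading_one: "1 \<in> \<Omega>\<^sub>2 (0, 0)"
  by (rule complex_structure_conjuncts[THEN conjunct2, THEN conjunct2, THEN conjunct1])

lemma grading_span: "\<Omega> k = cspan (\<Union>{\<Omega>\<^sub>2 (a, b) | a b. a + b = k})"
  using complex_structure_conjuncts[THEN conjunct2, THEN conjunct2, THEN conjunct2, THEN conjunct1] by simp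

lemma subspace_grading: "csubspace (\<Omega> k)" and subspace_bigrading: "csubspace (\<Omega>\<^sub>2 i)"
  by (rule dsd_subspace[OF grading], rule dsd_subspace[OF bigrading])

lemma bigrading_grading: "x \<in> \<Omega>\<^sub>2 (a, b) \<Longrightarrow> x \<in> \<Omega> (a + b)"
  unfolding grading_span by (rule cvs.span_base) blast

lemma bigrading_00: "\<Omega>\<^sub>2 (0, 0) = \<Omega> 0"
proof -
  have "\<Union>{\<Omega>\<^sub>2 (a, b) | a b. a + b = 0} = \<Omega>\<^sub>2 (0, 0)" by auto
  moreover have "cspan (\<Omega>\<^sub>2 (0, 0)) = \<Omega>\<^sub>2 (0, 0)"
    unfolding cvs.span_eq_iff by (rule subspace_bigrading)
  ultimately show ?thesis using grading_span[of 0] by (simp only:)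
qed

lemma eta_degree: "\<eta> b \<in> \<Omega> 0" and eta_bidegree: "\<eta> b \<in> \<Omega>\<^sub>2 (0, 0)"
  using degree_zero_range by (auto simp: bigrading_00)

lemma sigma_power_bidegree: "\<sigma> ^ j \<in> \<Omega>\<^sub>2 (j, j)"
proof (induction j)
  case (Suc j)
  then show ?case using bigrading_mult[OF sigma_degree Suc] by simp
qed (simp add: bigrading_one)

lemma sigma_mult_bidegree: "x \<in> \<Omega>\<^sub>2 (a, b) \<Longrightarrow> \<sigma> ^ j * x \<in> \<Omega>\<^sub>2 (a + j, b + j)"
  using bigrading_mult[OF sigma_power_bidegree] by (simp add: add.commute)

lemma sigma_mult_degree: "x \<in> \<Omega> k \<Longrightarrow> \<sigma> ^ j * x \<in> \<Omega> (k + 2 * j)"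
proof -
  assume "x \<in> \<Omega> k"
  then have "\<sigma> ^ j * x \<in> \<Omega> (j + j + k)" by (rule grading_mult[OF bigrading_grading[OF sigma_power_bidegree]])
  moreover have "j + j + k = k + 2 * j" by simp
  ultimately show ?thesis by simp
qed

lemma component_sigma: "component \<Omega>\<^sub>2 (a + j, b + j) (\<sigma> ^ j * x) = \<sigma> ^ j * component \<Omega>\<^sub>2 (a, b) x"
proof -
  let ?I = "{i. component \<Omega>\<^sub>2 i x \<noteq> 0}"
  have fin: "finite ?I" using component_decomposition[OF bigrading] by blast
  have c: "component \<Omega>\<^sub>2 (a + j, b + j) (\<sigma> ^ j * component \<Omega>\<^sub>2 i x)
      = (if i = (a, b) then \<sigma> ^ j * component \<Omega>\<^sub>2 (a, b) x else 0)" for i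
  proof (cases i)
    case (Pair p q)
    have "\<sigma> ^ j * component \<Omega>\<^sub>2 i x \<in> \<Omega>\<^sub>2 (p + j, q + j)"
      using sigma_mult_bidegree component_mem[OF bigrading, of "(p, q)"] Pair by simp
    from component_homogeneous[OF bigrading this, of "(a + j, b + j)"] show ?thesis using Pair by auto
  qed
  have "\<sigma> ^ j * x = (\<Sum>i\<in>?I. \<sigma> ^ j * component \<Omega>\<^sub>2 i x)"
    using component_sum_superset[OF bigrading fin, of x] by (simp add: sum_distrib_left[symmetric])
  then have "component \<Omega>\<^sub>2 (a + j, b + j) (\<sigma> ^ j * x)
      = (\<Sum>i\<in>?I. component \<Omega>\<^sub>2 (a + j, b + j) (\<sigma> ^ j * component \<Omega>\<^sub>2 i x))"
    by (simp add: clinearD(6)[OF clinear_component[OF bigrading]])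
  also have "\<dots> = (if (a, b) \<in> ?I then \<sigma> ^ j * component \<Omega>\<^sub>2 (a, b) x else 0)"
    unfolding c using fin by simp
  finally show ?thesis by auto
qed

lemma component_degree:
  assumes "x \<in> \<Omega> k" "component \<Omega>\<^sub>2 (a, b) x \<noteq> 0" shows "a + b = k"
proof (rule ccontr)
  assume n: "a + b \<noteq> k"
  have "component \<Omega>\<^sub>2 (a, b) x = 0"
    using assms(1) unfolding grading_span
  proof (induction rule: cvs.span_induct_alt)
    case (step c x y)
    then obtain p q where "x \<in> \<Omega>\<^sub>2 (p, q)" "p + q = k" by blast
    then have "component \<Omega>\<^sub>2 (a, b) x = 0" using n by (auto simp: component_homogeneous[OF bigrading])
    then show ?case using step by (simp add: clinearD[OF clinear_component[OF bigrading]])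
  qed (simp add: clinearD[OF clinear_component[OF bigrading]])
  then show False using assms(2) by simp
qed

definition bihomogeneous_primitive :: "nat \<Rightarrow> nat \<Rightarrow> 'w set"
  where "bihomogeneous_primitive a b = primitive \<Omega> n \<sigma> (a + b) \<inter> \<Omega>\<^sub>2 (a, b)"

lemma bihomogeneous_primitive_iff:
  "a + b \<le> n \<Longrightarrow> x \<in> bihomogeneous_primitive a b \<longleftrightarrow> x \<in> \<Omega>\<^sub>2 (a, b) \<and> \<sigma> ^ (n - (a + b) + 1) * x = 0"
  unfolding bihomogeneous_primitive_def primitive_def lefschetz_power using bigrading_grading by auto

lemma subspace_bihomogeneous_primitive: 
  assumes "a + b \<le> n" shows "csubspace (bihomogeneous_primitive a b)"
  by (rule cvs.subspaceI)
     (auto simp: bihomogeneous_primitive_iff[OF assms] distrib_left mult_scaleC_right cvs.subspace_0[OF subspace_bigrading]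
       cvs.subspace_add[OF subspace_bigrading] cvs.subspace_scale[OF subspace_bigrading] simp del: power_Suc)

lemma primitive_component:
  assumes "x \<in> \<Omega> k" "k \<le> n" "\<sigma> ^ (n - k + 1) * x = 0" "a + b = k"
  shows "component \<Omega>\<^sub>2 (a, b) x \<in> bihomogeneous_primitive a b"
proof -
  have "\<sigma> ^ (n - k + 1) * component \<Omega>\<^sub>2 (a, b) x = 0"
    unfolding component_sigma[symmetric] assms(3) by (rule clinearD(3)[OF clinear_component[OF bigrading]])
  then show ?thesis using assms(2,4) component_mem[OF bigrading] by (simp add: bihomogeneous_primitive_iff del: power_Suc)
qed

definition lefschetz_strings :: "nat \<Rightarrow> 'w set"
  where "lefschetz_strings k = {\<sigma> ^ j * \<alpha> | a b j \<alpha>. \<alpha> \<in> bihomogeneous_primitive a b \<and> j + (a + b) \<le> n \<and> 2 * j + (a + b) = k}"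

lemma sigma_mult_eq_0:
  assumes "x \<in> \<Omega> k" "k \<le> n" "\<sigma> ^ (n - k) * x = 0" shows "x = 0"
proof (cases "k < n")
  case True
  have "inj_on (lefschetz \<sigma> ^^ (n - k)) (\<Omega> k)" using lefschetz_iso[OF True] by (simp add: bij_betw_def)
  from inj_onD[OF this _ assms(1) cvs.subspace_0[OF subspace_grading]] show ?thesis
    using assms(3) by (simp add: lefschetz_power)
next
  case False
  then show ?thesis using assms by simp
qed

lemma grading_high: "k > 2 * n \<Longrightarrow> \<Omega> k = {0}"
  using total_degree by (simp add: total_degree_def)

lemma sigma_lefschetz_strings:
  assumes "x \<in> cspan (lefschetz_strings k)" "k + m \<le> n"
  shows "\<sigma> ^ m * x \<in> cspan (lefschetz_strings (k + 2 * m))"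
  using assms(1)
proof (induction rule: cvs.span_induct_alt)
  case (step c x y)
  then obtain a b j \<alpha> where \<alpha>: "x = \<sigma> ^ j * \<alpha>" "\<alpha> \<in> bihomogeneous_primitive a b" "j + (a + b) \<le> n" "2 * j + (a + b) = k"
    by (auto simp: lefschetz_strings_def)
  have "\<sigma> ^ m * x = \<sigma> ^ (m + j) * \<alpha>" by (simp add: \<alpha>(1) power_add mult.assoc)
  moreover have "m + j + (a + b) \<le> n" "2 * (m + j) + (a + b) = k + 2 * m" using \<alpha> assms(2) by auto
  ultimately have "\<sigma> ^ m * x \<in> lefschetz_strings (k + 2 * m)"
    using \<alpha>(2) unfolding lefschetz_strings_def by blast
  then show ?case using step.IH
    by (simp add: distrib_left mult_scaleC_right cvs.span_add cvs.span_scale cvs.span_base)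
qed (simp add: cvs.span_zero)

text \<open>
  By surjectivity of \<open>\<sigma>\<^sup>n\<^sup>-\<^sup>k\<^sup>+\<^sup>2\<close> on \<open>\<Omega>\<^sup>k\<^sup>-\<^sup>2\<close> there is \<open>\<beta>\<close> with \<open>\<sigma>\<^sup>n\<^sup>-\<^sup>k\<^sup>+\<^sup>1 x = \<sigma>\<^sup>n\<^sup>-\<^sup>k\<^sup>+\<^sup>2 \<beta>\<close>. Then \<open>x - \<sigma> \<beta>\<close>
  is primitive, and \<open>\<beta>\<close> has smaller degree.
\<close>

lemma lefschetz_spanning_low:
  "k \<le> n \<Longrightarrow> x \<in> \<Omega> k \<Longrightarrow> x \<in> cspan (lefschetz_strings k)"
proof (induction k arbitrary: x rule: less_induct)
  case (less k)
  have prim: "y \<in> cspan (lefschetz_strings k)" if y: "y \<in> \<Omega> k" "\<sigma> ^ (n - k + 1) * y = 0" for y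
  proof -
    let ?I = "{i. component \<Omega>\<^sub>2 i y \<noteq> 0}"
    have "y = (\<Sum>i\<in>?I. component \<Omega>\<^sub>2 i y)" using component_decomposition[OF bigrading] by blast
    also have "\<dots> \<in> cspan (lefschetz_strings k)"
    proof (intro cvs.span_sum cvs.span_base)
      fix i assume "i \<in> ?I"
      then obtain a b where i: "i = (a, b)" "component \<Omega>\<^sub>2 (a, b) y \<noteq> 0" by (cases i) auto
      then have ab: "a + b = k" using component_degree[OF y(1)] by blast
      have "component \<Omega>\<^sub>2 (a, b) y \<in> bihomogeneous_primitive a b"
        by (rule primitive_component[OF y(1) less.prems(1) y(2) ab])
      then show "component \<Omega>\<^sub>2 i y \<in> lefschetz_strings k"
        unfolding lefschetz_strings_def i(1) using ab less.prems(1)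
        by (intro CollectI exI[of _ a] exI[of _ b] exI[of _ 0] exI[of _ "component \<Omega>\<^sub>2 (a, b) y"]) simp
    qed
    finally show ?thesis .
  qed
  have deg: "\<sigma> ^ (n - k + 1) * x \<in> \<Omega> (k + 2 * (n - k + 1))" by (rule sigma_mult_degree[OF less.prems(2)])
  show ?case
  proof (cases "k < 2")
    case True
    \<comment> \<open>The form \<open>x\<close> itself is primitive, because \<open>\<sigma>\<^sup>n\<^sup>-\<^sup>k\<^sup>+\<^sup>1 x\<close> exceeds the total degree.\<close>
    then have "2 * n < k + 2 * (n - k + 1)" using less.prems(1) by auto
    then show ?thesis using prim[OF less.prems(2)] deg grading_high by auto
  next
    case False
    then have k: "k - 2 < n" "k + 2 * (n - k + 1) = 2 * n - (k - 2)" "n - (k - 2) = (n - k + 1) + 1" using less.prems(1) by auto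
    have "bij_betw (lefschetz \<sigma> ^^ (n - (k - 2))) (\<Omega> (k - 2)) (\<Omega> (2 * n - (k - 2)))" by (rule lefschetz_iso[OF k(1)])
    then have "\<exists>\<beta>\<in>\<Omega> (k - 2). (lefschetz \<sigma> ^^ (n - (k - 2))) \<beta> = \<sigma> ^ (n - k + 1) * x"
      using deg unfolding k(2) bij_betw_def by (metis imageE)
    then obtain \<beta> where \<beta>: "\<beta> \<in> \<Omega> (k - 2)" "\<sigma> ^ (n - k + 1 + 1) * \<beta> = \<sigma> ^ (n - k + 1) * x"
      unfolding lefschetz_power k(3) by blast
    have \<sigma>\<beta>: "\<sigma> * \<beta> \<in> \<Omega> k" using sigma_mult_degree[OF \<beta>(1), of 1] False by (simp add: numeral_2_eq_2 Suc_diff_Suc)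
    have "x - \<sigma> * \<beta> \<in> \<Omega> k" using less.prems(2) \<sigma>\<beta> by (rule cvs.subspace_diff[OF subspace_grading])
    moreover have "\<sigma> ^ (n - k + 1) * (x - \<sigma> * \<beta>) = 0"
    proof -
      have "\<sigma> ^ (n - k + 1) * (\<sigma> * \<beta>) = \<sigma> ^ (n - k + 1 + 1) * \<beta>"
        by (simp only: power_add[of \<sigma> "n - k + 1" 1] power_one_right mult.assoc)
      then show ?thesis unfolding right_diff_distrib using \<beta>(2) by simp
    qed
    ultimately have 1: "x - \<sigma> * \<beta> \<in> cspan (lefschetz_strings k)" by (rule prim)
    have "\<beta> \<in> cspan (lefschetz_strings (k - 2))" using less.IH[of "k - 2"] \<beta>(1) less.prems(1) False by simp
    from sigma_lefschetz_strings[OF this, of 1] have "\<sigma> * \<beta> \<in> cspan (lefschetz_strings k)"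
      using False less.prems(1) by (simp add: numeral_2_eq_2 Suc_diff_Suc)
    from cvs.span_add[OF 1 this] show ?thesis by simp
  qed
qed

lemma lefschetz_spanning:
  assumes "x \<in> \<Omega> k" shows "x \<in> cspan (lefschetz_strings k)"
proof -
  consider "k \<le> n" | "n < k" "k \<le> 2 * n" | "2 * n < k" by linarith
  then show ?thesis
  proof cases
    case 1
    then show ?thesis using lefschetz_spanning_low assms by blast
  next
    case 2
    define l where "l = 2 * n - k"
    have l: "l < n" "2 * n - l = k" "l + 2 * (n - l) = k" using 2 by (auto simp: l_def)
    have "bij_betw (lefschetz \<sigma> ^^ (n - l)) (\<Omega> l) (\<Omega> k)" using lefschetz_iso[OF l(1)] l(2) by simp
    then obtain y where y: "y \<in> \<Omega> l" "x = \<sigma> ^ (n - l) * y"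
      using assms unfolding bij_betw_def lefschetz_power by blast
    have "y \<in> cspan (lefschetz_strings l)" using lefschetz_spanning_low[OF _ y(1)] l(1) by simp
    from sigma_lefschetz_strings[OF this, of "n - l"] show ?thesis using l by (simp add: y(2))
  next
    case 3
    then show ?thesis using grading_high assms by (auto simp: cvs.span_zero)
  qed
qed

lemma lefschetz_string_inj:
  assumes "\<alpha> \<in> bihomogeneous_primitive a b" "j + (a + b) \<le> n" "\<sigma> ^ j * \<alpha> = 0"
  shows "\<alpha> = 0"
proof (rule sigma_mult_eq_0)
  show "\<alpha> \<in> \<Omega> (a + b)" using assms(1) bigrading_grading by (auto simp: bihomogeneous_primitive_def)
  show "a + b \<le> n" using assms(2) by simp
  have "n - (a + b) = (n - (a + b) - j) + j" using assms(2) by simp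
  then have "\<sigma> ^ (n - (a + b)) * \<alpha> = \<sigma> ^ (n - (a + b) - j) * (\<sigma> ^ j * \<alpha>)"
    by (metis power_add mult.assoc)
  then show "\<sigma> ^ (n - (a + b)) * \<alpha> = 0" by (simp add: assms(3))
qed

definition lefschetz_summand :: "nat \<times> nat \<times> nat \<Rightarrow> 'w set"
  where "lefschetz_summand = (\<lambda>(a, b, j). if j + (a + b) \<le> n then (\<lambda>\<alpha>. \<sigma> ^ j * \<alpha>) ` bihomogeneous_primitive a b else {0})"

lemma lefschetz_summand_bidegree: "x \<in> lefschetz_summand (a, b, j) \<Longrightarrow> x \<in> \<Omega>\<^sub>2 (a + j, b + j)"
  by (auto simp: lefschetz_summand_def bihomogeneous_primitive_def sigma_mult_bidegree
      cvs.subspace_0[OF subspace_bigrading] split: if_splits)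

text \<open>
  In a relation between terms of the same bidegree, a power of \<open>\<sigma>\<close> that is just high enough to
  annihilate all terms but the one with the largest exponent isolates that term.
\<close>

lemma lefschetz_summand_independent_bidegree:
  assumes "finite I" "\<And>i. i \<in> I \<Longrightarrow> f i \<in> lefschetz_summand i" "(\<Sum>i\<in>I. f i) = 0"
    and deg: "\<And>a b j. (a, b, j) \<in> I \<Longrightarrow> a + j = p \<and> b + j = q"
  shows "\<forall>i\<in>I. f i = 0"
proof (rule ccontr)
  assume "\<not> (\<forall>i\<in>I. f i = 0)"
  define I' where "I' = {i \<in> I. f i \<noteq> 0}"
  have I': "finite I'" "I' \<noteq> {}" using \<open>\<not> _\<close> assms(1) by (auto simp: I'_def)
  define m where "m = Max ((\<lambda>i. snd (snd i)) ` I')"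
  have "m \<in> (\<lambda>i. snd (snd i)) ` I'" unfolding m_def using I' by (intro Max_in) auto
  then obtain a b where i: "(a, b, m) \<in> I'" by force
  have le: "j \<le> m" if "(a', b', j) \<in> I'" for a' b' j
    unfolding m_def using I'(1) that by (intro Max_ge) force+
  have d: "a + m = p" "b + m = q" using deg i by (auto simp: I'_def)
  have str: "j + (a' + b') \<le> n \<and> (\<exists>\<alpha>\<in>bihomogeneous_primitive a' b'. f (a', b', j) = \<sigma> ^ j * \<alpha>)"
    if "(a', b', j) \<in> I'" for a' b' j
  proof -
    have "f (a', b', j) \<in> lefschetz_summand (a', b', j)" "f (a', b', j) \<noteq> 0"
      using that assms(2) by (auto simp: I'_def)
    then show ?thesis by (auto simp: lefschetz_summand_def split: if_splits)
  qed
  obtain \<alpha> where \<alpha>: "m + (a + b) \<le> n" "\<alpha> \<in> bihomogeneous_primitive a b" "f (a, b, m) = \<sigma> ^ m * \<alpha>"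
    using str[OF i] by blast
  \<comment> \<open>\<open>\<sigma> ^ (e + m)\<close> is injective on forms of degree \<open>a + b\<close>; the next power annihilates the primitive ones.\<close>
  define e where "e = n - (a + b) - m"
  have kill: "\<sigma> ^ e * f i' = 0" if "i' \<in> I'" "i' \<noteq> (a, b, m)" for i'
  proof -
    obtain a' b' j where i': "i' = (a', b', j)" by (cases i') auto
    have d': "a' + j = p" "b' + j = q" using deg that(1) by (auto simp: I'_def i')
    have "j \<noteq> m" using that(2) d d' by (auto simp: i')
    then have j: "j < m" using le[of a' b' j] that(1) i' by fastforce
    obtain \<beta> where \<beta>: "j + (a' + b') \<le> n" "\<beta> \<in> bihomogeneous_primitive a' b'" "f i' = \<sigma> ^ j * \<beta>"
      using str[of a' b' j] \<open>i' \<in> I'\<close> i' by auto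
    have ex: "e + j = (e + j - (n - (a' + b') + 1)) + (n - (a' + b') + 1)"
      using j d d' \<alpha>(1) \<beta>(1) by (simp add: e_def)
    have "\<sigma> ^ e * f i' = \<sigma> ^ (e + j) * \<beta>" by (simp add: \<beta>(3) power_add mult.assoc)
    also have "\<dots> = \<sigma> ^ (e + j - (n - (a' + b') + 1)) * (\<sigma> ^ (n - (a' + b') + 1) * \<beta>)"
      by (subst ex) (simp only: power_add[of \<sigma> "e + j - (n - (a' + b') + 1)"] mult.assoc)
    also have "\<sigma> ^ (n - (a' + b') + 1) * \<beta> = 0"
      using \<beta>(1,2) bihomogeneous_primitive_iff[of a' b' \<beta>] by simp
    finally show ?thesis by simp
  qed
  have "(\<Sum>i\<in>I. f i) = (\<Sum>i\<in>I'. f i)" unfolding I'_def using assms(1) by (intro sum.mono_neutral_right) auto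
  then have "0 = \<sigma> ^ e * (\<Sum>i\<in>I'. f i)" using assms(3) by simp
  also have "\<dots> = (\<Sum>i\<in>I'. if i = (a, b, m) then \<sigma> ^ e * f i else 0)"
    unfolding sum_distrib_left by (rule sum.cong) (auto simp: kill)
  also have "\<dots> = \<sigma> ^ e * f (a, b, m)" using I'(1) i by simp
  also have "\<dots> = \<sigma> ^ (n - (a + b)) * \<alpha>"
    using \<alpha>(1) unfolding \<alpha>(3) mult.assoc[symmetric] power_add[symmetric] by (simp add: e_def)
  finally have "\<alpha> = 0"
    using \<alpha>(1,2) bigrading_grading by (intro sigma_mult_eq_0[of \<alpha> "a + b"]) (auto simp: bihomogeneous_primitive_def)
  then show False using i \<alpha>(3) by (simp add: I'_def)
qed

theorem lefschetz_decomposition: "direct_sum_decomposition lefschetz_summand"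
proof (rule direct_sum_decompositionI)
  fix i :: "nat \<times> nat \<times> nat"
  obtain a b j where i: "i = (a, b, j)" by (cases i) auto
  show "csubspace (lefschetz_summand i)"
    using subspace_bihomogeneous_primitive[of a b] unfolding i lefschetz_summand_def
    by (auto intro!: cvp.linear_subspace_image clinear_mult_left)
next
  have "lefschetz_strings k \<subseteq> (\<Union>i. lefschetz_summand i)" for k
  proof
    fix x assume "x \<in> lefschetz_strings k"
    then obtain a b j \<alpha> where "x = \<sigma> ^ j * \<alpha>" "\<alpha> \<in> bihomogeneous_primitive a b" "j + (a + b) \<le> n"
      by (auto simp: lefschetz_strings_def)
    then have "x \<in> lefschetz_summand (a, b, j)" by (auto simp: lefschetz_summand_def)
    then show "x \<in> (\<Union>i. lefschetz_summand i)" by blast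
  qed
  then have "\<Omega> k \<subseteq> cspan (\<Union>i. lefschetz_summand i)" for k
    using lefschetz_spanning cvs.span_mono by blast
  then have "cspan (\<Union>k. \<Omega> k) \<subseteq> cspan (\<Union>i. lefschetz_summand i)"
    by (intro cvs.span_minimal cvs.subspace_span) blast
  then show "cspan (\<Union>i. lefschetz_summand i) = UNIV" using dsd_span[OF grading] by blast
next
  fix I f i
  assume I: "finite I" "\<And>i. i \<in> I \<Longrightarrow> f i \<in> lefschetz_summand i" "(\<Sum>i\<in>I. f i) = 0" "i \<in> I"
  obtain a b j where i: "i = (a, b, j)" by (cases i) auto
  define J where "J = {i' \<in> I. fst i' + snd (snd i') = a + j \<and> fst (snd i') + snd (snd i') = b + j}"
  have c: "component \<Omega>\<^sub>2 (a + j, b + j) (f i') = (if i' \<in> J then f i' else 0)" if "i' \<in> I" for i'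
  proof -
    obtain a' b' j' where i': "i' = (a', b', j')" by (cases i') auto
    have "f i' \<in> \<Omega>\<^sub>2 (a' + j', b' + j')" using I(2)[OF that] lefschetz_summand_bidegree by (simp add: i')
    from component_homogeneous[OF bigrading this, of "(a + j, b + j)"] show ?thesis
      using that by (auto simp: J_def i')
  qed
  have "0 = component \<Omega>\<^sub>2 (a + j, b + j) (\<Sum>i\<in>I. f i)"
    by (simp add: I(3) clinearD[OF clinear_component[OF bigrading]])
  also have "\<dots> = (\<Sum>i\<in>I. if i \<in> J then f i else 0)"
    unfolding clinearD(6)[OF clinear_component[OF bigrading]] by (intro sum.cong refl c)
  also have "\<dots> = (\<Sum>i\<in>J. f i)" unfolding J_def using I(1) by (intro sum.mono_neutral_cong_right) auto
  finally have "\<forall>i\<in>J. f i = 0"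
    using I by (intro lefschetz_summand_independent_bidegree[where p = "a + j" and q = "b + j"]) (auto simp: J_def)
  moreover have "i \<in> J" using I(4) by (simp add: J_def i)
  ultimately show "f i = 0" by blast
qed

definition hodge_factor :: "nat \<Rightarrow> nat \<Rightarrow> nat \<Rightarrow> complex"
  where "hodge_factor a b j = (- 1) ^ ((a + b) * (a + b + 1) div 2) * \<i> powi (int a - int b) *
    (fact j / fact (n - j - (a + b)))"

definition hodge_spec :: "('w \<Rightarrow> 'w) \<Rightarrow> bool"
  where "hodge_spec s \<longleftrightarrow> clinear s \<and>
    (\<forall>a b j. \<forall>\<alpha>\<in>bihomogeneous_primitive a b. j + (a + b) \<le> n \<longrightarrow>
      s (\<sigma> ^ j * \<alpha>) = hodge_factor a b j *\<^sub>C (\<sigma> ^ (n - j - (a + b)) * \<alpha>))"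

lemma hodge_map_eq_The: "hodge_map \<Omega> n \<Omega>\<^sub>2 \<sigma> = (THE s. hodge_spec s)"
  unfolding hodge_map_def hodge_spec_def hodge_factor_def bihomogeneous_primitive_def lefschetz_power ..

lemma hodge_spec_ex: "\<exists>s. hodge_spec s"
proof -
  let ?inv = "\<lambda>a b j. inv_into (bihomogeneous_primitive a b) (\<lambda>\<alpha>. \<sigma> ^ j * \<alpha>)"
  define r where "r = (\<lambda>(a, b, j) x. if j + (a + b) \<le> n
    then hodge_factor a b j *\<^sub>C (\<sigma> ^ (n - j - (a + b)) * ?inv a b j x) else 0)"
  have inv: "?inv a b j (\<sigma> ^ j * \<alpha>) = \<alpha>" if "\<alpha> \<in> bihomogeneous_primitive a b" "j + (a + b) \<le> n" for a b j \<alpha>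
  proof (rule inv_into_f_f[OF inj_onI that(1)])
    fix x y assume xy: "x \<in> bihomogeneous_primitive a b" "y \<in> bihomogeneous_primitive a b" "\<sigma> ^ j * x = \<sigma> ^ j * y"
    have "csubspace (bihomogeneous_primitive a b)" using that(2) by (intro subspace_bihomogeneous_primitive) simp
    then have "x - y \<in> bihomogeneous_primitive a b" using xy(1,2) by (rule cvs.subspace_diff)
    from lefschetz_string_inj[OF this that(2)] show "x = y" using xy(3) by (simp add: right_diff_distrib)
  qed
  have r: "r (a, b, j) (\<sigma> ^ j * \<alpha>) = hodge_factor a b j *\<^sub>C (\<sigma> ^ (n - j - (a + b)) * \<alpha>)"
    if "\<alpha> \<in> bihomogeneous_primitive a b" "j + (a + b) \<le> n" for a b j \<alpha>
    using that(2) by (simp add: r_def inv[OF that])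
  have "\<exists>s. clinear s \<and> (\<forall>i. \<forall>x\<in>lefschetz_summand i. s x = r i x)"
  proof (rule dsd_linear_extension[OF lefschetz_decomposition])
    fix i x y assume x: "x \<in> lefschetz_summand i" and y: "y \<in> lefschetz_summand i"
    obtain a b j where i: "i = (a, b, j)" by (cases i) auto
    show "r i (x + y) = r i x + r i y"
    proof (cases "j + (a + b) \<le> n")
      case True
      obtain \<alpha> \<beta> where \<alpha>: "\<alpha> \<in> bihomogeneous_primitive a b" "x = \<sigma> ^ j * \<alpha>"
        and \<beta>: "\<beta> \<in> bihomogeneous_primitive a b" "y = \<sigma> ^ j * \<beta>"
        using x y True by (auto simp: i lefschetz_summand_def)
      have "\<alpha> + \<beta> \<in> bihomogeneous_primitive a b"
        using \<alpha>(1) \<beta>(1) True by (intro cvs.subspace_add subspace_bihomogeneous_primitive) auto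
      from r[OF this True] show ?thesis
        by (simp add: i \<alpha>(2) \<beta>(2) r[OF \<alpha>(1) True] r[OF \<beta>(1) True] distrib_left scaleC_add_right)
    qed (simp add: r_def i)
  next
    fix i c x assume x: "x \<in> lefschetz_summand i"
    obtain a b j where i: "i = (a, b, j)" by (cases i) auto
    show "r i (c *\<^sub>C x) = c *\<^sub>C r i x"
    proof (cases "j + (a + b) \<le> n")
      case True
      obtain \<alpha> where \<alpha>: "\<alpha> \<in> bihomogeneous_primitive a b" "x = \<sigma> ^ j * \<alpha>"
        using x True by (auto simp: i lefschetz_summand_def)
      have "c *\<^sub>C \<alpha> \<in> bihomogeneous_primitive a b"
        using \<alpha>(1) True by (intro cvs.subspace_scale subspace_bihomogeneous_primitive) auto
      from r[OF this True] show ?thesis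
        by (simp add: i \<alpha>(2) r[OF \<alpha>(1) True] mult_scaleC_right mult.commute)
    qed (simp add: r_def i)
  qed
  then obtain s where s: "clinear s" "\<And>i x. x \<in> lefschetz_summand i \<Longrightarrow> s x = r i x" by blast
  have "hodge_spec s"
    unfolding hodge_spec_def
  proof (intro conjI allI ballI impI s(1))
    fix a b j \<alpha> assume \<alpha>: "\<alpha> \<in> bihomogeneous_primitive a b" "j + (a + b) \<le> n"
    then have "\<sigma> ^ j * \<alpha> \<in> lefschetz_summand (a, b, j)" by (simp add: lefschetz_summand_def)
    then show "s (\<sigma> ^ j * \<alpha>) = hodge_factor a b j *\<^sub>C (\<sigma> ^ (n - j - (a + b)) * \<alpha>)"
      using s(2) r[OF \<alpha>] by simp
  qed
  then show ?thesis by blast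
qed

lemma lefschetz_induct:
  assumes string: "\<And>a b j \<alpha>. \<alpha> \<in> bihomogeneous_primitive a b \<Longrightarrow> j + (a + b) \<le> n \<Longrightarrow> P (\<sigma> ^ j * \<alpha>)"
    and add: "\<And>c x y. P x \<Longrightarrow> P y \<Longrightarrow> P (c *\<^sub>C x + y)" and zero: "P 0"
  shows "P x"
proof -
  have "x \<in> cspan (\<Union>i. lefschetz_summand i)" using dsd_span[OF lefschetz_decomposition] by simp
  then show ?thesis
  proof (induction rule: cvs.span_induct_alt)
    case (step c x y)
    then obtain i where "x \<in> lefschetz_summand i" by blast
    then have "P x" using string zero by (cases i) (auto simp: lefschetz_summand_def split: if_splits)
    then show ?case using add step by blast
  qed (rule zero)
qed

abbreviation hodge :: "'w \<Rightarrow> 'w"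
  where "hodge \<equiv> hodge_map \<Omega> n \<Omega>\<^sub>2 \<sigma>"

lemma hodge_spec_hodge: "hodge_spec hodge"
proof -
  have "s = s'" if s: "hodge_spec s" "hodge_spec s'" for s s'
  proof
    fix x
    note l = clinearD[OF s(1)[unfolded hodge_spec_def, THEN conjunct1]]
      clinearD[OF s(2)[unfolded hodge_spec_def, THEN conjunct1]]
    show "s x = s' x"
    proof (induction x rule: lefschetz_induct)
      case (1 a b j \<alpha>)
      then show ?case using s by (simp add: hodge_spec_def)
    qed (simp_all add: l)
  qed
  then show ?thesis unfolding hodge_map_eq_The using hodge_spec_ex theI[of hodge_spec] by metis
qed

lemma clinear_hodge: "clinear hodge"
  and hodge_string: "\<alpha> \<in> bihomogeneous_primitive a b \<Longrightarrow> j + (a + b) \<le> n \<Longrightarrow>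
    hodge (\<sigma> ^ j * \<alpha>) = hodge_factor a b j *\<^sub>C (\<sigma> ^ (n - j - (a + b)) * \<alpha>)"
  using hodge_spec_hodge by (auto simp: hodge_spec_def)

lemma hodge_degree:
  assumes "x \<in> \<Omega> k" shows "hodge x \<in> \<Omega> (2 * n - k)"
  using lefschetz_spanning[OF assms]
proof (induction rule: cvs.span_induct_alt)
  case base
  show ?case by (simp add: clinearD[OF clinear_hodge] cvs.subspace_0[OF subspace_grading])
next
  case (step c x y)
  then obtain a b j \<alpha> where \<alpha>: "x = \<sigma> ^ j * \<alpha>" "\<alpha> \<in> bihomogeneous_primitive a b" "j + (a + b) \<le> n" "2 * j + (a + b) = k"
    by (auto simp: lefschetz_strings_def)
  have "\<alpha> \<in> \<Omega> (a + b)" using \<alpha>(2) bigrading_grading by (auto simp: bihomogeneous_primitive_def)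
  from sigma_mult_degree[OF this, of "n - j - (a + b)"] have "\<sigma> ^ (n - j - (a + b)) * \<alpha> \<in> \<Omega> (2 * n - k)"
    using \<alpha>(3,4) by (simp add: algebra_simps)
  then have "hodge x \<in> \<Omega> (2 * n - k)"
    by (simp add: \<alpha>(1) hodge_string[OF \<alpha>(2,3)] cvs.subspace_scale[OF subspace_grading])
  with step.IH show ?case
    by (simp add: clinearD[OF clinear_hodge] cvs.subspace_add[OF subspace_grading] cvs.subspace_scale[OF subspace_grading])
qed

lemma bihomogeneous_primitive_eta:
  assumes "\<alpha> \<in> bihomogeneous_primitive a b" "a + b \<le> n"
  shows "\<eta> c * \<alpha> \<in> bihomogeneous_primitive a b" "\<alpha> * \<eta> c \<in> bihomogeneous_primitive a b"
proof -
  have \<alpha>: "\<alpha> \<in> \<Omega>\<^sub>2 (a, b)" "\<sigma> ^ (n - (a + b) + 1) * \<alpha> = 0"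
    using assms bihomogeneous_primitive_iff by blast+
  have "\<sigma> ^ (n - (a + b) + 1) * (\<eta> c * \<alpha>) = \<eta> c * (\<sigma> ^ (n - (a + b) + 1) * \<alpha>)"
    by (metis sigma_power_central mult.assoc)
  then show "\<eta> c * \<alpha> \<in> bihomogeneous_primitive a b"
    using \<alpha> bigrading_mult[OF eta_bidegree \<alpha>(1), of c] by (simp add: bihomogeneous_primitive_iff[OF assms(2)])
  have "\<sigma> ^ (n - (a + b) + 1) * (\<alpha> * \<eta> c) = \<sigma> ^ (n - (a + b) + 1) * \<alpha> * \<eta> c"
    by (simp only: mult.assoc)
  then show "\<alpha> * \<eta> c \<in> bihomogeneous_primitive a b"
    using \<alpha> bigrading_mult[OF \<alpha>(1) eta_bidegree, of c] by (simp add: bihomogeneous_primitive_iff[OF assms(2)])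
qed

lemma hodge_eta_left: "hodge (\<eta> c * x) = \<eta> c * hodge x"
proof (induction x rule: lefschetz_induct)
  case (1 a b j \<alpha>)
  have "\<eta> c * (\<sigma> ^ j * \<alpha>) = \<sigma> ^ j * (\<eta> c * \<alpha>)" for j by (metis sigma_power_central mult.assoc)
  then show ?case using hodge_string[OF bihomogeneous_primitive_eta(1)[OF 1(1)] 1(2), of c] 1
    by (simp add: hodge_string mult_scaleC_right)
qed (simp_all add: distrib_left mult_scaleC_right clinearD[OF clinear_hodge])

lemma hodge_eta_right: "hodge (x * \<eta> c) = hodge x * \<eta> c"
proof (induction x rule: lefschetz_induct)
  case (1 a b j \<alpha>)
  then show ?case using hodge_string[OF bihomogeneous_primitive_eta(2)[OF 1(1)] 1(2), of c]
    by (simp add: hodge_string mult_scaleC_left mult.assoc)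
qed (simp_all add: distrib_right mult_scaleC_left clinearD[OF clinear_hodge])

end

section \<open>Covariant positive forms with values in the coideal subalgebra\<close>

definition sesquilinear :: "('m::complex_vector \<Rightarrow> 'm \<Rightarrow> 'b::complex_vector) \<Rightarrow> bool"
  where "sesquilinear g \<longleftrightarrow> (\<forall>y. conjlinear (\<lambda>x. g x y)) \<and> (\<forall>x. clinear (g x))"

lemma sesquilinearI:
  assumes "\<And>x y z. g (x + y) z = g x z + g y z" "\<And>c x z. g (c *\<^sub>C x) z = cnj c *\<^sub>C g x z"
    "\<And>x y z. g x (y + z) = g x y + g x z" "\<And>c x z. g x (c *\<^sub>C z) = c *\<^sub>C g x z"
  shows "sesquilinear g"
  unfolding sesquilinear_def conjlinear_def using assms by (intro conjI allI clinearI) auto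

lemma sesquilinearD:
  assumes "sesquilinear g"
  shows "g (x + y) z = g x z + g y z" "g (c *\<^sub>C x) z = cnj c *\<^sub>C g x z"
    "g x (y + z) = g x y + g x z" "g x (c *\<^sub>C z) = c *\<^sub>C g x z"
    "g (\<Sum>i\<in>I. f i) z = (\<Sum>i\<in>I. g (f i) z)" "g x (\<Sum>i\<in>I. f i) = (\<Sum>i\<in>I. g x (f i))" "g 0 z = 0" "g x 0 = 0"
proof -
  have l: "conjlinear (\<lambda>x. g x z)" "clinear (g x)" for x z using assms by (auto simp: sesquilinear_def)
  show "g (x + y) z = g x z + g y z" "g (c *\<^sub>C x) z = cnj c *\<^sub>C g x z"
    "g x (y + z) = g x y + g x z" "g x (c *\<^sub>C z) = c *\<^sub>C g x z"
    "g (\<Sum>i\<in>I. f i) z = (\<Sum>i\<in>I. g (f i) z)" "g x (\<Sum>i\<in>I. f i) = (\<Sum>i\<in>I. g x (f i))" "g 0 z = 0" "g x 0 = 0"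
    by (rule conjlinearD[OF l(1)] clinearD[OF l(2)])+
qed

text \<open>
  That is, \<open>\<Delta>(g(x, y)) = x\<^sub>-\<^sub>1\<^sup>* y\<^sub>-\<^sub>1 \<otimes> g(x\<^sub>0, y\<^sub>0)\<close>.
\<close>

definition covariant_form ::
    "('b::complex_vector \<Rightarrow> ('a::complex_star_algebra, 'b) tensor) \<Rightarrow> ('m::complex_vector \<Rightarrow> ('a, 'm) tensor) \<Rightarrow>
     ('m \<Rightarrow> 'm \<Rightarrow> 'b) \<Rightarrow> bool"
  where "covariant_form \<Delta>\<^sub>B \<delta> g \<longleftrightarrow>
    (\<forall>x y. \<Delta>\<^sub>B (g x y) = pair_lift (\<lambda>a x' b y'. (star a * b) \<otimes>\<^sub>C g x' y') (\<delta> x) (\<delta> y))"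

lemma pair_balanced_sesquilinear:
  assumes "sesquilinear g"
  shows "pair_balanced (\<lambda>(a::'a::complex_star_algebra) x' b y'. (star a * b) \<otimes>\<^sub>C g x' y')"
  unfolding pair_balanced_def
  by (intro conjI allI balancedI)
     (simp_all add: sesquilinearD(1-4)[OF assms] distrib_left distrib_right star_simps tens_add_left tens_add_right
      mult_scaleC_left mult_scaleC_right tens_scaleC_left tens_scaleC_right)

lemma covariant_form_sum:
  assumes "covariant_form \<Delta>\<^sub>B \<delta> g" "sesquilinear g"
    "\<delta> x = (\<Sum>i\<in>I. a i \<otimes>\<^sub>C x' i)" "\<delta> y = (\<Sum>j\<in>J. b j \<otimes>\<^sub>C y' j)"
  shows "\<Delta>\<^sub>B (g x y) = (\<Sum>i\<in>I. \<Sum>j\<in>J. (star (a i) * b j) \<otimes>\<^sub>C g (x' i) (y' j))"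
  using assms(1) unfolding covariant_form_def assms(3,4)
  by (simp add: assms(3,4) pair_lift_sum[OF pair_balanced_sesquilinear[OF assms(2)]])

lemma positive_functional_psd_form:
  fixes g :: "'m::complex_vector \<Rightarrow> 'm \<Rightarrow> 'b::complex_star_algebra" and \<phi> :: "'b \<Rightarrow> complex"
  assumes g: "sesquilinear g" "\<And>x. x \<noteq> 0 \<Longrightarrow> g x x \<in> positive_elements"
    and \<phi>: "clinear \<phi>" "\<And>b. \<phi> (star b * b) \<in> \<real>" "\<And>b. 0 \<le> Re (\<phi> (star b * b))"
  shows "psd_form (\<lambda>x y. \<phi> (g x y))"
proof (rule psd_formI)
  have "\<phi> (\<Sum>x\<leftarrow>xs. star x * x) \<in> \<real> \<and> 0 \<le> Re (\<phi> (\<Sum>x\<leftarrow>xs. star x * x))" for xs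
    by (induction xs) (auto simp: clinearD[OF \<phi>(1)] \<phi>(2,3))
  then have "\<phi> (g x x) \<in> \<real> \<and> 0 \<le> Re (\<phi> (g x x))" for x
    using g(2)[of x] by (cases "x = 0") (auto simp: positive_elements_def sesquilinearD[OF g(1)] clinearD[OF \<phi>(1)])
  then show "\<phi> (g x x) \<in> \<real>" "0 \<le> Re (\<phi> (g x x))" for x by blast+
qed (simp_all add: sesquilinearD[OF g(1)] clinearD[OF \<phi>(1)] scaleC_complex_def)

context cqga_homogeneous_space
begin

lemma clinear_haar_incl: "clinear (\<lambda>b. haar A (\<iota> b))" and clinear_counit_incl: "clinear (\<lambda>b. counit A (\<iota> b))"
  by (rule clinear_comp[OF haar_linear incl_linear], rule clinear_comp[OF counit_linear incl_linear])

lemma haar_psd_form: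
  assumes "sesquilinear g" "\<And>x. x \<noteq> 0 \<Longrightarrow> g x x \<in> positive_elements"
  shows "psd_form (\<lambda>x y. haar A (\<iota> (g x y)))"
  by (rule positive_functional_psd_form[OF assms clinear_haar_incl])
     (use haar_state in \<open>simp_all add: incl_mult incl_star\<close>)

lemma counit_psd_form:
  assumes "sesquilinear g" "\<And>x. x \<noteq> 0 \<Longrightarrow> g x x \<in> positive_elements"
  shows "psd_form (\<lambda>x y. counit A (\<iota> (g x y)))"
  by (rule positive_functional_psd_form[OF assms clinear_counit_incl])
     (simp_all add: incl_mult incl_star counit_mult counit_star complex_is_Real_iff)

lemma haar_positive_elements:
  assumes "b \<in> positive_elements" shows "haar A (\<iota> b) \<noteq> 0"
proof
  assume 0: "haar A (\<iota> b) = 0"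
  obtain xs where xs: "b = (\<Sum>x\<leftarrow>xs. star x * x)" "b \<noteq> 0" using assms by (auto simp: positive_elements_def)
  have nn: "0 \<le> Re (haar A (\<iota> (\<Sum>x\<leftarrow>xs. star x * x)))" for xs
    by (induction xs) (simp_all add: clinearD[OF haar_linear] clinearD[OF incl_linear] incl_mult incl_star haar.nonneg)
  have "Re (haar A (\<iota> (\<Sum>x\<leftarrow>xs. star x * x))) = 0 \<Longrightarrow> (\<Sum>x\<leftarrow>xs. star x * x) = 0" for xs
  proof (induction xs)
    case (Cons x xs)
    have "Re (haar A (star (\<iota> x) * \<iota> x)) + Re (haar A (\<iota> (\<Sum>x\<leftarrow>xs. star x * x))) = 0"
      using Cons.prems by (simp add: clinearD[OF haar_linear] clinearD[OF incl_linear] incl_mult incl_star)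
    then have r: "Re (haar A (star (\<iota> x) * \<iota> x)) = 0" "Re (haar A (\<iota> (\<Sum>x\<leftarrow>xs. star x * x))) = 0"
      using nn[of xs] haar.nonneg[of "\<iota> x"] by linarith+
    have "haar A (star (\<iota> x) * \<iota> x) = 0" using haar.diag_real[of "\<iota> x"] r(1) by simp
    then have "\<iota> x = 0" by (rule haar_faithful)
    then have "x = 0" using incl_inj clinearD(3)[OF incl_linear] by (metis injD)
    then show ?case using Cons.IH[OF r(2)] by simp
  qed simp
  then show False using xs 0 by simp
qed

lemma haar_form_definite:
  assumes "\<And>x. x \<noteq> 0 \<Longrightarrow> g x x \<in> positive_elements" "haar A (\<iota> (g x x)) = 0"
  shows "x = 0"
  using assms haar_positive_elements by blast

lemma covariant_form_invariant:
  assumes "covariant_form \<Delta>\<^sub>B \<delta> g" "sesquilinear g" "psd_form (\<lambda>x y. haar A (\<iota> (g x y)))"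
  shows "invariant_form A \<delta> (\<lambda>x y. haar A (\<iota> (g x y)))"
  unfolding invariant_form_def
proof (intro allI)
  fix x y
  obtain P f where P: "\<delta> x = (\<Sum>p\<in>P. p \<otimes>\<^sub>C f p)" using tensor_expansion_UNIV by blast
  obtain Q k where Q: "\<delta> y = (\<Sum>q\<in>Q. q \<otimes>\<^sub>C k q)" using tensor_expansion_UNIV by blast
  have "\<Delta>\<^sub>B (g x y) = (\<Sum>i\<in>P \<times> Q. (star (fst i) * snd i) \<otimes>\<^sub>C g (f (fst i)) (k (snd i)))"
    by (simp add: covariant_form_sum[OF assms(1,2) P Q] sum.cartesian_product')
  from haar_left[OF coideal_sum[OF this]]
  show "pair_lift (\<lambda>a x' b y'. haar A (\<iota> (g x' y')) *\<^sub>C (star a * b)) (\<delta> x) (\<delta> y) = haar A (\<iota> (g x y)) *\<^sub>C 1"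
    by (simp add: P Q pair_lift_sum[OF psd_form.pair_balanced_form[OF assms(3)]] sum.cartesian_product')
qed

lemma coideal_one: "\<Delta>\<^sub>B 1 = 1 \<otimes>\<^sub>C 1"
  by (rule tmap_inj_right[OF incl_linear incl_inj]) (simp add: coideal incl_one comult_one tmap_idl[OF incl_linear])

lemma coideal_star_sum:
  assumes "\<Delta>\<^sub>B b = (\<Sum>i\<in>I. x i \<otimes>\<^sub>C y i)" shows "\<Delta>\<^sub>B (star b) = (\<Sum>i\<in>I. star (x i) \<otimes>\<^sub>C star (y i))"
proof (rule tmap_inj_right[OF incl_linear incl_inj])
  have "comult A (\<iota> (star b)) = (\<Sum>i\<in>I. star (x i) \<otimes>\<^sub>C \<iota> (star (y i)))"
    using comult_star_sum[OF coideal_sum[OF assms]] by (simp add: incl_star)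
  then show "tmap id \<iota> (\<Delta>\<^sub>B (star b)) = tmap id \<iota> (\<Sum>i\<in>I. star (x i) \<otimes>\<^sub>C star (y i))"
    by (simp add: coideal clinearD[OF clinear_tmap[OF clinear_id incl_linear]] tmap_idl[OF incl_linear])
qed

end

section \<open>Covariance of the metric\<close>

lemma cbilinear_tmult: "cbilinear (tmult :: ('a::complex_algebra_1, 'b::complex_algebra_1) tensor \<Rightarrow> _)"
proof -
  have "cbilinear (pair_lift (\<lambda>(u::'a) (v::'b) u' v'. (u * u') \<otimes>\<^sub>C (v * v')))"
    by (intro cbilinear_pair_lift; rule cbilinearI)
       (simp_all add: distrib_left distrib_right mult_scaleC_left mult_scaleC_right tens_add_left tens_add_right
        tens_scaleC_left tens_scaleC_right)
  then show ?thesis by (simp add: pair_lift_def[abs_def] tmult_def[abs_def])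
qed

lemma tmult_linear: "clinear (tmult s)" "clinear (\<lambda>s. tmult s t)"
  using cbilinear_tmult by (auto simp: cbilinear_def)

lemma tmult_tens: "tmult (a \<otimes>\<^sub>C x) (b \<otimes>\<^sub>C y) = (a * b) \<otimes>\<^sub>C (x * y)"
  using tmult_sum[of "\<lambda>_. a" "\<lambda>_. x" "{()}" "\<lambda>_. b" "\<lambda>_. y" "{()}"] by simp

lemma tmult_assoc: "tmult (tmult r s) t = tmult r (tmult s t)"
proof -
  obtain P f where P: "r = (\<Sum>p\<in>P. p \<otimes>\<^sub>C f p)" using tensor_expansion_UNIV by blast
  obtain Q k where Q: "s = (\<Sum>q\<in>Q. q \<otimes>\<^sub>C k q)" using tensor_expansion_UNIV by blast
  obtain R l where R: "t = (\<Sum>q\<in>R. q \<otimes>\<^sub>C l q)" using tensor_expansion_UNIV by blast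
  show ?thesis
    by (simp add: P Q R clinearD[OF tmult_linear(1)] clinearD[OF tmult_linear(2)] tmult_tens mult.assoc)
qed

lemma tmult_one: "tmult (1 \<otimes>\<^sub>C 1) t = t"
proof -
  obtain P f where P: "t = (\<Sum>p\<in>P. p \<otimes>\<^sub>C f p)" using tensor_expansion_UNIV by blast
  show ?thesis by (simp add: P clinearD[OF tmult_linear(1)] tmult_tens)
qed

lemma (in star_dc) conjlinear_st: "conjlinear st"
  by (simp add: conjlinear_def st_add st_scaleC)

context cqh_hermitian_space
begin

lemma clinear_coaction: "clinear \<delta>"
  by (rule clinear_comodule[OF forms.comodule])

lemma coaction_eta_sum: "\<Delta>\<^sub>B b = (\<Sum>i\<in>I. x i \<otimes>\<^sub>C y i) \<Longrightarrow> \<delta> (\<eta> b) = (\<Sum>i\<in>I. x i \<otimes>\<^sub>C \<eta> (y i))"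
  by (simp add: coaction_extends clinearD[OF clinear_tmap[OF clinear_id degree_zero_linear]] tmap_idl[OF degree_zero_linear])

lemma coaction_one: "\<delta> 1 = 1 \<otimes>\<^sub>C 1"
  using coaction_extends[of 1] by (simp add: degree_zero_one coideal_one tmap_idl[OF degree_zero_linear])

lemma coaction_eta_mult: "\<delta> (\<eta> b * \<nu>) = tmult (\<delta> (\<eta> b)) (\<delta> \<nu>)"
proof -
  obtain P f where P: "\<Delta>\<^sub>B b = (\<Sum>p\<in>P. p \<otimes>\<^sub>C f p)" using tensor_expansion_UNIV by blast
  obtain Q k where Q: "\<delta> \<nu> = (\<Sum>q\<in>Q. q \<otimes>\<^sub>C k q)" using tensor_expansion_UNIV by blast
  have bal: "pair_balanced (\<lambda>(a::'a) b' a' m'. (a * a') \<otimes>\<^sub>C (\<eta> b' * m'))"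
    unfolding pair_balanced_def
    by (intro conjI allI balancedI)
       (simp_all add: distrib_left distrib_right clinearD[OF degree_zero_linear] tens_add_left tens_add_right
        mult_scaleC_left mult_scaleC_right tens_scaleC_left tens_scaleC_right)
  have "\<delta> (\<eta> b * \<nu>) = pair_lift (\<lambda>a b' a' m'. (a * a') \<otimes>\<^sub>C (\<eta> b' * m')) (\<Delta>\<^sub>B b) (\<delta> \<nu>)"
    unfolding pair_lift_def by (rule forms.compatible)
  then show ?thesis by (simp add: P Q pair_lift_sum[OF bal] coaction_eta_sum[OF P] tmult_sum)
qed

text \<open>
  The forms \<open>\<omega>\<close> with this property for all \<open>\<nu>\<close> are a subalgebra. It contains \<open>B\<close>, and it contains the
  differentials of elements of \<open>B\<close> by the Leibniz rule.
\<close>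

theorem coaction_mult: "\<delta> (\<omega> * \<nu>) = tmult (\<delta> \<omega>) (\<delta> \<nu>)"
proof -
  define T where "T = {\<omega>. \<forall>\<nu>. \<delta> (\<omega> * \<nu>) = tmult (\<delta> \<omega>) (\<delta> \<nu>)}"
  note l = clinearD[OF clinear_coaction] clinearD[OF tmult_linear(1)] clinearD[OF tmult_linear(2)]
  have "T = UNIV"
  proof (rule generated)
    show "csubspace T" by (rule cvs.subspaceI) (simp_all add: T_def l distrib_right mult_scaleC_left)
    show "1 \<in> T" by (simp add: T_def coaction_one tmult_one)
    show "x * y \<in> T" if "x \<in> T" "y \<in> T" for x y using that by (simp add: T_def mult.assoc tmult_assoc)
    show "\<eta> b \<in> T" for b by (simp add: T_def coaction_eta_mult)
    show "d (\<eta> b) \<in> T" for b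
    proof -
      have "\<delta> (d (\<eta> b) * \<nu>) = tmult (\<delta> (d (\<eta> b))) (\<delta> \<nu>)" for \<nu>
      proof -
        obtain P f where P: "\<Delta>\<^sub>B b = (\<Sum>p\<in>P. p \<otimes>\<^sub>C f p)" using tensor_expansion_UNIV by blast
        obtain Q k where Q: "\<delta> \<nu> = (\<Sum>q\<in>Q. q \<otimes>\<^sub>C k q)" using tensor_expansion_UNIV by blast
        note ld = clinearD[OF clinear_tmap[OF clinear_id d_linear]] tmap_idl[OF d_linear]
        have leib: "d (\<eta> b * \<nu>) = d (\<eta> b) * \<nu> + \<eta> b * d \<nu>" for b \<nu>
          using d_leibniz[OF eta_degree, of b \<nu>] by simp
        have "d (\<eta> b) * \<nu> = d (\<eta> b * \<nu>) - \<eta> b * d \<nu>" by (simp add: leib)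
        then have "\<delta> (d (\<eta> b) * \<nu>) = tmap id d (tmult (\<delta> (\<eta> b)) (\<delta> \<nu>)) - tmult (\<delta> (\<eta> b)) (tmap id d (\<delta> \<nu>))"
          by (simp add: l(4) d_covariant coaction_eta_mult)
        also have "\<dots> = (\<Sum>p\<in>P. \<Sum>q\<in>Q. (p * q) \<otimes>\<^sub>C d (\<eta> (f p) * k q)) - (\<Sum>p\<in>P. \<Sum>q\<in>Q. (p * q) \<otimes>\<^sub>C (\<eta> (f p) * d (k q)))"
          by (simp add: Q coaction_eta_sum[OF P] tmult_sum ld)
        also have "\<dots> = (\<Sum>p\<in>P. \<Sum>q\<in>Q. (p * q) \<otimes>\<^sub>C (d (\<eta> (f p)) * k q))"
          by (simp add: leib tens_add_right sum.distrib)
        also have "\<dots> = tmult (\<delta> (d (\<eta> b))) (\<delta> \<nu>)"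
          by (simp add: d_covariant Q coaction_eta_sum[OF P] tmult_sum ld)
        finally show ?thesis .
      qed
      then show ?thesis by (simp add: T_def)
    qed
  qed
  then show ?thesis by (auto simp: T_def)
qed

lemma coaction_mult_sum:
  "\<delta> \<omega> = (\<Sum>i\<in>I. x i \<otimes>\<^sub>C y i) \<Longrightarrow> \<delta> \<nu> = (\<Sum>j\<in>J. x' j \<otimes>\<^sub>C y' j) \<Longrightarrow>
   \<delta> (\<omega> * \<nu>) = (\<Sum>i\<in>I. \<Sum>j\<in>J. (x i * x' j) \<otimes>\<^sub>C (y i * y' j))"
  by (simp add: coaction_mult tmult_sum)

lemma bigrading_coaction: "x \<in> \<Omega>\<^sub>2 i \<Longrightarrow> \<delta> x \<in> tensor_subspace UNIV (\<Omega>\<^sub>2 i)"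
  using bigrading_covariant[of "fst i" "snd i"] by (simp add: relative_hopf_subobject_0_def)

lemma grading_coaction:
  assumes "x \<in> \<Omega> k" shows "\<delta> x \<in> tensor_subspace UNIV (\<Omega> k)"
  using assms unfolding grading_span[of k]
proof (induction rule: cvs.span_induct_alt)
  case base
  show ?case by (simp add: clinearD[OF clinear_coaction] cvs.subspace_0[OF tensor_subspace_closed])
next
  case (step c x y)
  then obtain a b where ab: "x \<in> \<Omega>\<^sub>2 (a, b)" "a + b = k" by blast
  have "tensor_subspace UNIV (\<Omega>\<^sub>2 (a, b)) \<subseteq> tensor_subspace UNIV (cspan (\<Union>{\<Omega>\<^sub>2 (a, b) | a b. a + b = k}))"
    using ab(2) by (intro tensor_subspace_mono subset_refl) (auto intro: cvs.span_base)
  then have "\<delta> x \<in> tensor_subspace UNIV (cspan (\<Union>{\<Omega>\<^sub>2 (a, b) | a b. a + b = k}))"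
    using bigrading_coaction[OF ab(1)] by blast
  then show ?case using step.IH
    by (simp add: clinearD[OF clinear_coaction] cvs.subspace_add[OF tensor_subspace_closed]
        cvs.subspace_scale[OF tensor_subspace_closed])
qed

text \<open>
  The sign in the rule for the involution of a product depends on the degrees, so the argument with
  generators is run for the span of the homogeneous forms that satisfy the claim.
\<close>

theorem coaction_st: "\<delta> (st \<omega>) = tmap star st (\<delta> \<omega>)"
proof -
  define S where "S = {\<omega>. \<delta> (st \<omega>) = tmap star st (\<delta> \<omega>)}"
  define T where "T = cspan (\<Union>k. S \<inter> \<Omega> k)"
  note l = clinearD[OF clinear_coaction] conjlinearD[OF conjlinear_st]
  note ls = add_homD[OF add_hom_conj_tmap[OF conjlinear_star conjlinear_st]] tmap_conj_tens[OF conjlinear_star conjlinear_st]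
  have scale: "tmap star st (c *\<^sub>C t) = cnj c *\<^sub>C tmap star st t" for c t
    by (induction t rule: tensor_induct)
       (simp_all add: ls scaleC_add_right scaleC_tens star_scaleC)
  have S: "csubspace S"
    by (rule cvs.subspaceI) (simp_all add: S_def l ls scale)
  have base: "x \<in> T" if "x \<in> S" "x \<in> \<Omega> k" for x k
    unfolding T_def using that by (intro cvs.span_base) blast
  have prod: "x * y \<in> S" if x: "x \<in> S" "x \<in> \<Omega> k" and y: "y \<in> S" "y \<in> \<Omega> l" for x y k l
  proof -
    obtain P f where P: "\<And>p. f p \<in> \<Omega> k" "\<delta> x = (\<Sum>p\<in>P. p \<otimes>\<^sub>C f p)"
      using tensor_independent_expansion[OF grading_coaction[OF x(2)] subspace_grading] by metis
    obtain Q g where Q: "\<And>q. g q \<in> \<Omega> l" "\<delta> y = (\<Sum>q\<in>Q. q \<otimes>\<^sub>C g q)"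
      using tensor_independent_expansion[OF grading_coaction[OF y(2)] subspace_grading] by metis
    define e :: complex where "e = (- 1) ^ (k * l)"
    have e: "(- 1) ^ (k * l) * (z :: 'w) = e *\<^sub>C z" for z
    proof -
      have "(- 1 :: 'w) ^ m * z = ((- 1) ^ m) *\<^sub>C z" for m
        by (induction m) (simp_all add: mult_scaleC_left mult.assoc scaleC_one)
      then show ?thesis by (simp add: e_def)
    qed
    have st: "\<delta> (st x) = (\<Sum>p\<in>P. star p \<otimes>\<^sub>C st (f p))" "\<delta> (st y) = (\<Sum>q\<in>Q. star q \<otimes>\<^sub>C st (g q))"
      using x(1) y(1) by (simp_all add: S_def P(2) Q(2) ls)
    have "\<delta> (st (x * y)) = e *\<^sub>C \<delta> (st y * st x)" by (simp add: st_mult[OF x(2) y(2)] e l)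
    also have "\<dots> = (\<Sum>q\<in>Q. \<Sum>p\<in>P. (star q * star p) \<otimes>\<^sub>C (e *\<^sub>C (st (g q) * st (f p))))"
      by (simp add: coaction_mult_sum[OF st(2) st(1)] cvs.scale_sum_right tens_scaleC_right)
    also have "\<dots> = (\<Sum>q\<in>Q. \<Sum>p\<in>P. star (p * q) \<otimes>\<^sub>C st (f p * g q))"
      by (simp add: st_mult[OF P(1) Q(1)] e star_mult)
    also have "\<dots> = tmap star st (\<delta> (x * y))"
      by (subst sum.swap) (simp add: coaction_mult_sum[OF P(2) Q(2)] ls)
    finally show ?thesis by (simp add: S_def)
  qed
  have eta: "\<eta> b \<in> S" for b
  proof -
    obtain P f where P: "\<Delta>\<^sub>B b = (\<Sum>p\<in>P. p \<otimes>\<^sub>C f p)" using tensor_expansion_UNIV by blast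
    show ?thesis
      by (simp add: S_def st_extends coaction_eta_sum[OF P] coaction_eta_sum[OF coideal_star_sum[OF P]] ls)
  qed
  have deta: "d (\<eta> b) \<in> S" for b
  proof -
    obtain P f where P: "\<Delta>\<^sub>B b = (\<Sum>p\<in>P. p \<otimes>\<^sub>C f p)" using tensor_expansion_UNIV by blast
    have "\<delta> (st (d (\<eta> b))) = tmap id d (\<delta> (\<eta> (star b)))" by (simp add: st_d[symmetric] st_extends d_covariant)
    also have "\<dots> = tmap star st (\<delta> (d (\<eta> b)))"
      by (simp add: d_covariant coaction_eta_sum[OF P] coaction_eta_sum[OF coideal_star_sum[OF P]] ls
          clinearD[OF clinear_tmap[OF clinear_id d_linear]] tmap_idl[OF d_linear] st_d[symmetric] st_extends)
    finally show ?thesis by (simp add: S_def)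
  qed
  have "T = UNIV"
  proof (rule generated)
    show "csubspace T" unfolding T_def by (rule cvs.subspace_span)
    have "1 \<in> S" using eta[of 1] by (simp add: degree_zero_one)
    then show "1 \<in> T" using base eta_degree[of 1] by (simp add: degree_zero_one)
    show "\<eta> b \<in> T" for b using base eta eta_degree by blast
    show "d (\<eta> b) \<in> T" for b using base deta d_degree[OF eta_degree] by blast
    fix x y assume "x \<in> T" "y \<in> T"
    have hom: "x' * y \<in> T" if "x' \<in> S" "x' \<in> \<Omega> k" for x' k
      using \<open>y \<in> T\<close> unfolding T_def[of] 
    proof (induction rule: cvs.span_induct_alt)
      case (step c y1 y2)
      then obtain l where "y1 \<in> S" "y1 \<in> \<Omega> l" by blast
      then have "x' * y1 \<in> T" using prod that grading_mult base by blast
      then show ?case using step.IH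
        by (simp add: T_def distrib_left mult_scaleC_right cvs.span_add cvs.span_scale)
    qed (simp add: cvs.span_zero)
    show "x * y \<in> T"
      using \<open>x \<in> T\<close> unfolding T_def[of]
    proof (induction rule: cvs.span_induct_alt)
      case (step c x1 x2)
      then have "x1 * y \<in> T" using hom by blast
      then show ?case using step.IH
        by (simp add: T_def distrib_right mult_scaleC_left cvs.span_add cvs.span_scale)
    qed (simp add: cvs.span_zero)
  qed
  moreover have "T \<subseteq> S" unfolding T_def by (rule cvs.span_minimal[OF _ S]) blast
  ultimately have "\<omega> \<in> S" by blast
  then show ?thesis by (simp add: S_def)
qed

lemma coaction_component: "\<delta> (component \<Omega> k \<omega>) = tmap id (component \<Omega> k) (\<delta> \<omega>)"
proof -
  note l = clinearD[OF clinear_coaction] clinearD[OF clinear_component[OF grading]]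
    clinearD[OF clinear_tmap[OF clinear_id clinear_component[OF grading]]]
  have "\<omega> \<in> cspan (\<Union>k. \<Omega> k)" using dsd_span[OF grading] by simp
  then show ?thesis
  proof (induction rule: cvs.span_induct_alt)
    case (step c x y)
    then obtain j where x: "x \<in> \<Omega> j" by blast
    obtain P f where P: "\<And>p. f p \<in> \<Omega> j" "\<delta> x = (\<Sum>p\<in>P. p \<otimes>\<^sub>C f p)"
      using tensor_independent_expansion[OF grading_coaction[OF x] subspace_grading] by metis
    have "\<delta> (component \<Omega> k x) = tmap id (component \<Omega> k) (\<delta> x)"
      by (simp add: component_homogeneous[OF grading x] P(2) l tmap_idl[OF clinear_component[OF grading]]
          component_homogeneous[OF grading P(1)] clinearD(3)[OF clinear_tens_right])
    then show ?case using step.IH by (simp add: l)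
  qed (simp add: l)
qed

lemma coaction_sigma_power: "\<delta> (\<sigma> ^ j) = 1 \<otimes>\<^sub>C \<sigma> ^ j"
  by (induction j) (simp_all add: coaction_one coaction_mult sigma_coinvariant tmult_tens)

lemma coaction_sigma_mult_sum:
  "\<delta> x = (\<Sum>i\<in>I. a i \<otimes>\<^sub>C y i) \<Longrightarrow> \<delta> (\<sigma> ^ j * x) = (\<Sum>i\<in>I. a i \<otimes>\<^sub>C (\<sigma> ^ j * y i))"
  by (simp add: coaction_mult coaction_sigma_power clinearD[OF tmult_linear(1)] tmult_tens)

text \<open>
  It suffices to consider a power of \<open>\<sigma>\<close> times a primitive form \<open>\<alpha>\<close>. As \<open>\<sigma>\<close> is coinvariant, the right
  legs of \<open>\<delta> \<alpha>\<close> are primitive of the same bidegree, and the Hodge map acts on them with the same factor.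
\<close>

theorem coaction_hodge: "\<delta> (hodge x) = tmap id hodge (\<delta> x)"
proof (induction x rule: lefschetz_induct)
  case (1 a b j \<alpha>)
  then have ab: "a + b \<le> n" by simp
  have \<alpha>: "\<alpha> \<in> \<Omega>\<^sub>2 (a, b)" "\<sigma> ^ (n - (a + b) + 1) * \<alpha> = 0"
    using 1(1) bihomogeneous_primitive_iff[OF ab] by blast+
  obtain P f where P: "finite P" "cvs.independent P" "\<And>p. f p \<in> \<Omega>\<^sub>2 (a, b)" "\<delta> \<alpha> = (\<Sum>p\<in>P. p \<otimes>\<^sub>C f p)"
    using tensor_independent_expansion[OF bigrading_coaction[OF \<alpha>(1)] subspace_bigrading] by metis
  have "(\<Sum>p\<in>P. p \<otimes>\<^sub>C (\<sigma> ^ (n - (a + b) + 1) * f p)) = \<delta> (\<sigma> ^ (n - (a + b) + 1) * \<alpha>)"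
    by (rule coaction_sigma_mult_sum[OF P(4), symmetric])
  also have "\<dots> = (\<Sum>p\<in>P. p \<otimes>\<^sub>C 0)"
    unfolding \<alpha>(2) by (simp add: clinearD[OF clinear_coaction] clinearD(3)[OF clinear_tens_right])
  finally have eq: "(\<Sum>p\<in>P. p \<otimes>\<^sub>C (\<sigma> ^ (n - (a + b) + 1) * f p)) = (\<Sum>p\<in>P. p \<otimes>\<^sub>C 0)" .
  have "\<sigma> ^ (n - (a + b) + 1) * f p = 0" if "p \<in> P" for p
    by (rule tens_left_unique[OF P(1,2) eq that])
  then have fp: "f p \<in> bihomogeneous_primitive a b" if "p \<in> P" for p
    using P(3) that bihomogeneous_primitive_iff[OF ab] by blast
  have "\<delta> (hodge (\<sigma> ^ j * \<alpha>)) = hodge_factor a b j *\<^sub>C (\<Sum>p\<in>P. p \<otimes>\<^sub>C (\<sigma> ^ (n - j - (a + b)) * f p))"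
    by (simp add: hodge_string[OF 1] clinearD[OF clinear_coaction] coaction_sigma_mult_sum[OF P(4)])
  also have "\<dots> = (\<Sum>p\<in>P. p \<otimes>\<^sub>C hodge (\<sigma> ^ j * f p))"
    unfolding cvs.scale_sum_right by (intro sum.cong refl) (simp add: hodge_string[OF fp 1(2)] tens_scaleC_right)
  also have "\<dots> = tmap id hodge (\<delta> (\<sigma> ^ j * \<alpha>))"
    by (simp add: coaction_sigma_mult_sum[OF P(4)] clinearD[OF clinear_tmap[OF clinear_id clinear_hodge]]
        tmap_idl[OF clinear_hodge])
  finally show ?case .
qed (simp_all add: clinearD[OF clinear_hodge] clinearD[OF clinear_coaction]
      clinearD[OF clinear_tmap[OF clinear_id clinear_hodge]])

text \<open>
  The metric before the identification of \<open>\<Omega>\<^sup>0\<close> with \<open>B\<close>.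
\<close>

definition metric_form :: "'w \<Rightarrow> 'w \<Rightarrow> 'w"
  where "metric_form \<omega> \<nu> = (\<Sum>k\<le>2 * n. hodge (hodge (st (component \<Omega> k \<omega>)) * component \<Omega> k \<nu>))"

abbreviation g :: "'w \<Rightarrow> 'w \<Rightarrow> 'b"
  where "g \<equiv> metric \<eta> \<Omega> st n \<Omega>\<^sub>2 \<sigma>"

lemma st_degree: "x \<in> \<Omega> k \<Longrightarrow> st x \<in> \<Omega> k"
  unfolding grading_span[of k]
proof (induction rule: cvs.span_induct_alt)
  case (step c x y)
  then obtain a b where ab: "x \<in> \<Omega>\<^sub>2 (a, b)" "a + b = k" by blast
  have "st ` \<Omega>\<^sub>2 (a, b) = \<Omega>\<^sub>2 (b, a)"
    using complex_structure_conjuncts[THEN conjunct2, THEN conjunct2, THEN conjunct2, THEN conjunct2, THEN conjunct1] by simp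
  then have mem: "st x \<in> \<Omega>\<^sub>2 (b, a)" using ab(1) by blast
  have "\<Omega>\<^sub>2 (b, a) \<in> {\<Omega>\<^sub>2 (a, b) | a b. a + b = k}"
    using ab(2) by (intro CollectI exI[of _ b] exI[of _ a]) simp
  then have "st x \<in> cspan (\<Union>{\<Omega>\<^sub>2 (a, b) | a b. a + b = k})"
    using mem by (intro cvs.span_base UnionI)
  then show ?case using step.IH by (simp add: st_add st_scaleC cvs.span_add cvs.span_scale)
qed (simp add: conjlinearD[OF conjlinear_st] cvs.span_zero)

lemma metric_summand_degree:
  assumes "k \<le> 2 * n"
  shows "hodge (hodge (st (component \<Omega> k \<omega>)) * component \<Omega> k \<nu>) \<in> \<Omega> 0"
proof -
  have "hodge (st (component \<Omega> k \<omega>)) \<in> \<Omega> (2 * n - k)"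
    by (intro hodge_degree st_degree component_mem[OF grading])
  from grading_mult[OF this component_mem[OF grading, of k \<nu>]]
  have "hodge (st (component \<Omega> k \<omega>)) * component \<Omega> k \<nu> \<in> \<Omega> (2 * n)" using assms by simp
  from hodge_degree[OF this] show ?thesis by simp
qed

lemma eta_metric: "\<eta> (g \<omega> \<nu>) = metric_form \<omega> \<nu>"
proof -
  have "\<eta> (the_inv \<eta> x) = x" if "x \<in> \<Omega> 0" for x
    using that degree_zero_range by (intro f_the_inv_into_f[OF degree_zero_inj]) simp
  then show ?thesis
    unfolding metric_def metric_form_def clinearD(6)[OF degree_zero_linear]
    by (intro sum.cong refl) (simp add: metric_summand_degree)
qed

lemma eta_eqI: "\<eta> x = \<eta> y \<Longrightarrow> x = y"
  by (rule injD[OF degree_zero_inj])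

lemma sesquilinear_metric_form: "sesquilinear metric_form"
  by (rule sesquilinearI)
     (simp_all add: metric_form_def clinearD[OF clinear_component[OF grading]] st_add st_scaleC
      clinearD[OF clinear_hodge] distrib_left distrib_right mult_scaleC_left mult_scaleC_right sum.distrib
      cvs.scale_sum_right)

lemma sesquilinear_metric: "sesquilinear g"
  by (rule sesquilinearI; rule eta_eqI)
     (simp_all add: eta_metric clinearD[OF degree_zero_linear] sesquilinearD[OF sesquilinear_metric_form])

lemma component_mult_eta: "component \<Omega> k (x * \<eta> c) = component \<Omega> k x * \<eta> c"
proof -
  note l = clinearD[OF clinear_component[OF grading]]
  have "x \<in> cspan (\<Union>k. \<Omega> k)" using dsd_span[OF grading] by simp
  then show ?thesis
  proof (induction rule: cvs.span_induct_alt)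
    case (step a x y)
    then obtain j where x: "x \<in> \<Omega> j" by blast
    have "x * \<eta> c \<in> \<Omega> j" using grading_mult[OF x eta_degree] by simp
    then have "component \<Omega> k (x * \<eta> c) = component \<Omega> k x * \<eta> c"
      by (simp add: component_homogeneous[OF grading] x component_homogeneous[OF grading, of _ j])
    then show ?case using step.IH by (simp add: l distrib_right mult_scaleC_left)
  qed (simp add: l)
qed

lemma metric_right: "g \<omega> (\<nu> * \<eta> b) = g \<omega> \<nu> * b"
  by (rule eta_eqI)
     (simp add: eta_metric degree_zero_mult metric_form_def component_mult_eta hodge_eta_right
      mult.assoc[symmetric] sum_distrib_right)

lemma metric_left: "g (\<omega> * \<eta> b) \<nu> = star b * g \<omega> \<nu>"
proof (rule eta_eqI)
  have "st (component \<Omega> k \<omega> * \<eta> b) = \<eta> (star b) * st (component \<Omega> k \<omega>)" for k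
    using st_mult[OF component_mem[OF grading] eta_degree, of k \<omega> b] by (simp add: st_extends)
  then show "\<eta> (g (\<omega> * \<eta> b) \<nu>) = \<eta> (star b * g \<omega> \<nu>)"
    by (simp add: eta_metric degree_zero_mult metric_form_def component_mult_eta hodge_eta_left
        mult.assoc sum_distrib_left)
qed

theorem metric_covariant: "covariant_form \<Delta>\<^sub>B \<delta> g"
  unfolding covariant_form_def
proof (intro allI)
  fix \<omega> \<nu>
  obtain P f where P: "\<delta> \<omega> = (\<Sum>p\<in>P. p \<otimes>\<^sub>C f p)" using tensor_expansion_UNIV by blast
  obtain Q h where Q: "\<delta> \<nu> = (\<Sum>q\<in>Q. q \<otimes>\<^sub>C h q)" using tensor_expansion_UNIV by blast
  note lh = clinearD[OF clinear_tmap[OF clinear_id clinear_hodge]] tmap_idl[OF clinear_hodge]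
  note lc = clinearD[OF clinear_tmap[OF clinear_id clinear_component[OF grading]]] tmap_idl[OF clinear_component[OF grading]]
  note ls = add_homD[OF add_hom_conj_tmap[OF conjlinear_star conjlinear_st]] tmap_conj_tens[OF conjlinear_star conjlinear_st]
  have 1: "\<delta> (hodge (st (component \<Omega> k \<omega>))) = (\<Sum>p\<in>P. star p \<otimes>\<^sub>C hodge (st (component \<Omega> k (f p))))" for k
    by (simp add: coaction_hodge coaction_st coaction_component P lh lc ls)
  have 2: "\<delta> (component \<Omega> k \<nu>) = (\<Sum>q\<in>Q. q \<otimes>\<^sub>C component \<Omega> k (h q))" for k
    by (simp add: coaction_component Q lc)
  have "\<delta> (metric_form \<omega> \<nu>) = (\<Sum>k\<le>2 * n. \<Sum>p\<in>P. \<Sum>q\<in>Q. (star p * q) \<otimes>\<^sub>C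
      hodge (hodge (st (component \<Omega> k (f p))) * component \<Omega> k (h q)))"
    unfolding metric_form_def clinearD(6)[OF clinear_coaction]
    by (simp add: coaction_hodge coaction_mult_sum[OF 1 2] lh)
  also have "\<dots> = (\<Sum>p\<in>P. \<Sum>q\<in>Q. (star p * q) \<otimes>\<^sub>C metric_form (f p) (h q))"
    unfolding metric_form_def clinearD(6)[OF clinear_tens_right]
    by (subst sum.swap, rule sum.cong[OF refl], subst sum.swap, rule refl)
  finally have "tmap id \<eta> (\<Delta>\<^sub>B (g \<omega> \<nu>)) = tmap id \<eta> (\<Sum>p\<in>P. \<Sum>q\<in>Q. (star p * q) \<otimes>\<^sub>C g (f p) (h q))"
    by (simp add: coaction_extends[symmetric] eta_metric clinearD[OF clinear_tmap[OF clinear_id degree_zero_linear]]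
        tmap_idl[OF degree_zero_linear])
  then have "\<Delta>\<^sub>B (g \<omega> \<nu>) = (\<Sum>p\<in>P. \<Sum>q\<in>Q. (star p * q) \<otimes>\<^sub>C g (f p) (h q))"
    by (rule tmap_inj_right[OF degree_zero_linear degree_zero_inj])
  then show "\<Delta>\<^sub>B (g \<omega> \<nu>) = pair_lift (\<lambda>a x' b y'. (star a * b) \<otimes>\<^sub>C g x' y') (\<delta> \<omega>) (\<delta> \<nu>)"
    by (simp add: P Q pair_lift_sum[OF pair_balanced_sesquilinear[OF sesquilinear_metric]])
qed

end

section \<open>The twisted forms\<close>

context weak_hermitian_module
begin

lemma ract_scaleC: "ract m (c *\<^sub>C 1) = c *\<^sub>C m"
  by (simp add: clinearD[OF ract_linear_right] ract_one)

lemma h_right_dual: "h f \<in> right_dual ract"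
  using h_bij by (auto simp: bij_betw_def)

lemma h_ract_right: "h f (ract k b) = h f k * b"
  and h_add_right: "h f (k + k') = h f k + h f k'"
  using h_right_dual[of f] by (auto simp: right_dual_def)

lemma h_ract_left: "h (ract f b) k = star b * h f k"
  using h_left[of f "star b"] by (simp add: star_star)

lemma h_lact_left: "h (lact b f) k = h f (lact (star b) k)"
  using h_right[of "star b" f] by (simp add: star_star)

lemma sesquilinear_h: "sesquilinear h"
proof (rule sesquilinearI)
  show "h (x + y) z = h x z + h y z" for x y z by (simp add: h_add)
  show "h (c *\<^sub>C x) z = cnj c *\<^sub>C h x z" for c x z
    using h_ract_left[of x "c *\<^sub>C 1" z]
    by (simp add: ract_scaleC star_scaleC star_one mult_scaleC_left)
  show "h x (y + z) = h x y + h x z" for x y z by (rule h_add_right)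
  show "h x (c *\<^sub>C z) = c *\<^sub>C h x z" for c x z
    using h_ract_right[of x z "c *\<^sub>C 1"] by (simp add: ract_scaleC mult_scaleC_right)
qed

text \<open>
  The form identifies the module with its right dual, so every right module map has an adjoint.
\<close>

lemma adjoint_exists:
  assumes "\<And>x y. L (x + y) = L x + L y" "\<And>x b. L (ract x b) = ract (L x) b"
  shows "\<exists>x'. \<forall>y. h x (L y) = h x' y"
proof -
  have "(\<lambda>y. h x (L y)) \<in> right_dual ract"
    by (simp add: right_dual_def assms h_ract_right h_add_right)
  then have "(\<lambda>y. h x (L y)) \<in> range h" using h_bij by (simp add: bij_betw_def)
  then obtain x' where "(\<lambda>y. h x (L y)) = h x'" by blast
  then show ?thesis by (metis)
qed

end

lemma tensor_pair_add_hom_eqI: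
  assumes "\<And>t. add_hom (\<lambda>s. F s t)" "\<And>s. add_hom (F s)" "\<And>t. add_hom (\<lambda>s. F' s t)" "\<And>s. add_hom (F' s)"
    and "\<And>v w v' w'. F (v \<otimes>\<^sub>C w) (v' \<otimes>\<^sub>C w') = F' (v \<otimes>\<^sub>C w) (v' \<otimes>\<^sub>C w')"
  shows "F s t = F' s t"
proof -
  have "F (v \<otimes>\<^sub>C w) t = F' (v \<otimes>\<^sub>C w) t" for v w
    by (rule tensor_add_hom_eqI[of "F (v \<otimes>\<^sub>C w)"]) (rule assms)+
  then show ?thesis by (rule tensor_add_hom_eqI[of "\<lambda>s. F s t" "\<lambda>s. F' s t", OF assms(1,3)])
qed

locale twisted_forms =
  cqh_hermitian_space A H \<iota> \<Delta>\<^sub>B \<pi> \<eta> \<Omega> d st \<delta> n \<Omega>\<^sub>2 \<sigma> +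
  F: covariant_hermitian_module A \<iota> \<Delta>\<^sub>B \<eta> "metric \<eta> \<Omega> st n \<Omega>\<^sub>2 \<sigma>" lact ract \<delta>\<^sub>F h \<tau>
  for A :: "'a::complex_star_algebra hopf"
    and H :: "'p::complex_star_algebra hopf"
    and \<iota> :: "'b::complex_star_algebra \<Rightarrow> 'a"
    and \<Delta>\<^sub>B :: "'b \<Rightarrow> ('a, 'b) tensor"
    and \<pi> :: "'a \<Rightarrow> 'p"
    and \<eta> :: "'b \<Rightarrow> 'w::complex_algebra_1"
    and \<Omega> :: "nat \<Rightarrow> 'w set"
    and d st :: "'w \<Rightarrow> 'w"
    and \<delta> :: "'w \<Rightarrow> ('a, 'w) tensor"
    and n :: nat
    and \<Omega>\<^sub>2 :: "nat \<times> nat \<Rightarrow> 'w set"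
    and \<sigma> :: 'w
    and lact :: "'b \<Rightarrow> 'm::complex_vector \<Rightarrow> 'm"
    and ract :: "'m \<Rightarrow> 'b \<Rightarrow> 'm"
    and \<delta>\<^sub>F :: "'m \<Rightarrow> ('a, 'm) tensor"
    and h :: "'m \<Rightarrow> 'm \<Rightarrow> 'b"
    and \<tau> :: "'w \<Rightarrow> 'm \<Rightarrow> 'e::complex_vector" +
  assumes balanced_product: "balanced_tensor_product (\<lambda>\<omega> b. \<omega> * \<eta> b) lact \<tau>"
begin

lemma cbilinear_tau: "cbilinear \<tau>" and surj_tau: "surj (tlift \<tau>)"
  and kernel_tau: "{t. tlift \<tau> t = 0} = cspan {(v * \<eta> b) \<otimes>\<^sub>C w - v \<otimes>\<^sub>C lact b w | v b w. True}"
  using balanced_product by (simp_all add: balanced_tensor_product_def cbilinear_def)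

lemma tau_left: "clinear (\<lambda>\<omega>. \<tau> \<omega> f)" and tau_right: "clinear (\<tau> \<omega>)"
  using cbilinear_tau by (auto simp: cbilinear_def)

lemmas tau_simps = clinearD[OF tau_left] clinearD[OF tau_right]

lemma clinear_tlift_tau: "clinear (tlift \<tau>)"
  by (rule clinear_tlift[OF cbilinear_tau])

lemma tlift_tau: "tlift \<tau> (v \<otimes>\<^sub>C w) = \<tau> v w"
  by (rule tlift_tens[OF cbilinear_balanced[OF cbilinear_tau]])

lemma tau_balanced: "\<tau> (v * \<eta> b) w = \<tau> v (lact b w)"
proof -
  have "(v * \<eta> b) \<otimes>\<^sub>C w - v \<otimes>\<^sub>C lact b w \<in> {t. tlift \<tau> t = 0}"
    unfolding kernel_tau by (rule cvs.span_base) blast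
  then show ?thesis by (simp add: clinearD[OF clinear_tlift_tau] tlift_tau)
qed

text \<open>
  The preimage chosen by \<open>blift\<close> is immaterial, since \<open>\<beta>\<close> annihilates the generators of the kernel of
  \<open>tlift \<tau>\<close>.
\<close>

lemma blift_eval:
  assumes bal: "balanced \<beta>" and B: "\<And>v b w. \<beta> (v * \<eta> b) w = \<beta> v (lact b w)"
  shows "blift \<tau> \<beta> (tlift \<tau> t) = tlift \<beta> t"
proof -
  note a = add_homD[OF add_hom_tlift[OF bal]]
  have zero: "tlift \<beta> x = 0" if "tlift \<tau> x = 0" for x
  proof -
    have "x \<in> cspan {(v * \<eta> b) \<otimes>\<^sub>C w - v \<otimes>\<^sub>C lact b w | v b w. True}"
      using that kernel_tau by blast
    then show ?thesis
    proof (induction rule: cvs.span_induct_alt)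
      case (step c x y)
      then obtain v b w where x: "x = (v * \<eta> b) \<otimes>\<^sub>C w - v \<otimes>\<^sub>C lact b w" by blast
      have "c *\<^sub>C x = ((c *\<^sub>C v) * \<eta> b) \<otimes>\<^sub>C w - (c *\<^sub>C v) \<otimes>\<^sub>C lact b w"
        by (simp add: x cvs.scale_right_diff_distrib scaleC_tens mult_scaleC_left)
      then have "tlift \<beta> (c *\<^sub>C x) = 0" using B[of "c *\<^sub>C v" b w] by (simp add: a tlift_tens[OF bal])
      then show ?case using step.IH by (simp add: a)
    qed (simp add: a)
  qed
  define t' where "t' = (SOME t'. tlift \<tau> t' = tlift \<tau> t)"
  have "tlift \<tau> t' = tlift \<tau> t" unfolding t'_def by (rule someI) (rule refl)
  then have "tlift \<beta> (t' - t) = 0" by (intro zero) (simp add: clinearD[OF clinear_tlift_tau])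
  then show ?thesis by (simp add: blift_def t'_def[symmetric] a)
qed

lemma blift_tau:
  assumes "balanced \<beta>" "\<And>v b w. \<beta> (v * \<eta> b) w = \<beta> v (lact b w)"
  shows "blift \<tau> \<beta> (\<tau> v w) = \<beta> v w"
  using blift_eval[OF assms, of "v \<otimes>\<^sub>C w"] by (simp add: tlift_tau tlift_tens[OF assms(1)])

lemma tau_induct:
  assumes "\<And>v w. P (\<tau> v w)" "\<And>x y. P x \<Longrightarrow> P y \<Longrightarrow> P (x + y)"
  shows "P x"
proof -
  obtain t where t: "x = tlift \<tau> t" using surj_tau by blast
  show ?thesis unfolding t
    by (induction t rule: tensor_induct) (simp_all add: tlift_tau assms clinearD[OF clinear_tlift_tau])
qed

abbreviation lactE :: "'b \<Rightarrow> 'e \<Rightarrow> 'e"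
  where "lactE b \<equiv> blift \<tau> (\<lambda>\<omega> f. \<tau> (\<eta> b * \<omega>) f)"

abbreviation ractE :: "'e \<Rightarrow> 'b \<Rightarrow> 'e"
  where "ractE e b \<equiv> blift \<tau> (\<lambda>\<omega> f. \<tau> \<omega> (ract f b)) e"

abbreviation G :: "'e \<Rightarrow> 'e \<Rightarrow> 'b"
  where "G \<equiv> twisted_metric g lact h \<tau>"

definition Lmult :: "'w \<Rightarrow> 'e \<Rightarrow> 'e"
  where "Lmult \<omega> = blift \<tau> (\<lambda>\<nu> f. \<tau> (\<omega> * \<nu>) f)"

lemma cbilinear_Lmult: "cbilinear (\<lambda>\<nu> f. \<tau> (\<omega> * \<nu>) f)"
  by (rule cbilinearI) (simp_all add: tau_simps distrib_left mult_scaleC_right)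

lemma Lmult_tlift: "Lmult \<omega> (tlift \<tau> t) = tlift (\<lambda>\<nu> f. \<tau> (\<omega> * \<nu>) f) t"
  unfolding Lmult_def
  by (rule blift_eval[OF cbilinear_balanced[OF cbilinear_Lmult]]) (simp add: mult.assoc[symmetric] tau_balanced)

lemma Lmult_tau: "Lmult \<omega> (\<tau> \<nu> f) = \<tau> (\<omega> * \<nu>) f"
  unfolding Lmult_def
  by (rule blift_tau[OF cbilinear_balanced[OF cbilinear_Lmult]]) (simp add: mult.assoc[symmetric] tau_balanced)

lemma clinear_Lmult: "clinear (Lmult \<omega>)"
proof (rule clinearI)
  note l = clinearD[OF clinear_tlift[OF cbilinear_Lmult]] clinearD[OF clinear_tlift_tau]
  fix x y c
  obtain s t where s: "x = tlift \<tau> s" and t: "y = tlift \<tau> t" using surj_tau by blast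
  show "Lmult \<omega> (x + y) = Lmult \<omega> x + Lmult \<omega> y"
    unfolding s t clinearD(1)[OF clinear_tlift_tau, symmetric] Lmult_tlift by (simp add: l)
  show "Lmult \<omega> (c *\<^sub>C x) = c *\<^sub>C Lmult \<omega> x"
    unfolding s clinearD(2)[OF clinear_tlift_tau, symmetric] Lmult_tlift by (simp add: l)
qed

lemma lactE_eq: "lactE b = Lmult (\<eta> b)"
  by (simp add: Lmult_def)

lemma lactE_tau: "lactE b (\<tau> \<nu> f) = \<tau> (\<eta> b * \<nu>) f"
  by (simp add: lactE_eq Lmult_tau)

lemma ractE_tau: "ractE (\<tau> \<nu> f) b = \<tau> \<nu> (ract f b)"
proof (rule blift_tau[OF cbilinear_balanced])
  show "cbilinear (\<lambda>\<omega> f. \<tau> \<omega> (ract f b))"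
    by (rule cbilinearI) (simp_all add: tau_simps clinearD[OF F.ract_linear_left])
qed (simp add: tau_balanced F.lact_ract)

lemma ractE_add: "ractE (x + y) b = ractE x b + ractE y b"
  by (rule clinearD(1)[OF F.twisted.ract_linear_left])

lemma Lmult_ractE: "Lmult \<omega> (ractE x b) = ractE (Lmult \<omega> x) b"
  by (induction x rule: tau_induct) (simp_all add: ractE_tau Lmult_tau ractE_add clinearD[OF clinear_Lmult])

lemmas sesquilinear_G = F.twisted.sesquilinear_h

lemma G_tau: "G (\<tau> \<omega> f) (\<tau> \<nu> k) = h f (lact (g \<omega> \<nu>) k)"
proof -
  note hs = sesquilinearD[OF F.sesquilinear_h]
  note gs = sesquilinearD[OF sesquilinear_metric]
  note ll = clinearD[OF F.lact_linear_left] clinearD[OF F.lact_linear_right]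
  have inner: "balanced (\<lambda>\<nu> k. h f (lact (g \<omega> \<nu>) k))" for \<omega> f
    by (rule balancedI) (simp_all add: hs gs ll)
  have innerB: "h f (lact (g \<omega> (\<nu> * \<eta> b)) k) = h f (lact (g \<omega> \<nu>) (lact b k))" for \<omega> \<nu> f b k
    by (simp add: metric_right F.lact_mult)
  have eval: "blift \<tau> (\<lambda>\<nu> k. h f (lact (g \<omega> \<nu>) k)) (tlift \<tau> t) = tlift (\<lambda>\<nu> k. h f (lact (g \<omega> \<nu>) k)) t" for \<omega> f t
    by (rule blift_eval[OF inner innerB])
  have add: "tlift (\<lambda>\<nu> k. \<beta>1 \<nu> k + \<beta>2 \<nu> k) t = tlift \<beta>1 t + tlift \<beta>2 t" for \<beta>1 \<beta>2 :: "'w \<Rightarrow> 'm \<Rightarrow> 'b" and t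
    by (simp add: tlift_def sum.distrib)
  obtain t where t: "\<tau> \<nu> k = tlift \<tau> t" using tlift_tau by metis
  have outer: "balanced (\<lambda>\<omega> f. blift \<tau> (\<lambda>\<nu> k. h f (lact (g \<omega> \<nu>) k)) (\<tau> \<nu> k))"
    unfolding t eval
  proof (rule balancedI)
    fix v v' w w' c
    show "tlift (\<lambda>\<nu> k. h w (lact (g (v + v') \<nu>) k)) t = tlift (\<lambda>\<nu> k. h w (lact (g v \<nu>) k)) t + tlift (\<lambda>\<nu> k. h w (lact (g v' \<nu>) k)) t"
      by (simp add: gs hs ll add)
    show "tlift (\<lambda>\<nu> k. h (w + w') (lact (g v \<nu>) k)) t = tlift (\<lambda>\<nu> k. h w (lact (g v \<nu>) k)) t + tlift (\<lambda>\<nu> k. h w' (lact (g v \<nu>) k)) t"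
      by (simp add: gs hs ll add)
    show "tlift (\<lambda>\<nu> k. h w (lact (g (c *\<^sub>C v) \<nu>) k)) t = tlift (\<lambda>\<nu> k. h (c *\<^sub>C w) (lact (g v \<nu>) k)) t"
      by (simp add: gs hs ll)
  qed
  have outerB: "blift \<tau> (\<lambda>\<nu> k. h w (lact (g (v * \<eta> b) \<nu>) k)) (\<tau> \<nu> k) = blift \<tau> (\<lambda>\<nu> k. h (lact b w) (lact (g v \<nu>) k)) (\<tau> \<nu> k)" for v b w
    unfolding t eval by (simp add: metric_left F.lact_mult F.h_lact_left)
  show ?thesis
    unfolding twisted_metric_def
    by (subst blift_tau[OF outer outerB]) (rule blift_tau[OF inner innerB])
qed

lemma h_covariant_form: "covariant_form \<Delta>\<^sub>B \<delta>\<^sub>F h"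
  unfolding covariant_form_def
proof (intro allI)
  fix f k
  note hs = sesquilinearD[OF F.sesquilinear_h]
  obtain P x where P: "\<delta>\<^sub>F f = (\<Sum>p\<in>P. p \<otimes>\<^sub>C x p)" using tensor_expansion_UNIV by blast
  obtain Q y where Q: "\<delta>\<^sub>F k = (\<Sum>q\<in>Q. q \<otimes>\<^sub>C y q)" using tensor_expansion_UNIV by blast
  have b1: "balanced (\<lambda>(a::'a) f'. star a \<otimes>\<^sub>C h f')"
  proof (rule balancedI)
    fix v v' :: 'a and w w' c
    show "star (v + v') \<otimes>\<^sub>C h w = star v \<otimes>\<^sub>C h w + star v' \<otimes>\<^sub>C h w" by (simp add: star_simps tens_add_left)
    have "h (w + w') = h w + h w'" by (rule ext) (simp add: hs)
    then show "star v \<otimes>\<^sub>C h (w + w') = star v \<otimes>\<^sub>C h w + star v \<otimes>\<^sub>C h w'" by (simp add: tens_add_right)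
    have "h (c *\<^sub>C w) = cnj c *\<^sub>C h w" by (rule ext) (simp add: hs scaleC_fun_def)
    then show "star (c *\<^sub>C v) \<otimes>\<^sub>C h w = star v \<otimes>\<^sub>C h (c *\<^sub>C w)"
      by (simp add: star_simps tens_scaleC_left tens_scaleC_right)
  qed
  have b2: "balanced (\<lambda>(a::'a) (\<psi>::'m \<Rightarrow> 'b). tlift (\<lambda>a' k'. (a * a') \<otimes>\<^sub>C \<psi> k') t)" for t
    unfolding tlift_def
    by (rule balancedI) (simp_all add: distrib_right tens_add_left tens_add_right sum.distrib scaleC_fun_def
        tens_scaleC_left tens_scaleC_right mult_scaleC_left)
  have b3: "balanced (\<lambda>(a'::'a) k'. (a * a') \<otimes>\<^sub>C h f' k')" for a f'
    by (rule balancedI) (simp_all add: distrib_left tens_add_left tens_add_right hs mult_scaleC_right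
        tens_scaleC_left tens_scaleC_right)
  have "\<Delta>\<^sub>B (h f k) = tlift (\<lambda>a \<psi>. tlift (\<lambda>a' k'. (a * a') \<otimes>\<^sub>C \<psi> k') (\<delta>\<^sub>F k)) (tlift (\<lambda>a f'. star a \<otimes>\<^sub>C h f') (\<delta>\<^sub>F f))"
    using F.h_covariant[of f] by (simp add: dual_coaction_def)
  also have "tlift (\<lambda>a f'. star a \<otimes>\<^sub>C h f') (\<delta>\<^sub>F f) = (\<Sum>p\<in>P. star p \<otimes>\<^sub>C h (x p))"
    by (simp only: P tlift_sum[OF b1] tlift_tens[OF b1])
  also have "tlift (\<lambda>a \<psi>. tlift (\<lambda>a' k'. (a * a') \<otimes>\<^sub>C \<psi> k') (\<delta>\<^sub>F k)) (\<Sum>p\<in>P. star p \<otimes>\<^sub>C h (x p))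
      = (\<Sum>p\<in>P. tlift (\<lambda>a' k'. (star p * a') \<otimes>\<^sub>C h (x p) k') (\<delta>\<^sub>F k))"
    by (simp only: tlift_sum[OF b2] tlift_tens[OF b2])
  also have "\<dots> = (\<Sum>p\<in>P. \<Sum>q\<in>Q. (star p * q) \<otimes>\<^sub>C h (x p) (y q))"
    by (simp only: Q tlift_sum[OF b3] tlift_tens[OF b3])
  finally show "\<Delta>\<^sub>B (h f k) = pair_lift (\<lambda>a x' b y'. (star a * b) \<otimes>\<^sub>C h x' y') (\<delta>\<^sub>F f) (\<delta>\<^sub>F k)"
    by (simp add: P Q pair_lift_sum[OF pair_balanced_sesquilinear[OF F.sesquilinear_h]])
qed

text \<open>
  Evaluation at the counit is the restriction to the fibre of \<open>E\<close> over the base point. The resulting form is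
  only semidefinite.
\<close>

definition fibre :: "'e \<Rightarrow> 'e \<Rightarrow> complex"
  where "fibre x y = counit A (\<iota> (G x y))"

lemma fibre_psd_form: "psd_form fibre"
  unfolding fibre_def[abs_def] by (rule counit_psd_form[OF sesquilinear_G F.twisted.h_positive])

sublocale fibre: psd_form fibre
  by (rule fibre_psd_form)

lemma fibre_ractE: "fibre x (ractE y b) = counit A (\<iota> b) * fibre x y"
  by (simp add: fibre_def F.twisted.h_ract_right incl_mult counit_mult)

text \<open>
  By \<open>left_action_as_right\<close> for both factors, \<open>b (\<nu> \<otimes> k)\<close> is a sum of terms \<open>(y \<otimes> z) c\<close>, and the counit maps the
  matrix of the coefficients \<open>c\<close> to \<open>\<epsilon>(b)\<close> times the identity. The coefficients \<open>c\<close> act on the right, so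
  they may be replaced by their counits.
\<close>

theorem fibre_lactE: "fibre x (lactE b y) = counit A (\<iota> b) * fibre x y"
proof (induction y rule: tau_induct)
  case (1 \<nu> k)
  have posF: "psd_form (\<lambda>x y. haar A (\<iota> (h x y)))" by (rule haar_psd_form[OF F.sesquilinear_h F.h_positive])
  have pos\<Omega>: "psd_form (\<lambda>x y. haar A (\<iota> (g x y)))" by (rule haar_psd_form[OF sesquilinear_metric positive_definite])
  note invF = covariant_form_invariant[OF h_covariant_form F.sesquilinear_h posF]
  note inv\<Omega> = covariant_form_invariant[OF metric_covariant sesquilinear_metric pos\<Omega>]
  have defF: "x = 0" if "haar A (\<iota> (h x x)) = 0" for x
    using haar_form_definite[of h x] F.h_positive that by blast
  have def\<Omega>: "x = 0" if "haar A (\<iota> (g x x)) = 0" for x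
    using haar_form_definite[of g x] positive_definite that by blast
  obtain W u where W: "corep_basis A \<delta> W u" "{\<nu>} \<subseteq> cspan W" "finite W"
    and orthW: "\<And>x y. x \<in> W \<Longrightarrow> y \<in> W \<Longrightarrow> haar A (\<iota> (g x y)) = (if x = y then 1 else 0)"
    by (rule orthonormal_corep_basis[OF forms.comodule _ pos\<Omega>, of "{\<nu>}"]) (auto intro: def\<Omega>)
  obtain W' u' where W': "corep_basis A \<delta>\<^sub>F W' u'" "{k} \<subseteq> cspan W'" "finite W'"
    and orthW': "\<And>x y. x \<in> W' \<Longrightarrow> y \<in> W' \<Longrightarrow> haar A (\<iota> (h x y)) = (if x = y then 1 else 0)"
    by (rule orthonormal_corep_basis[OF F.comodule _ posF, of "{k}"]) (auto intro: defF)
  have basis: "fibre x (\<tau> (\<eta> b * \<nu>) k) = counit A (\<iota> b) * fibre x (\<tau> \<nu> k)" if \<nu>: "\<nu> \<in> W" and k: "k \<in> W'" for \<nu> k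
  proof -
    have "\<exists>a. (\<forall>x\<in>W. \<eta> b * x = (\<Sum>y\<in>W. y * \<eta> (a x y))) \<and>
        (\<forall>x\<in>W. \<forall>y\<in>W. counit A (\<iota> (a x y)) = (if x = y then counit A (\<iota> b) else 0))"
      by (rule left_action_as_right[OF forms.relative_hopf_module_0_axioms pos\<Omega> inv\<Omega> W(1) orthW])
    then obtain a where a: "\<eta> b * \<nu> = (\<Sum>y\<in>W. y * \<eta> (a y))"
      "\<And>y. y \<in> W \<Longrightarrow> counit A (\<iota> (a y)) = (if \<nu> = y then counit A (\<iota> b) else 0)"
      using \<nu> by blast
    have "\<exists>a'. lact c k = (\<Sum>z\<in>W'. ract z (a' z)) \<and>
        (\<forall>z\<in>W'. counit A (\<iota> (a' z)) = (if k = z then counit A (\<iota> c) else 0))" for c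
    proof -
      have "\<exists>a. (\<forall>x\<in>W'. lact c x = (\<Sum>y\<in>W'. ract y (a x y))) \<and>
          (\<forall>x\<in>W'. \<forall>y\<in>W'. counit A (\<iota> (a x y)) = (if x = y then counit A (\<iota> c) else 0))"
        by (rule left_action_as_right[OF F.relative_hopf_module_0_axioms posF invF W'(1) orthW'])
      then show ?thesis using k by blast
    qed
    then obtain a' where a': "\<And>c. lact c k = (\<Sum>z\<in>W'. ract z (a' c z))"
      "\<And>c z. z \<in> W' \<Longrightarrow> counit A (\<iota> (a' c z)) = (if k = z then counit A (\<iota> c) else 0)"
      by metis
    have "\<tau> (\<eta> b * \<nu>) k = (\<Sum>y\<in>W. \<Sum>z\<in>W'. ractE (\<tau> y z) (a' (a y) z))"
      by (simp add: a(1) tau_simps tau_balanced a'(1) ractE_tau)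
    then have "fibre x (\<tau> (\<eta> b * \<nu>) k) = (\<Sum>y\<in>W. \<Sum>z\<in>W'. counit A (\<iota> (a' (a y) z)) * fibre x (\<tau> y z))"
      by (simp add: fibre.right_simps fibre_ractE)
    also have "\<dots> = (\<Sum>y\<in>W. \<Sum>z\<in>W'. if k = z then counit A (\<iota> (a y)) * fibre x (\<tau> y z) else 0)"
      by (intro sum.cong refl) (simp add: a'(2))
    also have "\<dots> = (\<Sum>y\<in>W. counit A (\<iota> (a y)) * fibre x (\<tau> y k))"
      using W'(3) k by simp
    also have "\<dots> = (\<Sum>y\<in>W. if \<nu> = y then counit A (\<iota> b) * fibre x (\<tau> y k) else 0)"
      by (intro sum.cong refl) (simp add: a(2))
    also have "\<dots> = counit A (\<iota> b) * fibre x (\<tau> \<nu> k)" using W(3) \<nu> by simp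
    finally show ?thesis .
  qed
  have lk: "clinear (\<lambda>k. fibre x (\<tau> (\<eta> b * \<nu>) k))" "clinear (\<lambda>k. counit A (\<iota> b) * fibre x (\<tau> \<nu> k))"
    and l\<nu>: "clinear (\<lambda>\<nu>. fibre x (\<tau> (\<eta> b * \<nu>) k))" "clinear (\<lambda>\<nu>. counit A (\<iota> b) * fibre x (\<tau> \<nu> k))" for \<nu> k
    by (rule clinearI; simp add: tau_simps fibre.right_simps distrib_left mult_scaleC_right scaleC_complex_def mult.left_commute)+
  have "k \<in> cspan W'" "\<nu> \<in> cspan W" using W(2) W'(2) by auto
  have "fibre x (\<tau> (\<eta> b * \<nu>) k) = counit A (\<iota> b) * fibre x (\<tau> \<nu> k)"
  proof (rule cvp.linear_eq_on[OF l\<nu> \<open>\<nu> \<in> cspan W\<close>])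
    fix \<nu> assume \<nu>: "\<nu> \<in> W"
    show "fibre x (\<tau> (\<eta> b * \<nu>) k) = counit A (\<iota> b) * fibre x (\<tau> \<nu> k)"
      by (rule cvp.linear_eq_on[OF lk \<open>k \<in> cspan W'\<close>]) (rule basis[OF \<nu>])
  qed
  then show ?case by (simp add: lactE_tau)
next
  case (2 y z)
  then show ?case by (simp add: lactE_eq clinearD[OF clinear_Lmult] fibre.right_simps distrib_left)
qed

text \<open>
  \<open>E\<close> is generated over \<open>B\<close> by finitely many elements. Their coefficients enter the fibre form through the
  counit only, so up to null vectors \<open>E\<close> is their complex span.
\<close>

theorem fibre_finite_parseval:
  "\<exists>R. finite R \<and> (\<forall>x y. fibre x y = (\<Sum>e\<in>R. fibre x e * fibre e y))"
proof -
  obtain G1 where G1: "finite G1" "\<And>m. \<exists>c. m = (\<Sum>x\<in>G1. \<eta> (c x) * x)"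
    using forms.finitely_generated by (auto simp: finitely_generated_on_def)
  obtain G2 where G2: "finite G2" "\<And>m. \<exists>c. m = (\<Sum>x\<in>G2. lact (c x) x)"
    using F.finitely_generated by (auto simp: finitely_generated_on_def)
  define X where "X = (\<lambda>(x, z). \<tau> x z) ` (G1 \<times> G2)"
  have fX: "finite X" using G1(1) G2(1) by (simp add: X_def)
  have red: "\<exists>y'\<in>cspan X. \<forall>x. fibre x y = fibre x y'" for y
  proof (induction y rule: tau_induct)
    case (1 \<nu> k)
    obtain c where c: "k = (\<Sum>z\<in>G2. lact (c z) z)" using G2(2) by blast
    have "\<exists>c'. \<nu> * \<eta> (c z) = (\<Sum>x\<in>G1. \<eta> (c' x) * x)" for z using G1(2) by blast
    then obtain c' where c': "\<And>z. \<nu> * \<eta> (c z) = (\<Sum>x\<in>G1. \<eta> (c' z x) * x)" by metis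
    have "\<tau> \<nu> k = (\<Sum>z\<in>G2. \<Sum>x\<in>G1. lactE (c' z x) (\<tau> x z))"
      unfolding c by (simp add: tau_simps tau_balanced[symmetric] c' lactE_tau)
    then have "fibre x (\<tau> \<nu> k) = fibre x (\<Sum>z\<in>G2. \<Sum>x\<in>G1. counit A (\<iota> (c' z x)) *\<^sub>C \<tau> x z)" for x
      by (simp add: fibre.right_simps fibre_lactE scaleC_complex_def)
    moreover have "(\<Sum>z\<in>G2. \<Sum>x\<in>G1. counit A (\<iota> (c' z x)) *\<^sub>C \<tau> x z) \<in> cspan X"
      by (intro cvs.span_sum cvs.span_scale cvs.span_base) (auto simp: X_def)
    ultimately show ?case by blast
  next
    case (2 y z)
    then obtain y' z' where "y' \<in> cspan X" "z' \<in> cspan X" "\<forall>x. fibre x y = fibre x y'" "\<forall>x. fibre x z = fibre x z'" by blast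
    then show ?case by (intro bexI[of _ "y' + z'"]) (simp_all add: fibre.right_simps cvs.span_add)
  qed
  obtain R where R: "finite R" "\<forall>x\<in>cspan X. \<forall>y. fibre y x = (\<Sum>e\<in>R. fibre y e * fibre e x)"
    using fibre.gram_schmidt[OF fX] by blast
  have "fibre x y = (\<Sum>e\<in>R. fibre x e * fibre e y)" for x y
  proof -
    obtain y' where y': "y' \<in> cspan X" "\<And>x. fibre x y = fibre x y'" using red[of y] by blast
    show ?thesis unfolding y'(2) using R(2) y'(1) by blast
  qed
  then show ?thesis using R(1) by blast
qed

text \<open>
  The coordinate \<open>x\<^sub>-\<^sub>1 s(e, x\<^sub>0)\<close> of \<open>x \<in> E\<close> in the direction \<open>e\<close>. Its domain is the tensor product over the
  complex numbers, on which no compatibility with the action of \<open>B\<close> has to be checked.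
\<close>

definition coord :: "'e \<Rightarrow> ('w, 'm) tensor \<Rightarrow> 'a"
  where "coord e = tlift (\<lambda>\<omega> f. pair_lift (\<lambda>a \<omega>' a' f'. fibre e (\<tau> \<omega>' f') *\<^sub>C (a * a')) (\<delta> \<omega>) (\<delta>\<^sub>F f))"

lemma coord_form_cbilinear:
  "cbilinear (\<lambda>(a'::'a) f'. fibre e (\<tau> \<omega>' f') *\<^sub>C (a * a'))"
  "cbilinear (\<lambda>(a::'a) \<omega>'. fibre e (\<tau> \<omega>' f') *\<^sub>C (a * a'))"
  by (rule cbilinearI; simp add: tau_simps fibre.right_simps distrib_left distrib_right mult_scaleC_left mult_scaleC_right
      scaleC_add_left scaleC_add_right scaleC_complex_def mult.commute)+

lemma cbilinear_coord: "cbilinear (\<lambda>\<omega> f. pair_lift (\<lambda>a \<omega>' a' f'. fibre e (\<tau> \<omega>' f') *\<^sub>C (a * a')) (\<delta> \<omega>) (\<delta>\<^sub>F f))"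
proof -
  have "cbilinear (pair_lift (\<lambda>(a::'a) \<omega>' a' f'. fibre e (\<tau> \<omega>' f') *\<^sub>C (a * a')))"
    by (intro cbilinear_pair_lift coord_form_cbilinear)
  then have p: "clinear (pair_lift (\<lambda>(a::'a) \<omega>' a' f'. fibre e (\<tau> \<omega>' f') *\<^sub>C (a * a')) v)"
    "clinear (\<lambda>v. pair_lift (\<lambda>(a::'a) \<omega>' a' f'. fibre e (\<tau> \<omega>' f') *\<^sub>C (a * a')) v w)" for v w
    by (simp_all add: cbilinear_def)
  show ?thesis unfolding cbilinear_def
    by (intro conjI allI clinear_comp[OF p(1) clinear_comodule[OF F.comodule]] clinear_comp[OF p(2) clinear_coaction])
qed

lemma clinear_coord: "clinear (coord e)"
  unfolding coord_def by (rule clinear_tlift[OF cbilinear_coord])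

lemma coord_sum:
  assumes "\<delta> \<omega> = (\<Sum>i\<in>I. a i \<otimes>\<^sub>C x i)" "\<delta>\<^sub>F f = (\<Sum>j\<in>J. b j \<otimes>\<^sub>C y j)"
  shows "coord e (\<omega> \<otimes>\<^sub>C f) = (\<Sum>i\<in>I. \<Sum>j\<in>J. fibre e (\<tau> (x i) (y j)) *\<^sub>C (a i * b j))"
  unfolding coord_def tlift_tens[OF cbilinear_balanced[OF cbilinear_coord]] assms
  by (rule pair_lift_sum[OF cbilinear_pair_balanced]) (rule coord_form_cbilinear)+

lemma sum_swap_outermost:
  "(\<Sum>r\<in>R. \<Sum>p\<in>P. \<Sum>q\<in>Q. \<Sum>t\<in>T. \<Sum>e\<in>E. f r p q t e) = (\<Sum>e\<in>E. \<Sum>r\<in>R. \<Sum>p\<in>P. \<Sum>q\<in>Q. \<Sum>t\<in>T. f r p q t e)"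
  by (rule sym, subst sum.swap, rule sum.cong[OF refl], subst sum.swap, rule sum.cong[OF refl],
      subst sum.swap, rule sum.cong[OF refl], rule sum.swap)

text \<open>
  Covariance and the counit axiom give \<open>G(x, y) = x\<^sub>-\<^sub>1\<^sup>* y\<^sub>-\<^sub>1 s(x\<^sub>0, y\<^sub>0)\<close>, and the fibre form is expanded along \<open>R\<close>.
\<close>

theorem G_coord:
  assumes R: "finite R" "\<And>x y. fibre x y = (\<Sum>e\<in>R. fibre x e * fibre e y)"
  shows "\<iota> (G (tlift \<tau> s) (tlift \<tau> t)) = (\<Sum>e\<in>R. star (coord e s) * coord e t)"
proof (rule tensor_pair_add_hom_eqI[where F = "\<lambda>s t. \<iota> (G (tlift \<tau> s) (tlift \<tau> t))"
      and F' = "\<lambda>s t. \<Sum>e\<in>R. star (coord e s) * coord e t"])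
  show "add_hom (\<lambda>s. \<iota> (G (tlift \<tau> s) (tlift \<tau> t)))" "add_hom (\<lambda>s. \<iota> (G (tlift \<tau> t') (tlift \<tau> s)))"
    "add_hom (\<lambda>s. \<Sum>e\<in>R. star (coord e s) * coord e t)" "add_hom (\<lambda>s. \<Sum>e\<in>R. star (coord e t') * coord e s)" for t t'
    by (rule add_homI; simp add: clinearD[OF clinear_tlift_tau] sesquilinearD[OF sesquilinear_G] clinearD[OF incl_linear]
        clinearD[OF clinear_coord] star_simps distrib_left distrib_right sum.distrib)+
next
  fix \<omega> f \<nu> k
  obtain P x where P: "\<delta> \<omega> = (\<Sum>p\<in>P. p \<otimes>\<^sub>C x p)" using tensor_expansion_UNIV by blast
  obtain Q y where Q: "\<delta> \<nu> = (\<Sum>q\<in>Q. q \<otimes>\<^sub>C y q)" using tensor_expansion_UNIV by blast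
  obtain S z where S: "\<delta>\<^sub>F f = (\<Sum>r\<in>S. r \<otimes>\<^sub>C z r)" using tensor_expansion_UNIV by blast
  obtain T w where T: "\<delta>\<^sub>F k = (\<Sum>t\<in>T. t \<otimes>\<^sub>C w t)" using tensor_expansion_UNIV by blast
  have bal: "pair_balanced (\<lambda>(a::'a) b' a' m'. (a * a') \<otimes>\<^sub>C lact b' m')"
    unfolding pair_balanced_def
    by (intro conjI allI balancedI)
       (simp_all add: distrib_left distrib_right clinearD[OF F.lact_linear_left] clinearD[OF F.lact_linear_right]
        tens_add_left tens_add_right mult_scaleC_left mult_scaleC_right tens_scaleC_left tens_scaleC_right)
  have g: "\<Delta>\<^sub>B (g \<omega> \<nu>) = (\<Sum>i\<in>P \<times> Q. (star (fst i) * snd i) \<otimes>\<^sub>C g (x (fst i)) (y (snd i)))"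
    by (simp add: covariant_form_sum[OF metric_covariant sesquilinear_metric P Q] sum.cartesian_product')
  have "\<delta>\<^sub>F (lact (g \<omega> \<nu>) k) = pair_lift (\<lambda>a b' a' m'. (a * a') \<otimes>\<^sub>C lact b' m') (\<Delta>\<^sub>B (g \<omega> \<nu>)) (\<delta>\<^sub>F k)"
    unfolding pair_lift_def by (rule F.compatible)
  also have "\<dots> = (\<Sum>j\<in>(P \<times> Q) \<times> T. (star (fst (fst j)) * snd (fst j) * snd j) \<otimes>\<^sub>C
      lact (g (x (fst (fst j))) (y (snd (fst j)))) (w (snd j)))"
    by (simp only: g T pair_lift_sum[OF bal]) (simp add: sum.cartesian_product')
  finally have lk: "\<delta>\<^sub>F (lact (g \<omega> \<nu>) k) = (\<Sum>j\<in>(P \<times> Q) \<times> T. (star (fst (fst j)) * snd (fst j) * snd j) \<otimes>\<^sub>C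
      lact (g (x (fst (fst j))) (y (snd (fst j)))) (w (snd j)))" .
  have "\<Delta>\<^sub>B (h f (lact (g \<omega> \<nu>) k)) = (\<Sum>i\<in>S \<times> ((P \<times> Q) \<times> T).
      (star (fst i) * (star (fst (fst (snd i))) * snd (fst (snd i)) * snd (snd i))) \<otimes>\<^sub>C
      h (z (fst i)) (lact (g (x (fst (fst (snd i)))) (y (snd (fst (snd i))))) (w (snd (snd i)))))"
    by (simp add: covariant_form_sum[OF h_covariant_form F.sesquilinear_h S lk] sum.cartesian_product')
  from incl_counit_right[OF this]
  have "\<iota> (G (\<tau> \<omega> f) (\<tau> \<nu> k)) = (\<Sum>r\<in>S. \<Sum>p\<in>P. \<Sum>q\<in>Q. \<Sum>t\<in>T.
      fibre (\<tau> (x p) (z r)) (\<tau> (y q) (w t)) *\<^sub>C (star (p * r) * (q * t)))"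
    by (simp add: G_tau fibre_def sum.cartesian_product' star_mult mult.assoc)
  also have "\<dots> = (\<Sum>r\<in>S. \<Sum>p\<in>P. \<Sum>q\<in>Q. \<Sum>t\<in>T. \<Sum>e\<in>R.
      (cnj (fibre e (\<tau> (x p) (z r))) * fibre e (\<tau> (y q) (w t))) *\<^sub>C (star (p * r) * (q * t)))"
    by (intro sum.cong refl) (subst R(2), simp add: cvs.scale_sum_left fibre.cnj_form)
  also have "\<dots> = (\<Sum>e\<in>R. \<Sum>r\<in>S. \<Sum>p\<in>P. \<Sum>q\<in>Q. \<Sum>t\<in>T.
      (cnj (fibre e (\<tau> (x p) (z r))) * fibre e (\<tau> (y q) (w t))) *\<^sub>C (star (p * r) * (q * t)))"
    by (rule sum_swap_outermost)
  also have "\<dots> = (\<Sum>e\<in>R. \<Sum>p\<in>P. \<Sum>r\<in>S. \<Sum>q\<in>Q. \<Sum>t\<in>T.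
      (cnj (fibre e (\<tau> (x p) (z r))) * fibre e (\<tau> (y q) (w t))) *\<^sub>C (star (p * r) * (q * t)))"
    by (rule sum.cong[OF refl], rule sum.swap)
  also have "\<dots> = (\<Sum>e\<in>R. star (coord e (\<omega> \<otimes>\<^sub>C f)) * coord e (\<nu> \<otimes>\<^sub>C k))"
  proof (rule sum.cong[OF refl])
    fix e
    have c: "star (coord e (\<omega> \<otimes>\<^sub>C f)) = (\<Sum>p\<in>P. \<Sum>r\<in>S. cnj (fibre e (\<tau> (x p) (z r))) *\<^sub>C star (p * r))"
      by (simp add: coord_sum[OF P S] star_simps)
    show "(\<Sum>p\<in>P. \<Sum>r\<in>S. \<Sum>q\<in>Q. \<Sum>t\<in>T.
        (cnj (fibre e (\<tau> (x p) (z r))) * fibre e (\<tau> (y q) (w t))) *\<^sub>C (star (p * r) * (q * t)))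
        = star (coord e (\<omega> \<otimes>\<^sub>C f)) * coord e (\<nu> \<otimes>\<^sub>C k)"
      by (simp only: c coord_sum[OF Q T] sum_distrib_right)
         (simp add: sum_distrib_left mult_scaleC_left mult_scaleC_right mult.commute[of "cnj _"])
  qed
  finally show "\<iota> (G (tlift \<tau> (\<omega> \<otimes>\<^sub>C f)) (tlift \<tau> (\<nu> \<otimes>\<^sub>C k)))
      = (\<Sum>e\<in>R. star (coord e (\<omega> \<otimes>\<^sub>C f)) * coord e (\<nu> \<otimes>\<^sub>C k))"
    by (simp add: tlift_tau)
qed

end

section \<open>Bounded extension to the Hilbert space\<close>

lemma cinner_scaleC_left: "cinner (a *\<^sub>C x) y = cnj a * cinner x (y::'h::chilbert_space)"
  by (metis cinner_commute cinner_scaleC_right complex_cnj_mult)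

lemma norm_scaleC: "norm (a *\<^sub>C (x::'h::chilbert_space)) = cmod a * norm x"
proof -
  have "cinner (a *\<^sub>C x) (a *\<^sub>C x) = of_real ((cmod a)\<^sup>2) * cinner x x"
    by (simp add: cinner_scaleC_left cinner_scaleC_right complex_norm_square del: of_real_power)
  then have "Re (cinner (a *\<^sub>C x) (a *\<^sub>C x)) = (cmod a)\<^sup>2 * Re (cinner x x)" by simp
  then show ?thesis by (simp add: norm_eq_sqrt_cinner real_sqrt_mult)
qed

lemma uniformly_continuous_on_dist_bound:
  fixes f :: "'i::metric_space \<Rightarrow> 'j::metric_space"
  assumes "\<And>x y. x \<in> S \<Longrightarrow> y \<in> S \<Longrightarrow> dist (f x) (f y) \<le> K * dist x y" "0 \<le> K"
  shows "uniformly_continuous_on S f"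
  unfolding uniformly_continuous_on_def
proof (intro allI impI)
  fix e :: real assume e: "e > 0"
  show "\<exists>r>0. \<forall>x\<in>S. \<forall>x'\<in>S. dist x' x < r \<longrightarrow> dist (f x') (f x) < e"
  proof (intro exI[of _ "e / (K + 1)"] conjI ballI impI)
    show "0 < e / (K + 1)" using e assms(2) by simp
    fix x x' assume x: "x \<in> S" "x' \<in> S" and d: "dist x' x < e / (K + 1)"
    have "dist (f x') (f x) \<le> K * dist x' x" by (rule assms(1)[OF x(2,1)])
    also have "\<dots> \<le> (K + 1) * dist x' x" by (simp add: distrib_right)
    also have "\<dots> < e" using d assms(2) by (simp add: pos_less_divide_eq mult.commute)
    finally show "dist (f x') (f x) < e" .
  qed
qed

lemma continuous_on_scaleC: "continuous_on UNIV (\<lambda>x::'h::chilbert_space. c *\<^sub>C x)"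
proof (rule uniformly_continuous_imp_continuous[OF uniformly_continuous_on_dist_bound])
  have "norm (c *\<^sub>C x - c *\<^sub>C y) \<le> cmod c * norm (x - y)" for x y :: 'h
    by (simp add: cvs.scale_right_diff_distrib[symmetric] norm_scaleC)
  then show "dist (c *\<^sub>C x) (c *\<^sub>C y) \<le> cmod c * dist x y" for x y :: 'h by (simp add: dist_norm)
qed simp

text \<open>
  Since \<open>L\<close> is bounded, it preserves the null vectors of \<open>ip\<close>, which are the kernel of \<open>\<kappa>\<close>. So it induces a
  uniformly continuous map on the range of \<open>\<kappa>\<close>, whose continuous extension inherits linearity and the
  bound by density.
\<close>

lemma hilbert_completion_extension:
  fixes \<kappa> :: "'e::complex_vector \<Rightarrow> 'h::chilbert_space"
  assumes \<kappa>: "hilbert_completion ip \<kappa>" and L: "clinear L"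
    and bound: "\<And>x. sqrt (Re (ip (L x) (L x))) \<le> K * sqrt (Re (ip x x))"
  shows "\<exists>T :: 'h \<Rightarrow> 'h. bounded_clinear T \<and> (\<forall>x. T (\<kappa> x) = \<kappa> (L x))"
proof -
  have l\<kappa>: "clinear \<kappa>" and dense: "closure (range \<kappa>) = UNIV"
    and n\<kappa>: "norm (\<kappa> x) = sqrt (Re (ip x x))" for x
    using \<kappa> by (simp_all add: hilbert_completion_def norm_eq_sqrt_cinner)
  have b: "norm (\<kappa> (L x)) \<le> K * norm (\<kappa> x)" for x using bound by (simp add: n\<kappa>)
  define f where "f y = \<kappa> (L (SOME x. \<kappa> x = y))" for y
  have f\<kappa>: "f (\<kappa> x) = \<kappa> (L x)" for x
  proof -
    define x' where "x' = (SOME x'. \<kappa> x' = \<kappa> x)"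
    have "\<kappa> x' = \<kappa> x" unfolding x'_def by (rule someI) (rule refl)
    then have "norm (\<kappa> (L (x' - x))) \<le> 0" using b[of "x' - x"] by (simp add: clinearD[OF l\<kappa>])
    then have "\<kappa> (L x') = \<kappa> (L x)" by (simp add: clinearD[OF l\<kappa>] clinearD[OF L])
    then show ?thesis by (simp add: f_def x'_def)
  qed
  have "uniformly_continuous_on (range \<kappa>) f"
  proof (rule uniformly_continuous_on_dist_bound)
    fix y y' assume "y \<in> range \<kappa>" "y' \<in> range \<kappa>"
    then obtain x x' where x: "y = \<kappa> x" "y' = \<kappa> x'" by blast
    have "norm (f y - f y') \<le> K * norm (y - y')"
      using b[of "x - x'"] by (simp add: x f\<kappa> clinearD[OF l\<kappa>] clinearD[OF L])
    also have "\<dots> \<le> \<bar>K\<bar> * norm (y - y')" by (intro mult_right_mono) auto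
    finally show "dist (f y) (f y') \<le> \<bar>K\<bar> * dist y y'" by (simp add: dist_norm)
  qed simp
  then obtain T where "uniformly_continuous_on (closure (range \<kappa>)) T" and T: "\<And>y. y \<in> range \<kappa> \<Longrightarrow> f y = T y"
    by (rule uniformly_continuous_on_extension_on_closure) (rule that, assumption, simp)
  then have cont: "continuous_on UNIV T" by (simp add: dense uniformly_continuous_imp_continuous)
  have T\<kappa>: "T (\<kappa> x) = \<kappa> (L x)" for x using T[of "\<kappa> x"] f\<kappa> by simp
  have contc: "continuous_on UNIV (\<lambda>x. T (g x))" if "continuous_on UNIV g" for g :: "'i::topological_space \<Rightarrow> 'h"
    using continuous_on_compose2[OF cont that] by simp
  have ext: "P y" if "closed {y. P y}" "\<And>x. P (\<kappa> x)" for P y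
  proof -
    have "closure (range \<kappa>) \<subseteq> {y. P y}" using that by (intro closure_minimal) auto
    then show ?thesis using dense by blast
  qed
  have add1: "T (\<kappa> x + y) = T (\<kappa> x) + T y" for x y
  proof (rule ext[of "\<lambda>y. T (\<kappa> x + y) = T (\<kappa> x) + T y"])
    show "closed {y. T (\<kappa> x + y) = T (\<kappa> x) + T y}"
      by (intro closed_Collect_eq contc continuous_intros cont)
    show "T (\<kappa> x + \<kappa> x') = T (\<kappa> x) + T (\<kappa> x')" for x'
      using T\<kappa>[of "x + x'"] by (simp add: clinearD[OF l\<kappa>] clinearD[OF L] T\<kappa>)
  qed
  have add: "T (x + y) = T x + T y" for x y
  proof (rule ext[of "\<lambda>x. T (x + y) = T x + T y"])
    show "closed {x. T (x + y) = T x + T y}"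
      by (intro closed_Collect_eq contc continuous_intros cont)
  qed (rule add1)
  have scale: "T (c *\<^sub>C x) = c *\<^sub>C T x" for c x
  proof (rule ext[of "\<lambda>x. T (c *\<^sub>C x) = c *\<^sub>C T x"])
    show "closed {x. T (c *\<^sub>C x) = c *\<^sub>C T x}"
      using continuous_on_compose2[OF continuous_on_scaleC cont]
      by (intro closed_Collect_eq contc continuous_on_scaleC) auto
    show "T (c *\<^sub>C \<kappa> x) = c *\<^sub>C T (\<kappa> x)" for x
      using T\<kappa>[of "c *\<^sub>C x"] by (simp add: clinearD[OF l\<kappa>] clinearD[OF L] T\<kappa>)
  qed
  have bT: "norm (T x) \<le> K * norm x" for x
  proof (rule ext[of "\<lambda>x. norm (T x) \<le> K * norm x"])
    show "closed {x. norm (T x) \<le> K * norm x}"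
      by (intro closed_Collect_le continuous_intros cont)
  qed (simp add: T\<kappa> b)
  show ?thesis
    by (intro exI[of _ T] conjI allI T\<kappa>) (auto simp: bounded_clinear_def intro!: clinearI add scale exI[of _ K] bT)
qed

section \<open>Boundedness of left multiplication by forms\<close>

context twisted_forms
begin

text \<open>
  With the adjoint of \<open>Lmult \<omega>\<close>, the left side is a value of the fibre form at \<open>y\<close>, to which the expansion
  along \<open>R\<close> applies.
\<close>

lemma fibre_Lmult:
  assumes "\<And>x y. fibre x y = (\<Sum>e\<in>R. fibre x e * fibre e y)"
  shows "fibre x (Lmult \<omega> y) = (\<Sum>e\<in>R. fibre x (Lmult \<omega> e) * fibre e y)"
proof -
  obtain x' where x': "\<And>y. G x (Lmult \<omega> y) = G x' y"
    using F.twisted.adjoint_exists[of "Lmult \<omega>" x, OF clinearD(1)[OF clinear_Lmult] Lmult_ractE] by blast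
  have "fibre x (Lmult \<omega> y) = fibre x' y" for y by (simp add: fibre_def x')
  then show ?thesis using assms[of x' y] by simp
qed

lemma Lmult_tlift_tau: "Lmult \<omega> (tlift \<tau> t) = tlift \<tau> (tmap ((*) \<omega>) id t)"
proof (induction t rule: tensor_induct)
  case (tens v w)
  show ?case by (simp add: tlift_tau Lmult_tau tmap_idr[OF clinear_mult_left])
next
  case (add s t)
  then show ?case
    by (simp add: clinearD[OF clinear_tlift_tau] clinearD[OF clinear_Lmult] clinearD[OF clinear_tmap[OF clinear_mult_left clinear_id]])
qed

lemma sum_swap_outermost3:
  "(\<Sum>p\<in>P. \<Sum>q\<in>Q. \<Sum>t\<in>T. \<Sum>e\<in>E. f p q t e) = (\<Sum>e\<in>E. \<Sum>p\<in>P. \<Sum>q\<in>Q. \<Sum>t\<in>T. f p q t e)"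
  by (rule sym, subst sum.swap, rule sum.cong[OF refl], subst sum.swap, rule sum.cong[OF refl], rule sum.swap)

text \<open>
  In coordinates, multiplication by \<open>\<omega>\<close> is a finite matrix over \<open>A\<close> that does not depend on \<open>t\<close>.
\<close>

theorem coord_Lmult:
  assumes R: "\<And>x y. fibre x y = (\<Sum>e\<in>R. fibre x e * fibre e y)"
    and \<omega>: "\<delta> \<omega> = (\<Sum>p\<in>P. p \<otimes>\<^sub>C x p)"
  shows "coord e (tmap ((*) \<omega>) id t)
    = (\<Sum>e'\<in>R. (\<Sum>p\<in>P. fibre e (Lmult (x p) e') *\<^sub>C p) * coord e' t)"
proof (rule tensor_add_hom_eqI[of "\<lambda>t. coord e (tmap ((*) \<omega>) id t)"])
  show "add_hom (\<lambda>t. coord e (tmap ((*) \<omega>) id t))"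
    by (rule add_homI) (simp add: clinearD[OF clinear_coord] clinearD[OF clinear_tmap[OF clinear_mult_left clinear_id]])
  show "add_hom (\<lambda>t. \<Sum>e'\<in>R. (\<Sum>p\<in>P. fibre e (Lmult (x p) e') *\<^sub>C p) * coord e' t)"
    by (rule add_homI) (simp add: clinearD[OF clinear_coord] distrib_left sum.distrib)
  fix \<nu> f
  obtain Q y where Q: "\<delta> \<nu> = (\<Sum>q\<in>Q. q \<otimes>\<^sub>C y q)" using tensor_expansion_UNIV by blast
  obtain S z where S: "\<delta>\<^sub>F f = (\<Sum>r\<in>S. r \<otimes>\<^sub>C z r)" using tensor_expansion_UNIV by blast
  have \<omega>\<nu>: "\<delta> (\<omega> * \<nu>) = (\<Sum>i\<in>P \<times> Q. (fst i * snd i) \<otimes>\<^sub>C (x (fst i) * y (snd i)))"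
    by (simp add: coaction_mult_sum[OF \<omega> Q] sum.cartesian_product')
  have "coord e ((\<omega> * \<nu>) \<otimes>\<^sub>C f) = (\<Sum>p\<in>P. \<Sum>q\<in>Q. \<Sum>r\<in>S. fibre e (Lmult (x p) (\<tau> (y q) (z r))) *\<^sub>C (p * (q * r)))"
    by (simp add: coord_sum[OF \<omega>\<nu> S] sum.cartesian_product' Lmult_tau mult.assoc)
  also have "\<dots> = (\<Sum>p\<in>P. \<Sum>q\<in>Q. \<Sum>r\<in>S. \<Sum>e'\<in>R.
      (fibre e (Lmult (x p) e') * fibre e' (\<tau> (y q) (z r))) *\<^sub>C (p * (q * r)))"
    by (intro sum.cong refl) (subst fibre_Lmult[OF R], rule cvs.scale_sum_left)
  also have "\<dots> = (\<Sum>e'\<in>R. \<Sum>p\<in>P. \<Sum>q\<in>Q. \<Sum>r\<in>S.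
      (fibre e (Lmult (x p) e') * fibre e' (\<tau> (y q) (z r))) *\<^sub>C (p * (q * r)))"
    by (rule sum_swap_outermost3)
  also have "\<dots> = (\<Sum>e'\<in>R. (\<Sum>p\<in>P. fibre e (Lmult (x p) e') *\<^sub>C p) * coord e' (\<nu> \<otimes>\<^sub>C f))"
    by (simp only: coord_sum[OF Q S] sum_distrib_right)
       (simp add: sum_distrib_left mult_scaleC_left mult_scaleC_right mult.commute[of "fibre _ (\<tau> _ _)"])
  finally show "coord e (tmap ((*) \<omega>) id (\<nu> \<otimes>\<^sub>C f))
      = (\<Sum>e'\<in>R. (\<Sum>p\<in>P. fibre e (Lmult (x p) e') *\<^sub>C p) * coord e' (\<nu> \<otimes>\<^sub>C f))"
    by (simp add: tmap_idr[OF clinear_mult_left])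
qed

theorem Lmult_bounded:
  "\<exists>K. \<forall>x. sqrt (Re (haar A (\<iota> (G (Lmult \<omega> x) (Lmult \<omega> x))))) \<le> K * sqrt (Re (haar A (\<iota> (G x x))))"
proof -
  obtain R where R: "finite R" "\<And>x y. fibre x y = (\<Sum>e\<in>R. fibre x e * fibre e y)"
    using fibre_finite_parseval by blast
  obtain P x where P: "\<delta> \<omega> = (\<Sum>p\<in>P. p \<otimes>\<^sub>C x p)" using tensor_expansion_UNIV by blast
  \<comment> \<open>\<open>N t\<close> is the square of the norm of \<open>tlift \<tau> t\<close>.\<close>
  define N where "N t = (\<Sum>e\<in>R. (haar.seminorm (coord e t))\<^sup>2)" for t
  have N: "Re (haar A (\<iota> (G (tlift \<tau> t) (tlift \<tau> t)))) = N t" for t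
  proof -
    have "haar A (\<iota> (G (tlift \<tau> t) (tlift \<tau> t))) = (\<Sum>e\<in>R. of_real ((haar.seminorm (coord e t))\<^sup>2))"
      unfolding G_coord[OF R] clinearD(6)[OF haar_linear] by (intro sum.cong refl haar.seminorm_square)
    then show ?thesis by (simp add: N_def)
  qed
  have N_nonneg: "0 \<le> N t" for t by (simp add: N_def sum_nonneg)
  have N_ge: "haar.seminorm (coord e t) \<le> sqrt (N t)" if "e \<in> R" for e t
    unfolding N_def using R(1) that by (intro real_le_rsqrt member_le_sum) auto
  define M where "M e e' = (\<Sum>p\<in>P. fibre e (Lmult (x p) e') *\<^sub>C p)" for e e'
  have "\<exists>k. 0 \<le> k \<and> (\<forall>x. haar.seminorm (M e e' * x) \<le> k * haar.seminorm x)" for e e'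
    using left_mult_bounded[of "M e e'"] by blast
  then obtain k where k: "\<And>e e'. 0 \<le> k e e'" "\<And>e e' x. haar.seminorm (M e e' * x) \<le> k e e' * haar.seminorm x"
    by metis
  define C where "C = (\<Sum>e\<in>R. (\<Sum>e'\<in>R. k e e')\<^sup>2)"
  have bound: "N (tmap ((*) \<omega>) id t) \<le> C * N t" for t
  proof -
    have "(haar.seminorm (coord e (tmap ((*) \<omega>) id t)))\<^sup>2 \<le> (\<Sum>e'\<in>R. k e e')\<^sup>2 * N t" for e
    proof -
      have "haar.seminorm (coord e (tmap ((*) \<omega>) id t)) \<le> (\<Sum>e'\<in>R. haar.seminorm (M e e' * coord e' t))"
        unfolding coord_Lmult[OF R(2) P] M_def by (rule haar.seminorm_sum)
      also have "\<dots> \<le> (\<Sum>e'\<in>R. k e e' * sqrt (N t))"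
        by (intro sum_mono order_trans[OF k(2)] mult_left_mono N_ge k(1))
      also have "\<dots> = (\<Sum>e'\<in>R. k e e') * sqrt (N t)" by (simp add: sum_distrib_right)
      finally have "(haar.seminorm (coord e (tmap ((*) \<omega>) id t)))\<^sup>2 \<le> ((\<Sum>e'\<in>R. k e e') * sqrt (N t))\<^sup>2"
        by (rule power_mono) (rule haar.seminorm_nonneg)
      then show ?thesis using N_nonneg by (simp add: power_mult_distrib)
    qed
    then show ?thesis
      unfolding N_def[of "tmap ((*) \<omega>) id t"] C_def sum_distrib_right by (intro sum_mono)
  qed
  have "sqrt (Re (haar A (\<iota> (G (Lmult \<omega> x) (Lmult \<omega> x))))) \<le> sqrt C * sqrt (Re (haar A (\<iota> (G x x))))" for x
  proof -
    obtain t where t: "x = tlift \<tau> t" using surj_tau by blast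
    show ?thesis using bound[of t]
      unfolding t Lmult_tlift_tau N by (simp add: real_sqrt_mult[symmetric])
  qed
  then show ?thesis by blast
qed

end

theorem proposition3p9:
  fixes A :: "'a::complex_star_algebra hopf"
    and H :: "'p::complex_star_algebra hopf"
    and \<iota> :: "'b::complex_star_algebra \<Rightarrow> 'a"
    and \<Delta>\<^sub>B :: "'b \<Rightarrow> ('a, 'b) tensor"
    and \<pi> :: "'a \<Rightarrow> 'p"
    and \<eta> :: "'b \<Rightarrow> 'w::complex_algebra_1"
    and \<Omega> :: "nat \<Rightarrow> 'w set"
    and d st :: "'w \<Rightarrow> 'w"
    and \<delta>\<^sub>\<Omega> :: "'w \<Rightarrow> ('a, 'w) tensor"
    and n :: nat
    and \<Omega>\<^sub>2 :: "nat \<times> nat \<Rightarrow> 'w set"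
    and \<sigma> :: 'w
    and lact :: "'b \<Rightarrow> 'm::complex_vector \<Rightarrow> 'm"
    and ract :: "'m \<Rightarrow> 'b \<Rightarrow> 'm"
    and \<delta>\<^sub>F :: "'m \<Rightarrow> ('a, 'm) tensor"
    and h :: "'m \<Rightarrow> 'm \<Rightarrow> 'b"
    and \<tau> :: "'w \<Rightarrow> 'm \<Rightarrow> 'e::complex_vector"
    and \<kappa> :: "'e \<Rightarrow> 'h::chilbert_space"
    and g\<^sub>F :: "'e \<Rightarrow> 'e \<Rightarrow> 'b"
    and \<omega> :: 'w
  assumes "cqh_hermitian_space A H \<iota> \<Delta>\<^sub>B \<pi> \<eta> \<Omega> d st \<delta>\<^sub>\<Omega> n \<Omega>\<^sub>2 \<sigma>"
    and "balanced_tensor_product (\<lambda>\<omega> b. \<omega> * \<eta> b) lact \<tau>"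
    and "covariant_hermitian_module A \<iota> \<Delta>\<^sub>B \<eta> (metric \<eta> \<Omega> st n \<Omega>\<^sub>2 \<sigma>) lact ract \<delta>\<^sub>F h \<tau>"
    and "g\<^sub>F = twisted_metric (metric \<eta> \<Omega> st n \<Omega>\<^sub>2 \<sigma>) lact h \<tau>"
    and "hilbert_completion (\<lambda>x y. haar A (\<iota> (g\<^sub>F x y))) \<kappa>"
  shows "\<exists>!L :: 'e \<Rightarrow> 'e. clinear L \<and>
      (\<forall>\<nu> f. L (\<tau> \<nu> f) = \<tau> (\<omega> * \<nu>) f) \<and>
      (\<exists>K. \<forall>x. sqrt (Re (haar A (\<iota> (g\<^sub>F (L x) (L x))))) \<le> K * sqrt (Re (haar A (\<iota> (g\<^sub>F x x))))) \<and>
      (\<exists>T :: 'h \<Rightarrow> 'h. bounded_clinear T \<and> (\<forall>x. T (\<kappa> x) = \<kappa> (L x)))"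
proof -
  interpret twisted_forms A H \<iota> \<Delta>\<^sub>B \<pi> \<eta> \<Omega> d st \<delta>\<^sub>\<Omega> n \<Omega>\<^sub>2 \<sigma> lact ract \<delta>\<^sub>F h \<tau>
    by (intro twisted_forms.intro twisted_forms_axioms.intro assms(1-3))
  obtain K where K: "\<And>x. sqrt (Re (haar A (\<iota> (g\<^sub>F (Lmult \<omega> x) (Lmult \<omega> x))))) \<le> K * sqrt (Re (haar A (\<iota> (g\<^sub>F x x))))"
    using Lmult_bounded[of \<omega>] unfolding assms(4) by blast
  show ?thesis
  proof (rule ex1I[of _ "Lmult \<omega>"])
    show "clinear (Lmult \<omega>) \<and> (\<forall>\<nu> f. Lmult \<omega> (\<tau> \<nu> f) = \<tau> (\<omega> * \<nu>) f) \<and>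
      (\<exists>K. \<forall>x. sqrt (Re (haar A (\<iota> (g\<^sub>F (Lmult \<omega> x) (Lmult \<omega> x))))) \<le> K * sqrt (Re (haar A (\<iota> (g\<^sub>F x x))))) \<and>
      (\<exists>T :: 'h \<Rightarrow> 'h. bounded_clinear T \<and> (\<forall>x. T (\<kappa> x) = \<kappa> (Lmult \<omega> x)))"
    proof (intro conjI)
      show "clinear (Lmult \<omega>)" by (rule clinear_Lmult)
      show "\<forall>\<nu> f. Lmult \<omega> (\<tau> \<nu> f) = \<tau> (\<omega> * \<nu>) f" by (simp add: Lmult_tau)
      show "\<exists>K. \<forall>x. sqrt (Re (haar A (\<iota> (g\<^sub>F (Lmult \<omega> x) (Lmult \<omega> x))))) \<le> K * sqrt (Re (haar A (\<iota> (g\<^sub>F x x))))"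
        by (rule exI[of _ K], rule allI, rule K)
      show "\<exists>T :: 'h \<Rightarrow> 'h. bounded_clinear T \<and> (\<forall>x. T (\<kappa> x) = \<kappa> (Lmult \<omega> x))"
        by (rule hilbert_completion_extension[OF assms(5) clinear_Lmult[of \<omega>], where K = K]) (rule K)
    qed
  next
    fix L assume L: "clinear L \<and> (\<forall>\<nu> f. L (\<tau> \<nu> f) = \<tau> (\<omega> * \<nu>) f) \<and>
      (\<exists>K. \<forall>x. sqrt (Re (haar A (\<iota> (g\<^sub>F (L x) (L x))))) \<le> K * sqrt (Re (haar A (\<iota> (g\<^sub>F x x))))) \<and>
      (\<exists>T :: 'h \<Rightarrow> 'h. bounded_clinear T \<and> (\<forall>x. T (\<kappa> x) = \<kappa> (L x)))"
    have lin: "clinear L" and L\<tau>: "L (\<tau> \<nu> f) = \<tau> (\<omega> * \<nu>) f" for \<nu> f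
      using conjunct1[OF L] conjunct1[OF conjunct2[OF L]] by simp_all
    show "L = Lmult \<omega>"
    proof
      fix x
      show "L x = Lmult \<omega> x"
        by (induction x rule: tau_induct)
           (simp_all add: Lmult_tau L\<tau> clinearD(1)[OF clinear_Lmult] clinearD(1)[OF lin])
    qed
  qed
qed

end
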